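(* Let $M\in\mathrm{Sp}(2n)$. Then $M$ has a real symplectic square root if and only if $M$ is symplectically similar to a matrix of the form $$M_0\diamond\Big(\mathop{\diamond}_{\lambda\in\Lambda}M_\lambda\Big)\diamond M_{-1}$$ (the corresponding spectral $\diamond$-decomposition, with components which do not occur in the spectrum of $M$ omitted), where $M_0$, $M_\lambda$ and $M_{-1}$ are real symplectic matrices such that: (i) $M_0$ has no eigenvalues on the negative real axis $\mathbb{R}^-=(-\infty,0)$ (no further condition is imposed on $M_0$). (ii) $\Lambda$ consists of one representative $\lambda<-1$ from each reciprocal pair $\{\lambda,\lambda^{-1}\}\subset\mathbb{R}^-\setminus\{-1\}$ of eigenvalues of $M$. For each $\lambda\in\Lambda$, the component $M_\lambda\in\mathrm{Sp}(2n_\lambda)$ has spectrum contained in $\{\lambda,\lambda^{-1}\}$, $n_\lambda$ is even, and $M_\lambda\sim N_\lambda^{\diamond 2}$ for some lower-dimensional Wonenburger matrix $N_\lambda$. (iii) $M_{-1}$ has spectrum contained in $\{-1\}$ and is symplectically similar to a matrix of the form $$\left[\begin{pmatrix}J_{m_1}(-1)&s_1K_{m_1}\\ D_1&J_{m_1}(-1)^T\end{pmatrix}\diamond\cdots\diamond\begin{pmatrix}J_{m_p}(-1)&s_pK_{m_p}\\ D_p&J_{m_p}(-1)^T\end{pmatrix}\right]^{\diamond 2}\diamond\left[\begin{pmatrix}A_1&B_1\\ C_1&A_1^T\end{pmatrix}\diamond\cdots\diamond\begin{pmatrix}A_q&B_q\\ C_q&A_q^T\end{pmatrix}\right]$$ for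 some integers $p,q\ge0$ (an empty bracket being omitted), integers $m_i\ge1$, $l_j\ge0$ and signs $s_i,t_j\in\{\pm1\}$ $(1\le i\le p,\ 1\le j\le q)$, where $$A_j=\begin{pmatrix}J_{l_j+1}(-1)&0\\ 0&J_{l_j}(-1)\end{pmatrix},\qquad B_j=\begin{pmatrix}0&0&t_jK_{l_j}\\ 0&0&0\\ t_jK_{l_j}&0&0\end{pmatrix}$$ ($B_j$ partitioned into blocks of sizes $l_j,1,l_j$), and $D_i$, $C_j$ are real symmetric matrices such that the corresponding blocks satisfy the Wonenburger relations.
   Context: $\mathrm{Sp}(2n)$ is the group of real $2n\times 2n$ matrices $M$ with $M^TJM=J$, where $J=\begin{pmatrix}0&-I_n\\ I_n&0\end{pmatrix}$. A Wonenburger matrix is a matrix $\begin{pmatrix}A&B\\ C&A^T\end{pmatrix}$ with $A,B,C$ real $n\times n$ matrices satisfying the Wonenburger relations $B=B^T$, $C=C^T$, $AB=BA^T$, $A^TC=CA$, $A^2-BC=I$ (these ensure it is symplectic). A real symplectic square root of $M\in\mathrm{Sp}(2n)$ is a matrix $X\in\mathrm{Sp}(2n)$ with $X^2=M$. $M\sim N$ (symplectic similarity) means $PMP^{-1}=N$ for some real symplectic $P$. $J_m(\lambda)$ is the $m\times m$ Jordan block with eigenvalue $\lambda$ and ones on the superdiagonal; $K_l$ is the $l\times l$ matrix with all anti-diagonal entries equal to $1$ and all other entries $0$; blocks of size $0$ are omitted (so for $l_j=0$, $A_j=(-1)$, $B_j=(0)$). For $2m_k\times 2m_k$ matrices in square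 block form $M_k=\begin{pmatrix}A_k&B_k\\ C_k&D_k\end{pmatrix}$, $k=1,2$, the $\diamond$-sum is $$M_1\diamond M_2=\begin{pmatrix}A_1&0&B_1&0\\ 0&A_2&0&B_2\\ C_1&0&D_1&0\\ 0&C_2&0&D_2\end{pmatrix},$$ and $M^{\diamond k}$ is the $k$-fold $\diamond$-sum of $M$ with itself.
   Formalization: For l_j=0 the formal statement also requires C_j=(0), so that summand is -I_2; with C_j=(c), c≠0, the Wonenburger relations still hold, but e.g. the matrix with rows (-1,0),(1,-1) has no real square root, so the "if" direction would fail. *)

theory Defs
  imports
    "Jordan_Normal_Form.Jordan_Normal_Form"
    "Jordan_Normal_Form.Spectral_Radius"
begin

definition symp_form :: "nat \<Rightarrow> real mat" where
  "symp_form n = four_block_mat (0\<^sub>m n n) (- 1\<^sub>m n) (1\<^sub>m n) (0\<^sub>m n n)"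

text \<open>The argument is half the matrix size: \<open>Sp n\<close> is the group usually written $Sp(2n)$.
  \<open>Sp 0\<close> consists of the empty matrix, which stands for an omitted component.\<close>

definition Sp :: "nat \<Rightarrow> real mat set" where
  "Sp n = {M \<in> carrier_mat (2 * n) (2 * n). transpose_mat M * symp_form n * M = symp_form n}"

text \<open>\<open>similar_mat_wit N M P Q\<close> says that all four matrices are square of the same size, that
  $Q = P^{-1}$ and that $N = P M P^{-1}$.\<close>

definition symp_similar :: "nat \<Rightarrow> real mat \<Rightarrow> real mat \<Rightarrow> bool" where
  "symp_similar n M N \<longleftrightarrow> (\<exists>P\<in>Sp n. \<exists>Q. similar_mat_wit N M P Q)"

definition symp_sqrt :: "nat \<Rightarrow> real mat \<Rightarrow> real mat \<Rightarrow> bool" where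
  "symp_sqrt n M X \<longleftrightarrow> X \<in> Sp n \<and> X * X = M"

text \<open>The eigenvalues of a real matrix are taken in the complex numbers, so that
  ``spectrum contained in'' excludes non-real eigenvalues as well.\<close>

definition cspectrum :: "real mat \<Rightarrow> complex set" where
  "cspectrum M = spectrum (map_mat complex_of_real M)"

text \<open>Meant for square matrices of even size, which are split into four blocks of equal size.\<close>

definition diamond :: "real mat \<Rightarrow> real mat \<Rightarrow> real mat" (infixl "\<diamond>" 65) where
  "M \<diamond> N =
    (let (A1, B1, C1, D1) = split_block M (dim_row M div 2) (dim_col M div 2);
         (A2, B2, C2, D2) = split_block N (dim_row N div 2) (dim_col N div 2)
     in four_block_mat (diag_block_mat [A1, A2]) (diag_block_mat [B1, B2])
                       (diag_block_mat [C1, C2]) (diag_block_mat [D1, D2]))"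

definition diamond_sum :: "real mat list \<Rightarrow> real mat" where
  "diamond_sum Ms = foldr (\<diamond>) Ms (0\<^sub>m 0 0)"

definition wonenburger_rel :: "nat \<Rightarrow> real mat \<Rightarrow> real mat \<Rightarrow> real mat \<Rightarrow> bool" where
  "wonenburger_rel n A B C \<longleftrightarrow>
     A \<in> carrier_mat n n \<and> B \<in> carrier_mat n n \<and> C \<in> carrier_mat n n \<and>
     B = transpose_mat B \<and> C = transpose_mat C \<and>
     A * B = B * transpose_mat A \<and> transpose_mat A * C = C * A \<and>
     A * A - B * C = 1\<^sub>m n"

definition wblock :: "real mat \<Rightarrow> real mat \<Rightarrow> real mat \<Rightarrow> real mat" where
  "wblock A B C = four_block_mat A B C (transpose_mat A)"

definition wonenburger :: "nat \<Rightarrow> real mat \<Rightarrow> bool" where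
  "wonenburger n N \<longleftrightarrow> (\<exists>A B C. wonenburger_rel n A B C \<and> N = wblock A B C)"

definition antidiag_mat :: "nat \<Rightarrow> real mat" where
  "antidiag_mat l = mat l l (\<lambda>(i, j). if i + j + 1 = l then 1 else 0)"

text \<open>In \<open>odd_B\<close> the blocks $t K_l$ in the two outer
  corners of a partition into sizes $l, 1, l$ fill the anti-diagonal of the whole
  $(2l+1) \times (2l+1)$ matrix except for its middle entry, which is $0$.\<close>

definition odd_A :: "nat \<Rightarrow> real mat" where
  "odd_A l = diag_block_mat [jordan_block (l + 1) (- 1), jordan_block l (- 1)]"

definition odd_B :: "nat \<Rightarrow> real \<Rightarrow> real mat" where
  "odd_B l t = mat (2 * l + 1) (2 * l + 1) (\<lambda>(i, j). if i + j = 2 * l \<and> i \<noteq> l then t else 0)"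

definition even_summand :: "real mat \<Rightarrow> bool" where
  "even_summand E \<longleftrightarrow>
     (\<exists>m s D. m \<ge> 1 \<and> s \<in> {1, - 1} \<and>
        wonenburger_rel m (jordan_block m (- 1)) (s \<cdot>\<^sub>m antidiag_mat m) D \<and>
        E = wblock (jordan_block m (- 1)) (s \<cdot>\<^sub>m antidiag_mat m) D)"

text \<open>For $l = 0$ one has $A = (-1)$ and $B = (0)$, and the Wonenburger relations hold for every
  $C = (c)$. For $c \neq 0$ the block is then a single Jordan block of size $2$ for the
  eigenvalue $-1$, which has no real square root at all, so that the
  degenerate summand has to be read as $-I_2$, that is $C = (0)$.
  For $l \ge 1$ no condition beyond the Wonenburger relations is imposed.\<close>

definition odd_summand :: "real mat \<Rightarrow> bool" where
  "odd_summand G \<longleftrightarrow>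
     (\<exists>l t C. t \<in> {1, - 1} \<and>
        wonenburger_rel (2 * l + 1) (odd_A l) (odd_B l t) C \<and>
        (l = 0 \<longrightarrow> C = 0\<^sub>m 1 1) \<and>
        G = wblock (odd_A l) (odd_B l t) C)"

definition minus_one_form :: "real mat \<Rightarrow> bool" where
  "minus_one_form F \<longleftrightarrow>
     (\<exists>Es Gs. (\<forall>E\<in>set Es. even_summand E) \<and> (\<forall>G\<in>set Gs. odd_summand G) \<and>
        F = (diamond_sum Es \<diamond> diamond_sum Es) \<diamond> diamond_sum Gs)"

text \<open>The representatives $\lambda < -1$ of the reciprocal pairs of negative eigenvalues
  other than $-1$.\<close>

definition neg_reps :: "real mat \<Rightarrow> real set" where
  "neg_reps M = {l. l < - 1 \<and> {complex_of_real l, complex_of_real (inverse l)} \<subseteq> cspectrum M}"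

end

theory Submission
  imports Defs
begin

text \<open>
  For a symplectic \<open>X\<close> put \<open>t = (X + X\<^sup>-\<^sup>1)/2\<close> and \<open>d = (X - X\<^sup>-\<^sup>1)/2\<close>; these are a self-adjoint and an
  anti-self-adjoint map for the symplectic form \<open>\<omega>\<close>, they commute, and \<open>d\<^sup>2 = t\<^sup>2 - 1\<close>. Therefore \<open>\<omega>(d u, v)\<close> is
  a symmetric form, and the geometry of the cyclic subspace of a vector \<open>w\<close> is encoded in the moments
  \<open>\<omega>(d t\<^sup>j w, w)\<close>. If \<open>t - \<mu>\<close> is nilpotent on this subspace, the moments of a well chosen \<open>w\<close> all vanish
  except for one, which is a sign, and the subspace is nondegenerate with \<open>X\<close> acting on it as the
  Wonenburger matrix \<open>wnf\<close> (\<open>cyclic_data\<close>, \<open>exists_good_vector\<close>, \<open>normalize\<close>). Its orthogonal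
  complement is invariant, so a block splits off (\<open>symp_split\<close>).

  Let now \<open>X\<^sup>2 = M\<close>. As long as \<open>M\<close> has a negative eigenvalue \<open>l\<close>, a block is split off from \<open>X\<close> whose square
  is one of the summands in the statement. Let \<open>l \<noteq> -1\<close>. Then the vector \<open>w\<close> can be chosen such that its
  cyclic subspace \<open>U\<close> for \<open>M\<close> is orthogonal to \<open>X U\<close> (\<open>split_hyperbolic\<close>); as \<open>X\<close> maps \<open>U\<close> isometrically to
  \<open>X U\<close>, this contributes \<open>N \<diamond> N\<close> with a Wonenburger matrix \<open>N\<close>. For \<open>l = -1\<close> the eigenvalues of \<open>X\<close> are
  \<open>\<plusminus>i\<close> and \<open>t\<close> is nilpotent of some order \<open>k\<close> on the block. If \<open>k\<close> is even, the vanishing moments give the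
  orthogonality of \<open>U\<close> and \<open>X U\<close> for free and the contribution is a doubled even summand
  (\<open>split_even\<close>). If \<open>k\<close> is odd, the square of the block is an odd summand (\<open>wnf_odd_square\<close>). What remains
  has no negative eigenvalue, and collecting the blocks gives the normal form (\<open>square_normal_form\<close>).

  Conversely each component has a square root. For a doubled summand \<open>N \<diamond> N\<close> it is the block matrix with
  rows \<open>(0, N)\<close> and \<open>(1, 0)\<close>. An odd summand depends on \<open>C\<close> only up to similarity if \<open>l \<ge> 1\<close>
  (\<open>odd_summand_similar\<close>), and for one choice of \<open>C\<close> a root is written down (\<open>odd_root\<close>). A symplectic
  matrix without negative eigenvalues has a principal square root; since a square root with spectrum
  in the right half plane is unique, it is real and symplectic (\<open>symp_sqrt_no_negative\<close>).
\<close>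

section \<open>Matrix identities with dimension side conditions\<close>

lemma mat_assoc: "dim_col A = dim_row B \<Longrightarrow> dim_col B = dim_row C \<Longrightarrow>
    (A * B) * C = A * (B * (C :: 'a :: comm_ring_1 mat))"
  by (rule assoc_mult_mat) auto

lemma mat_distrib_left: "dim_row B = dim_row C \<Longrightarrow> dim_col B = dim_col C \<Longrightarrow> dim_col A = dim_row B \<Longrightarrow>
    A * (B + C) = A * B + A * (C :: 'a :: comm_ring_1 mat)"
  by (rule mult_add_distrib_mat) auto

lemma mat_distrib_right: "dim_row B = dim_row C \<Longrightarrow> dim_col B = dim_col C \<Longrightarrow> dim_col B = dim_row A \<Longrightarrow>
    (B + C) * A = B * A + C * (A :: 'a :: comm_ring_1 mat)"
  by (rule add_mult_distrib_mat) auto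

lemma mat_minus_left: "dim_row B = dim_row C \<Longrightarrow> dim_col B = dim_col C \<Longrightarrow> dim_col A = dim_row B \<Longrightarrow>
    A * (B - C) = A * B - A * (C :: 'a :: comm_ring_1 mat)"
  by (rule mult_minus_distrib_mat) auto

lemma mat_minus_right: "dim_row B = dim_row C \<Longrightarrow> dim_col B = dim_col C \<Longrightarrow> dim_col B = dim_row A \<Longrightarrow>
    (B - C) * A = B * A - C * (A :: 'a :: comm_ring_1 mat)"
  by (rule minus_mult_distrib_mat) auto

lemma mat_smult_left: "dim_col A = dim_row B \<Longrightarrow> (c \<cdot>\<^sub>m A) * B = c \<cdot>\<^sub>m (A * (B :: 'a :: comm_ring_1 mat))"
  by (rule mult_smult_assoc_mat) auto

lemma mat_smult_right: "dim_col A = dim_row B \<Longrightarrow> A * (c \<cdot>\<^sub>m B) = c \<cdot>\<^sub>m (A * (B :: 'a :: comm_ring_1 mat))"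
  by (rule mult_smult_distrib) auto

lemma mat_uminus_left: "dim_col A = dim_row B \<Longrightarrow> (- A) * B = - (A * (B :: 'a :: comm_ring_1 mat))"
  by (rule uminus_mult_left_mat) auto

lemma mat_uminus_right: "dim_col A = dim_row B \<Longrightarrow> A * (- B) = - (A * (B :: 'a :: comm_ring_1 mat))"
  by (rule uminus_mult_right_mat) auto

lemma mat_one_left: "dim_row A = n \<Longrightarrow> 1\<^sub>m n * A = (A :: 'a :: comm_ring_1 mat)"
  by (rule left_mult_one_mat) auto

lemma mat_one_right: "dim_col A = n \<Longrightarrow> A * 1\<^sub>m n = (A :: 'a :: comm_ring_1 mat)"
  by (rule right_mult_one_mat) auto

lemma mat_zero_left: "dim_row A = m \<Longrightarrow> 0\<^sub>m n m * A = (0\<^sub>m n (dim_col A) :: 'a :: comm_ring_1 mat)"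
  by (rule left_mult_zero_mat) auto

lemma mat_zero_right: "dim_col A = m \<Longrightarrow> A * 0\<^sub>m m n = (0\<^sub>m (dim_row A) n :: 'a :: comm_ring_1 mat)"
  by (rule right_mult_zero_mat) auto

lemma mat_transpose_mult: "dim_col A = dim_row B \<Longrightarrow>
    (A * B)\<^sup>T = B\<^sup>T * (A :: 'a :: comm_ring_1 mat)\<^sup>T"
  by (rule transpose_mult) auto

lemma mat_transpose_add: "dim_row A = dim_row B \<Longrightarrow> dim_col A = dim_col B \<Longrightarrow>
    (A + B)\<^sup>T = A\<^sup>T + (B :: 'a :: comm_ring_1 mat)\<^sup>T"
  by (rule eq_matI) auto

lemma mat_transpose_minus: "dim_row A = dim_row B \<Longrightarrow> dim_col A = dim_col B \<Longrightarrow>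
    (A - B)\<^sup>T = A\<^sup>T - (B :: 'a :: comm_ring_1 mat)\<^sup>T"
  by (rule eq_matI) auto

lemma mat_transpose_smult: "(c \<cdot>\<^sub>m A)\<^sup>T = c \<cdot>\<^sub>m (A :: 'a :: comm_ring_1 mat)\<^sup>T"
  by (rule eq_matI) auto

lemma mat_transpose_uminus: "(- A)\<^sup>T = - (A :: 'a :: comm_ring_1 mat)\<^sup>T"
  by (rule eq_matI) auto

lemma mat_uminus_uminus: "- (- A) = (A :: 'a :: comm_ring_1 mat)"
  by (rule eq_matI) auto

lemma mat_smult_smult: "a \<cdot>\<^sub>m (b \<cdot>\<^sub>m A) = (a * b) \<cdot>\<^sub>m (A :: 'a :: comm_ring_1 mat)"
  by (rule eq_matI) (auto simp: mult.assoc)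

lemma mat_smult_uminus: "a \<cdot>\<^sub>m (- A) = - (a \<cdot>\<^sub>m (A :: 'a :: comm_ring_1 mat))"
  by (rule eq_matI) auto

lemma mat_vec_assoc: "dim_col A = dim_row B \<Longrightarrow> dim_col B = dim_vec v \<Longrightarrow>
    (A * B) *\<^sub>v v = A *\<^sub>v (B *\<^sub>v (v :: 'a :: comm_ring_1 vec))"
  by (rule assoc_mult_mat_vec) auto

lemma mat_add_zero: "dim_row A = r \<Longrightarrow> dim_col A = c \<Longrightarrow> A + 0\<^sub>m r c = (A :: 'a :: comm_ring_1 mat)"
  "dim_row A = r \<Longrightarrow> dim_col A = c \<Longrightarrow> 0\<^sub>m r c + A = (A :: 'a :: comm_ring_1 mat)"
  by (rule eq_matI; auto)+

lemma mat_smult_minus: "dim_row A = dim_row B \<Longrightarrow> dim_col A = dim_col B \<Longrightarrow>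
    c \<cdot>\<^sub>m (A - B) = c \<cdot>\<^sub>m A - c \<cdot>\<^sub>m (B :: 'a :: comm_ring_1 mat)"
  by (rule eq_matI) (auto simp: algebra_simps)

lemma mat_smult_add: "dim_row A = dim_row B \<Longrightarrow> dim_col A = dim_col B \<Longrightarrow>
    c \<cdot>\<^sub>m (A + B) = c \<cdot>\<^sub>m A + c \<cdot>\<^sub>m (B :: 'a :: comm_ring_1 mat)"
  by (rule eq_matI) (auto simp: algebra_simps)

lemma mat_minus_self: "A - A = (0\<^sub>m (dim_row A) (dim_col A) :: 'a :: comm_ring_1 mat)"
  by (rule eq_matI) auto

lemma mv_carrier: "dim_row A = m \<Longrightarrow> A *\<^sub>v v \<in> carrier_vec m"
  by (auto intro: carrier_vecI)

lemma smult_zero_v: "c \<cdot>\<^sub>v 0\<^sub>v m = (0\<^sub>v m :: real vec)"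
  by (rule eq_vecI) auto

lemmas mat_dist = mat_distrib_left mat_distrib_right mat_minus_left mat_minus_right
  mat_smult_left mat_smult_right mat_uminus_left mat_uminus_right
lemmas mat_unit = mat_one_left mat_one_right mat_zero_left mat_zero_right
lemmas mat_tr = mat_transpose_mult mat_transpose_add mat_transpose_minus mat_transpose_smult
  mat_transpose_uminus transpose_one transpose_transpose
lemmas mat_neg = mat_uminus_uminus mat_smult_uminus

section \<open>The symplectic form, adjoints and symplectic embeddings\<close>

lemma symp_form_dim [simp]: "dim_row (symp_form n) = 2 * n" "dim_col (symp_form n) = 2 * n"
  by (auto simp: symp_form_def)

lemma symp_form_carrier [simp]: "symp_form n \<in> carrier_mat (2 * n) (2 * n)"
  by (rule carrier_matI) auto

lemma symp_form_index: "i < 2 * n \<Longrightarrow> j < 2 * n \<Longrightarrow>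
    symp_form n $$ (i, j) = (if i < n then (if j = i + n then - 1 else 0) else (if i = j + n then 1 else 0))"
  by (auto simp: symp_form_def)

lemma symp_form_transpose: "(symp_form n)\<^sup>T = - symp_form n"
  by (rule eq_matI) (auto simp: symp_form_index)

lemma symp_form_square: "symp_form n * symp_form n = - 1\<^sub>m (2 * n)"
proof -
  have "symp_form n * symp_form n = four_block_mat (- 1\<^sub>m n) (0\<^sub>m n n) (0\<^sub>m n n) (- 1\<^sub>m n)"
    unfolding symp_form_def
    by (subst mult_four_block_mat[of _ n n _ n _ n _ _ n _ n]) (auto simp: mat_unit)
  also have "\<dots> = - 1\<^sub>m (2 * n)"
    by (rule eq_matI) auto
  finally show ?thesis .
qed

lemma symp_form_square': "dim_row A = 2 * n \<Longrightarrow> symp_form n * (symp_form n * A) = - A"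
  by (simp add: mat_assoc[symmetric] symp_form_square mat_uminus_left mat_one_left)

text \<open>The adjoint with respect to the symplectic forms: \<open>\<omega>(S u, v) = \<omega>(u, S\<^sup>* v)\<close>. For an element of the
  symplectic group it is the inverse, so inverses are handled through an explicit linear formula.\<close>

definition sadj :: "nat \<Rightarrow> nat \<Rightarrow> real mat \<Rightarrow> real mat" where
  "sadj n k S = - (symp_form k * (S\<^sup>T * symp_form n))"

lemma sadj_dim [simp]: "dim_row (sadj n k S) = 2 * k" "dim_col (sadj n k S) = 2 * n"
  by (auto simp: sadj_def)

lemma sadj_carrier [simp]: "sadj n k S \<in> carrier_mat (2 * k) (2 * n)"
  by (rule carrier_matI) auto

lemma sadj_mult: "A \<in> carrier_mat (2 * n) (2 * m) \<Longrightarrow> B \<in> carrier_mat (2 * m) (2 * k) \<Longrightarrow>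
    sadj n k (A * B) = sadj m k B * sadj n m A"
  by (simp add: sadj_def mat_tr mat_assoc mat_dist mat_neg symp_form_square')

lemma sadj_sadj: "A \<in> carrier_mat (2 * n) (2 * k) \<Longrightarrow> sadj k n (sadj n k A) = A"
  by (simp add: sadj_def mat_tr mat_assoc mat_dist mat_neg symp_form_square symp_form_square'
      symp_form_transpose mat_unit)

lemma sadj_one: "sadj n n (1\<^sub>m (2 * n)) = 1\<^sub>m (2 * n)"
  by (simp add: sadj_def mat_unit mat_neg transpose_one symp_form_square)

lemma sadj_add: "A \<in> carrier_mat (2 * n) (2 * k) \<Longrightarrow> B \<in> carrier_mat (2 * n) (2 * k) \<Longrightarrow>
    sadj n k (A + B) = sadj n k A + sadj n k B"
  by (simp add: sadj_def mat_tr mat_dist) (rule eq_matI, auto)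

lemma sadj_minus: "A \<in> carrier_mat (2 * n) (2 * k) \<Longrightarrow> B \<in> carrier_mat (2 * n) (2 * k) \<Longrightarrow>
    sadj n k (A - B) = sadj n k A - sadj n k B"
  by (simp add: sadj_def mat_tr mat_dist) (rule eq_matI, auto)

lemma sadj_smult: "A \<in> carrier_mat (2 * n) (2 * k) \<Longrightarrow> sadj n k (c \<cdot>\<^sub>m A) = c \<cdot>\<^sub>m sadj n k A"
  by (simp add: sadj_def mat_tr mat_dist mat_neg)

text \<open>The columns of such a matrix are a symplectic basis of a nondegenerate subspace. Orthogonal
  decompositions of the space are expressed through these embeddings instead of subspaces.\<close>

definition semb :: "nat \<Rightarrow> nat \<Rightarrow> real mat \<Rightarrow> bool" where
  "semb n k S \<longleftrightarrow> S \<in> carrier_mat (2 * n) (2 * k) \<and> S\<^sup>T * symp_form n * S = symp_form k"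

lemma Sp_iff_semb: "S \<in> Sp n \<longleftrightarrow> semb n n S"
  by (auto simp: Sp_def semb_def)

lemma semb_carrier: "semb n k S \<Longrightarrow> S \<in> carrier_mat (2 * n) (2 * k)"
  by (auto simp: semb_def)

lemma semb_dim: "semb n k S \<Longrightarrow> dim_row S = 2 * n" "semb n k S \<Longrightarrow> dim_col S = 2 * k"
  by (auto simp: semb_def)

lemma Sp_carrier: "S \<in> Sp n \<Longrightarrow> S \<in> carrier_mat (2 * n) (2 * n)"
  by (auto simp: Sp_def)

lemma semb_iff_sadj: "S \<in> carrier_mat (2 * n) (2 * k) \<Longrightarrow> semb n k S \<longleftrightarrow> sadj n k S * S = 1\<^sub>m (2 * k)"
proof
  assume S: "S \<in> carrier_mat (2 * n) (2 * k)" and "semb n k S"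
  then have "S\<^sup>T * (symp_form n * S) = symp_form k"
    by (simp add: semb_def mat_assoc)
  then show "sadj n k S * S = 1\<^sub>m (2 * k)" using S
    by (simp add: sadj_def mat_assoc mat_dist mat_neg symp_form_square)
next
  assume S: "S \<in> carrier_mat (2 * n) (2 * k)" and a: "sadj n k S * S = 1\<^sub>m (2 * k)"
  have "symp_form k * (sadj n k S * S) = S\<^sup>T * (symp_form n * S)" using S
    by (simp add: sadj_def mat_assoc mat_dist mat_neg symp_form_square')
  then show "semb n k S" using S a by (simp add: semb_def mat_assoc mat_unit)
qed

lemma semb_sadj: "semb n k S \<Longrightarrow> sadj n k S * S = 1\<^sub>m (2 * k)"
  using semb_iff_sadj semb_carrier by blast

lemma semb_mult: "semb n m S \<Longrightarrow> semb m k R \<Longrightarrow> semb n k (S * R)"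
proof -
  assume S: "semb n m S" and R: "semb m k R"
  have "S * R \<in> carrier_mat (2 * n) (2 * k)" using semb_carrier[OF S] semb_carrier[OF R] by simp
  moreover have "sadj n k (S * R) * (S * R) = sadj m k R * ((sadj n m S * S) * R)"
    using semb_carrier[OF S] semb_carrier[OF R] by (simp add: sadj_mult mat_assoc)
  ultimately show ?thesis
    using semb_sadj[OF S] semb_sadj[OF R] semb_carrier[OF R] by (simp add: semb_iff_sadj mat_unit)
qed

lemma Sp_sadj_left: "P \<in> Sp n \<Longrightarrow> sadj n n P * P = 1\<^sub>m (2 * n)"
  by (simp add: Sp_iff_semb semb_sadj)

lemma Sp_sadj_right: "P \<in> Sp n \<Longrightarrow> P * sadj n n P = 1\<^sub>m (2 * n)"
  using mat_mult_left_right_inverse[OF sadj_carrier Sp_carrier Sp_sadj_left] by blast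

lemma Sp_sadj: "P \<in> Sp n \<Longrightarrow> sadj n n P \<in> Sp n"
  by (simp add: Sp_iff_semb semb_iff_sadj sadj_sadj Sp_carrier Sp_sadj_right[unfolded Sp_iff_semb])

lemma Sp_mult: "P \<in> Sp n \<Longrightarrow> Q \<in> Sp n \<Longrightarrow> P * Q \<in> Sp n"
  using semb_mult Sp_iff_semb by blast

lemma Sp_one: "1\<^sub>m (2 * n) \<in> Sp n"
  by (simp add: Sp_iff_semb semb_iff_sadj sadj_one mat_unit)

lemma Sp_zero: "0\<^sub>m 0 0 \<in> Sp 0"
  by (auto simp: Sp_def)

lemma Sp_zeroD: "P \<in> Sp 0 \<Longrightarrow> P = 0\<^sub>m 0 0"
  by (auto simp: Sp_def)

section \<open>Symplectic similarity\<close>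

text \<open>An intertwining relation is easier to compose than a conjugation, since the inverse of \<open>P\<close> does
  not occur in it.\<close>

lemma symp_similar_iff:
  assumes "M \<in> carrier_mat (2 * n) (2 * n)" "N \<in> carrier_mat (2 * n) (2 * n)"
  shows "symp_similar n M N \<longleftrightarrow> (\<exists>P\<in>Sp n. P * M = N * P)"
proof
  assume "symp_similar n M N"
  then obtain P Q where P: "P \<in> Sp n" and w: "similar_mat_wit N M P Q" by (auto simp: symp_similar_def)
  from similar_mat_witD2[OF assms(2) w]
  have Q: "Q * P = 1\<^sub>m (2 * n)" "N = P * M * Q" "Q \<in> carrier_mat (2 * n) (2 * n)" by auto
  have "N * P = P * M * (Q * P)" using Q(2,3) assms Sp_carrier[OF P] by (simp add: mat_assoc)
  then have "N * P = P * M" using Q assms Sp_carrier[OF P] by (simp add: mat_unit)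
  then show "\<exists>P\<in>Sp n. P * M = N * P" using P by metis
next
  assume "\<exists>P\<in>Sp n. P * M = N * P"
  then obtain P where P: "P \<in> Sp n" and c: "P * M = N * P" by blast
  have "P * M * sadj n n P = N * (P * sadj n n P)"
    using c assms Sp_carrier[OF P] by (simp add: mat_assoc)
  then have "N = P * M * sadj n n P" using assms by (simp add: Sp_sadj_right[OF P] mat_unit)
  then have "similar_mat_wit N M P (sadj n n P)"
    using assms Sp_carrier[OF P] Sp_sadj_left[OF P] Sp_sadj_right[OF P]
    by (intro similar_mat_witI[of _ _ "2 * n"]) auto
  then show "symp_similar n M N" using P by (auto simp: symp_similar_def)
qed

lemma symp_similar_carrier: "symp_similar n M N \<Longrightarrow> M \<in> carrier_mat (2 * n) (2 * n) \<and> N \<in> carrier_mat (2 * n) (2 * n)"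
  unfolding symp_similar_def Sp_def similar_mat_wit_def Let_def by auto

lemma symp_similarI: "P \<in> Sp n \<Longrightarrow> M \<in> carrier_mat (2 * n) (2 * n) \<Longrightarrow> N \<in> carrier_mat (2 * n) (2 * n) \<Longrightarrow>
    P * M = N * P \<Longrightarrow> symp_similar n M N"
  using symp_similar_iff by blast

lemma symp_similarE:
  assumes "symp_similar n M N"
  obtains P where "P \<in> Sp n" "P * M = N * P" "M \<in> carrier_mat (2 * n) (2 * n)" "N \<in> carrier_mat (2 * n) (2 * n)"
  using assms symp_similar_iff symp_similar_carrier by metis

lemma symp_similar_refl: "M \<in> carrier_mat (2 * n) (2 * n) \<Longrightarrow> symp_similar n M M"
  by (rule symp_similarI[OF Sp_one]) (auto simp: mat_unit)

lemma symp_similar_sym: assumes "symp_similar n M N" shows "symp_similar n N M"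
proof -
  obtain P where P: "P \<in> Sp n" "P * M = N * P" and c: "M \<in> carrier_mat (2 * n) (2 * n)" "N \<in> carrier_mat (2 * n) (2 * n)"
    using symp_similarE[OF assms] .
  let ?Q = "sadj n n P"
  have "?Q * N = ?Q * (N * (P * ?Q))" using c by (simp add: Sp_sadj_right[OF P(1)] mat_unit)
  also have "\<dots> = ?Q * ((P * M) * ?Q)" using c Sp_carrier[OF P(1)] P(2) by (simp add: mat_assoc)
  also have "\<dots> = (?Q * P) * (M * ?Q)" using c Sp_carrier[OF P(1)] by (simp add: mat_assoc)
  also have "\<dots> = M * ?Q" using c by (simp add: Sp_sadj_left[OF P(1)] mat_unit)
  finally show ?thesis using symp_similarI[OF Sp_sadj[OF P(1)]] c by blast
qed

lemma symp_similar_trans [trans]: assumes "symp_similar n L M" "symp_similar n M N" shows "symp_similar n L N"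
proof -
  obtain P where P: "P \<in> Sp n" "P * L = M * P" and c: "L \<in> carrier_mat (2 * n) (2 * n)" "M \<in> carrier_mat (2 * n) (2 * n)"
    using symp_similarE[OF assms(1)] .
  obtain Q where Q: "Q \<in> Sp n" "Q * M = N * Q" and d: "N \<in> carrier_mat (2 * n) (2 * n)"
    using symp_similarE[OF assms(2)] by metis
  have "(Q * P) * L = (Q * M) * P" using P c Sp_carrier[OF P(1)] Sp_carrier[OF Q(1)] by (simp add: mat_assoc)
  also have "\<dots> = N * (Q * P)" unfolding Q(2) using d Sp_carrier[OF P(1)] Sp_carrier[OF Q(1)] by (simp add: mat_assoc)
  finally show ?thesis using symp_similarI[OF Sp_mult[OF Q(1) P(1)]] c d by blast
qed

lemma symp_similar_square: assumes "symp_similar n X Y" shows "symp_similar n (X * X) (Y * Y)"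
proof -
  obtain P where P: "P \<in> Sp n" "P * X = Y * P" and c: "X \<in> carrier_mat (2 * n) (2 * n)" "Y \<in> carrier_mat (2 * n) (2 * n)"
    using symp_similarE[OF assms] .
  have "P * (X * X) = (P * X) * X" using c Sp_carrier[OF P(1)] by (simp add: mat_assoc)
  also have "\<dots> = (Y * P) * X" by (simp only: P(2))
  also have "\<dots> = Y * (P * X)" using c Sp_carrier[OF P(1)] by (simp add: mat_assoc)
  also have "\<dots> = (Y * Y) * P" using P(2) c Sp_carrier[OF P(1)] by (simp add: mat_assoc)
  finally show ?thesis using symp_similarI[OF P(1)] c by auto
qed

lemma symp_sqrt_similar: assumes "symp_similar n M N" "symp_sqrt n N Y" shows "\<exists>X. symp_sqrt n M X"
proof -
  obtain P where P: "P \<in> Sp n" "P * N = M * P" and c: "M \<in> carrier_mat (2 * n) (2 * n)"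
    using symp_similarE[OF symp_similar_sym[OF assms(1)]] by metis
  have Y: "Y \<in> Sp n" "Y * Y = N" using assms(2) by (auto simp: symp_sqrt_def)
  let ?Q = "sadj n n P"
  have "(P * Y * ?Q) * (P * Y * ?Q) = P * (Y * ((?Q * P) * (Y * ?Q)))"
    using Sp_carrier[OF P(1)] Sp_carrier[OF Y(1)] by (simp add: mat_assoc)
  also have "\<dots> = (P * (Y * Y)) * ?Q" 
    using Sp_carrier[OF P(1)] Sp_carrier[OF Y(1)] by (simp add: Sp_sadj_left[OF P(1)] mat_unit mat_assoc)
  also have "\<dots> = M * (P * ?Q)" unfolding Y(2) P(2) using c Sp_carrier[OF P(1)] by (simp add: mat_assoc)
  also have "\<dots> = M" using c by (simp add: Sp_sadj_right[OF P(1)] mat_unit)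
  finally show ?thesis using Sp_mult Sp_sadj P(1) Y(1) unfolding symp_sqrt_def by metis
qed

section \<open>The diamond sum as an orthogonal sum\<close>

text \<open>Multiplication by this 0/1 matrix selects the columns \<open>f 0, f 1, \<dots>\<close>.\<close>

definition sel_mat :: "nat \<Rightarrow> nat \<Rightarrow> (nat \<Rightarrow> nat) \<Rightarrow> real mat" where
  "sel_mat r c f = mat r c (\<lambda>(i, j). if i = f j then 1 else 0)"

lemma sel_mat_dim [simp]: "dim_row (sel_mat r c f) = r" "dim_col (sel_mat r c f) = c"
  by (auto simp: sel_mat_def)

lemma mult_sel_mat: "i < dim_row A \<Longrightarrow> dim_col A = r \<Longrightarrow> j < c \<Longrightarrow> f j < r \<Longrightarrow>
    (A * sel_mat r c f) $$ (i, j) = A $$ (i, f j)"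
  by (simp add: scalar_prod_def sel_mat_def if_distrib[of "\<lambda>x. _ * x"] cong: if_cong)

lemma transpose_sel_mat_mult: "dim_row A = r \<Longrightarrow> i < c \<Longrightarrow> j < dim_col A \<Longrightarrow> f i < r \<Longrightarrow>
    ((sel_mat r c f)\<^sup>T * A) $$ (i, j) = A $$ (f i, j)"
  by (simp add: scalar_prod_def sel_mat_def if_distrib[of "\<lambda>x. x * _"] cong: if_cong)

text \<open>The coordinates \<open>(q\<^sub>1, p\<^sub>1)\<close> and \<open>(q\<^sub>2, p\<^sub>2)\<close> of two summands are arranged as
  \<open>(q\<^sub>1, q\<^sub>2, p\<^sub>1, p\<^sub>2)\<close> in their diamond sum; \<open>left_pos\<close> and \<open>right_pos\<close> are the resulting
  positions.\<close>

definition left_pos :: "nat \<Rightarrow> nat \<Rightarrow> nat \<Rightarrow> nat" where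
  "left_pos m k j = (if j < m then j else j + k)"

definition right_pos :: "nat \<Rightarrow> nat \<Rightarrow> nat \<Rightarrow> nat" where
  "right_pos m k j = (if j < k then m + j else 2 * m + j)"

definition emb_left :: "nat \<Rightarrow> nat \<Rightarrow> real mat" where
  "emb_left m k = sel_mat (2 * (m + k)) (2 * m) (left_pos m k)"

definition emb_right :: "nat \<Rightarrow> nat \<Rightarrow> real mat" where
  "emb_right m k = sel_mat (2 * (m + k)) (2 * k) (right_pos m k)"

lemma emb_dim [simp]: "dim_row (emb_left m k) = 2 * (m + k)" "dim_col (emb_left m k) = 2 * m"
  "dim_row (emb_right m k) = 2 * (m + k)" "dim_col (emb_right m k) = 2 * k"
  by (auto simp: emb_left_def emb_right_def)

lemma left_pos_less: "j < 2 * m \<Longrightarrow> left_pos m k j < 2 * (m + k)"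
  and right_pos_less: "j < 2 * k \<Longrightarrow> right_pos m k j < 2 * (m + k)"
  by (auto simp: left_pos_def right_pos_def)

lemmas pos_less = left_pos_less right_pos_less left_pos_less[unfolded distrib_left] right_pos_less[unfolded distrib_left]

lemma emb_compress:
  assumes "A \<in> carrier_mat (2 * (m + k)) (2 * (m + k))"
  shows "i < 2 * m \<Longrightarrow> j < 2 * m \<Longrightarrow> ((emb_left m k)\<^sup>T * (A * emb_left m k)) $$ (i, j) = A $$ (left_pos m k i, left_pos m k j)"
    "i < 2 * m \<Longrightarrow> j < 2 * k \<Longrightarrow> ((emb_left m k)\<^sup>T * (A * emb_right m k)) $$ (i, j) = A $$ (left_pos m k i, right_pos m k j)"
    "i < 2 * k \<Longrightarrow> j < 2 * m \<Longrightarrow> ((emb_right m k)\<^sup>T * (A * emb_left m k)) $$ (i, j) = A $$ (right_pos m k i, left_pos m k j)"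
    "i < 2 * k \<Longrightarrow> j < 2 * k \<Longrightarrow> ((emb_right m k)\<^sup>T * (A * emb_right m k)) $$ (i, j) = A $$ (right_pos m k i, right_pos m k j)"
  unfolding emb_left_def emb_right_def using assms
  by (simp_all add: pos_less mult_sel_mat transpose_sel_mat_mult del: index_mult_mat(1))

lemma emb_orthonormal:
  "(emb_left m k)\<^sup>T * emb_left m k = 1\<^sub>m (2 * m)"
  "(emb_left m k)\<^sup>T * emb_right m k = 0\<^sub>m (2 * m) (2 * k)"
  "(emb_right m k)\<^sup>T * emb_left m k = 0\<^sub>m (2 * k) (2 * m)"
  "(emb_right m k)\<^sup>T * emb_right m k = 1\<^sub>m (2 * k)"
proof -
  note c = emb_compress[of "1\<^sub>m (2 * (m + k))" m k, simplified mat_unit emb_dim refl, simplified]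
  show "(emb_left m k)\<^sup>T * emb_left m k = 1\<^sub>m (2 * m)"
    by (rule eq_matI) (auto simp: c pos_less simp del: index_mult_mat(1), auto simp: left_pos_def split: if_splits)
  show "(emb_left m k)\<^sup>T * emb_right m k = 0\<^sub>m (2 * m) (2 * k)"
    by (rule eq_matI) (auto simp: c pos_less simp del: index_mult_mat(1), auto simp: left_pos_def right_pos_def split: if_splits)
  show "(emb_right m k)\<^sup>T * emb_left m k = 0\<^sub>m (2 * k) (2 * m)"
    by (rule eq_matI) (auto simp: c pos_less simp del: index_mult_mat(1), auto simp: left_pos_def right_pos_def split: if_splits)
  show "(emb_right m k)\<^sup>T * emb_right m k = 1\<^sub>m (2 * k)"
    by (rule eq_matI) (auto simp: c pos_less simp del: index_mult_mat(1), auto simp: right_pos_def split: if_splits)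
qed

lemma emb_symp:
  "(emb_left m k)\<^sup>T * (symp_form (m + k) * emb_left m k) = symp_form m"
  "(emb_left m k)\<^sup>T * (symp_form (m + k) * emb_right m k) = 0\<^sub>m (2 * m) (2 * k)"
  "(emb_right m k)\<^sup>T * (symp_form (m + k) * emb_left m k) = 0\<^sub>m (2 * k) (2 * m)"
  "(emb_right m k)\<^sup>T * (symp_form (m + k) * emb_right m k) = symp_form k"
proof -
  note c = emb_compress[of "symp_form (m + k)" m k, OF symp_form_carrier]
  show "(emb_left m k)\<^sup>T * (symp_form (m + k) * emb_left m k) = symp_form m"
    by (rule eq_matI) (auto simp: c pos_less symp_form_index simp del: index_mult_mat(1), auto simp: left_pos_def split: if_splits)
  show "(emb_left m k)\<^sup>T * (symp_form (m + k) * emb_right m k) = 0\<^sub>m (2 * m) (2 * k)"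
    by (rule eq_matI) (auto simp: c pos_less symp_form_index simp del: index_mult_mat(1), auto simp: left_pos_def right_pos_def split: if_splits)
  show "(emb_right m k)\<^sup>T * (symp_form (m + k) * emb_left m k) = 0\<^sub>m (2 * k) (2 * m)"
    by (rule eq_matI) (auto simp: c pos_less symp_form_index simp del: index_mult_mat(1), auto simp: left_pos_def right_pos_def split: if_splits)
  show "(emb_right m k)\<^sup>T * (symp_form (m + k) * emb_right m k) = symp_form k"
    by (rule eq_matI) (auto simp: c pos_less symp_form_index simp del: index_mult_mat(1), auto simp: right_pos_def split: if_splits)
qed

text \<open>Side by side the two embeddings form a permutation matrix, and a left inverse of a square matrix
  is a right inverse.\<close>

lemma emb_complete:
  "emb_left m k * (emb_left m k)\<^sup>T + emb_right m k * (emb_right m k)\<^sup>T = 1\<^sub>m (2 * (m + k))"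
proof -
  define E where "E = (\<lambda>j. if j < 2 * m then left_pos m k j else right_pos m k (j - 2 * m))"
  define P where "P = sel_mat (2 * (m + k)) (2 * (m + k)) E"
  have E: "E j < 2 * (m + k)" if "j < 2 * (m + k)" for j
    using that left_pos_less[of j m k] right_pos_less[of "j - 2 * m" k m] by (auto simp: E_def)
  have inj: "E i = E j \<longleftrightarrow> i = j" if "i < 2 * (m + k)" "j < 2 * (m + k)" for i j
    using that by (simp add: E_def left_pos_def right_pos_def) linarith
  have "P\<^sup>T * P = 1\<^sub>m (2 * (m + k))" 
  proof (rule eq_matI)
    fix i j assume "i < dim_row (1\<^sub>m (2 * (m + k)) :: real mat)" "j < dim_col (1\<^sub>m (2 * (m + k)) :: real mat)"
    then have i: "i < 2 * (m + k)" "j < 2 * (m + k)" by auto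
    then have "(P\<^sup>T * P) $$ (i, j) = P $$ (E i, j)"
      unfolding P_def by (subst transpose_sel_mat_mult) (use E in \<open>auto simp: distrib_left\<close>)
    also have "\<dots> = 1\<^sub>m (2 * (m + k)) $$ (i, j)" using i E[OF i(1)] inj[OF i] by (simp add: P_def sel_mat_def)
    finally show "(P\<^sup>T * P) $$ (i, j) = 1\<^sub>m (2 * (m + k)) $$ (i, j)" .
  qed (auto simp: P_def)
  then have P: "P * P\<^sup>T = 1\<^sub>m (2 * (m + k))"
    by (rule mat_mult_left_right_inverse[rotated 2]) (auto simp: P_def intro!: carrier_matI)
  have sum: "(\<Sum>a = 0..<2 * (m + k). F a) = (\<Sum>a = 0..<2 * m. F a) + (\<Sum>a = 0..<2 * k. F (a + 2 * m))" for F :: "nat \<Rightarrow> real"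
  proof -
    have "(\<Sum>a = 0..<2 * m + 2 * k. F a) = (\<Sum>a = 0..<2 * m. F a) + (\<Sum>a\<in>{2 * m..<2 * m + 2 * k}. F a)"
      by (simp add: sum.atLeastLessThan_concat)
    moreover have "(\<Sum>a\<in>{2 * m..<2 * m + 2 * k}. F a) = (\<Sum>a = 0..<2 * k. F (a + 2 * m))"
      using sum.shift_bounds_nat_ivl[of F 0 "2 * m" "2 * k"] by (simp add: add.commute)
    ultimately show ?thesis by (simp add: distrib_left)
  qed
  have "emb_left m k * (emb_left m k)\<^sup>T + emb_right m k * (emb_right m k)\<^sup>T = P * P\<^sup>T"
  proof (rule eq_matI)
    fix i j assume "i < dim_row (P * P\<^sup>T)" "j < dim_col (P * P\<^sup>T)"
    then have i: "i < 2 * (m + k)" "j < 2 * (m + k)" by (auto simp: P_def)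
    have "(P * P\<^sup>T) $$ (i, j) = (\<Sum>a = 0..<2 * (m + k). P $$ (i, a) * P $$ (j, a))"
      using i by (simp add: scalar_prod_def P_def)
    also have "\<dots> = (\<Sum>a = 0..<2 * m. emb_left m k $$ (i, a) * emb_left m k $$ (j, a))
        + (\<Sum>a = 0..<2 * k. emb_right m k $$ (i, a) * emb_right m k $$ (j, a))"
      unfolding sum by (intro arg_cong2[where f = "(+)"] sum.cong)
        (use i in \<open>auto simp: P_def E_def emb_left_def emb_right_def sel_mat_def\<close>)
    also have "\<dots> = (emb_left m k * (emb_left m k)\<^sup>T + emb_right m k * (emb_right m k)\<^sup>T) $$ (i, j)"
      using i by (simp add: scalar_prod_def)
    finally show "(emb_left m k * (emb_left m k)\<^sup>T + emb_right m k * (emb_right m k)\<^sup>T) $$ (i, j) = (P * P\<^sup>T) $$ (i, j)" ..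
  qed (auto simp: P_def)
  then show ?thesis using P by simp
qed

lemma diamond_dim [simp]:
  assumes "M \<in> carrier_mat (2 * m) (2 * m)" "N \<in> carrier_mat (2 * k) (2 * k)"
  shows "dim_row (M \<diamond> N) = 2 * (m + k)" "dim_col (M \<diamond> N) = 2 * (m + k)"
  using assms by (auto simp: diamond_def split_block_def Let_def)

lemma diamond_carrier [intro]:
  assumes "M \<in> carrier_mat (2 * m) (2 * m)" "N \<in> carrier_mat (2 * k) (2 * k)"
  shows "M \<diamond> N \<in> carrier_mat (2 * (m + k)) (2 * (m + k))"
  using diamond_dim[OF assms] by (rule carrier_matI)

lemma diamond_index:
  assumes "M \<in> carrier_mat (2 * m) (2 * m)" "N \<in> carrier_mat (2 * k) (2 * k)"
  shows "i < 2 * m \<Longrightarrow> j < 2 * m \<Longrightarrow> (M \<diamond> N) $$ (left_pos m k i, left_pos m k j) = M $$ (i, j)"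
    "i < 2 * m \<Longrightarrow> j < 2 * k \<Longrightarrow> (M \<diamond> N) $$ (left_pos m k i, right_pos m k j) = 0"
    "i < 2 * k \<Longrightarrow> j < 2 * m \<Longrightarrow> (M \<diamond> N) $$ (right_pos m k i, left_pos m k j) = 0"
    "i < 2 * k \<Longrightarrow> j < 2 * k \<Longrightarrow> (M \<diamond> N) $$ (right_pos m k i, right_pos m k j) = N $$ (i, j)"
  using assms
  by (auto simp: diamond_def split_block_def Let_def left_pos_def right_pos_def)

text \<open>This formula takes the place of the block definition: together with orthonormality and
  completeness of the two embeddings it reduces products, adjoints and spectra of diamond sums to
  matrix algebra.\<close>

lemma diamond_eq:
  assumes M: "M \<in> carrier_mat (2 * m) (2 * m)" and N: "N \<in> carrier_mat (2 * k) (2 * k)"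
  shows "M \<diamond> N = emb_left m k * (M * (emb_left m k)\<^sup>T) + emb_right m k * (N * (emb_right m k)\<^sup>T)"
proof -
  let ?L = "emb_left m k" and ?R = "emb_right m k" and ?D = "M \<diamond> N"
  note c = emb_compress[OF diamond_carrier[OF M N]] and d = diamond_index[OF M N] and dd = diamond_dim[OF M N]
  have 1: "?L\<^sup>T * (?D * ?L) = M"
    by (rule eq_matI) (use M in \<open>auto simp: c d dd simp del: index_mult_mat(1)\<close>)
  have 2: "?L\<^sup>T * (?D * ?R) = 0\<^sub>m (2 * m) (2 * k)"
    by (rule eq_matI) (auto simp: c d dd simp del: index_mult_mat(1))
  have 3: "?R\<^sup>T * (?D * ?L) = 0\<^sub>m (2 * k) (2 * m)"
    by (rule eq_matI) (auto simp: c d dd simp del: index_mult_mat(1))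
  have 4: "?R\<^sup>T * (?D * ?R) = N"
    by (rule eq_matI) (use N in \<open>auto simp: c d dd simp del: index_mult_mat(1)\<close>)
  let ?I = "?L * ?L\<^sup>T + ?R * ?R\<^sup>T"
  have "?D = ?I * (?D * ?I)" by (simp add: emb_complete mat_unit dd)
  also have "\<dots> = ?L * ((?L\<^sup>T * (?D * ?L)) * ?L\<^sup>T) + ?R * ((?R\<^sup>T * (?D * ?L)) * ?L\<^sup>T)
     + (?L * ((?L\<^sup>T * (?D * ?R)) * ?R\<^sup>T) + ?R * ((?R\<^sup>T * (?D * ?R)) * ?R\<^sup>T))"
    by (simp add: mat_dist mat_assoc dd)
  also have "\<dots> = ?L * (M * ?L\<^sup>T) + ?R * (N * ?R\<^sup>T)"
    unfolding 1 2 3 4 using M N by (simp add: mat_unit mat_add_zero)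
  finally show ?thesis .
qed

lemma emb_cancel:
  "dim_row A = 2 * m \<Longrightarrow> (emb_left m k)\<^sup>T * (emb_left m k * A) = A"
  "dim_row A = 2 * k \<Longrightarrow> (emb_left m k)\<^sup>T * (emb_right m k * A) = 0\<^sub>m (2 * m) (dim_col A)"
  "dim_row A = 2 * m \<Longrightarrow> (emb_right m k)\<^sup>T * (emb_left m k * A) = 0\<^sub>m (2 * k) (dim_col A)"
  "dim_row A = 2 * k \<Longrightarrow> (emb_right m k)\<^sup>T * (emb_right m k * A) = A"
  by (simp_all add: mat_assoc[symmetric] emb_orthonormal mat_unit)

lemma diamond_mult:
  assumes "A \<in> carrier_mat (2 * m) (2 * m)" "B \<in> carrier_mat (2 * k) (2 * k)"
    "C \<in> carrier_mat (2 * m) (2 * m)" "D \<in> carrier_mat (2 * k) (2 * k)"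
  shows "(A \<diamond> B) * (C \<diamond> D) = (A * C) \<diamond> (B * D)"
proof -
  have "A * C \<in> carrier_mat (2 * m) (2 * m)" "B * D \<in> carrier_mat (2 * k) (2 * k)" using assms by auto
  note e = diamond_eq[OF assms(1,2)] diamond_eq[OF assms(3,4)] diamond_eq[OF this]
  show ?thesis unfolding e using assms
    by (simp add: mat_dist mat_assoc emb_cancel mat_unit mat_add_zero)
qed

lemma emb_left_sadj: "sadj (m + k) m (emb_left m k) = (emb_left m k)\<^sup>T"
  and emb_right_sadj: "sadj (m + k) k (emb_right m k) = (emb_right m k)\<^sup>T"
proof -
  let ?L = "emb_left m k" and ?R = "emb_right m k" and ?J = "symp_form (m + k)"
  let ?I = "?L * ?L\<^sup>T + ?R * ?R\<^sup>T"
  have "?L\<^sup>T * ?J = ?L\<^sup>T * (?J * ?I)" by (simp add: emb_complete mat_unit)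
  also have "\<dots> = (?L\<^sup>T * (?J * ?L)) * ?L\<^sup>T + (?L\<^sup>T * (?J * ?R)) * ?R\<^sup>T"
    by (simp add: mat_dist mat_assoc)
  also have "\<dots> = symp_form m * ?L\<^sup>T" unfolding emb_symp by (simp add: mat_unit mat_add_zero)
  finally show "sadj (m + k) m (emb_left m k) = (emb_left m k)\<^sup>T"
    by (simp add: sadj_def symp_form_square' mat_neg)
  have "?R\<^sup>T * ?J = ?R\<^sup>T * (?J * ?I)" by (simp add: emb_complete mat_unit)
  also have "\<dots> = (?R\<^sup>T * (?J * ?L)) * ?L\<^sup>T + (?R\<^sup>T * (?J * ?R)) * ?R\<^sup>T"
    by (simp add: mat_dist mat_assoc)
  also have "\<dots> = symp_form k * ?R\<^sup>T" unfolding emb_symp by (simp add: mat_unit mat_add_zero)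
  finally show "sadj (m + k) k (emb_right m k) = (emb_right m k)\<^sup>T"
    by (simp add: sadj_def symp_form_square' mat_neg)
qed

lemma emb_transpose_sadj: "sadj m (m + k) ((emb_left m k)\<^sup>T) = emb_left m k"
  "sadj k (m + k) ((emb_right m k)\<^sup>T) = emb_right m k"
  unfolding emb_left_sadj[symmetric] emb_right_sadj[symmetric] by (rule sadj_sadj; auto)+

lemma emb_carrier [simp]: "emb_left m k \<in> carrier_mat (2 * (m + k)) (2 * m)"
  "emb_right m k \<in> carrier_mat (2 * (m + k)) (2 * k)"
  by (rule carrier_matI; simp)+

text \<open>The map out of an orthogonal sum that is \<open>S\<close> on the first summand and \<open>T\<close> on the second.\<close>

definition pair_emb :: "nat \<Rightarrow> nat \<Rightarrow> real mat \<Rightarrow> real mat \<Rightarrow> real mat" where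
  "pair_emb m k S T = S * (emb_left m k)\<^sup>T + T * (emb_right m k)\<^sup>T"

lemma pair_emb_carrier: "S \<in> carrier_mat r (2 * m) \<Longrightarrow> T \<in> carrier_mat r (2 * k) \<Longrightarrow>
    pair_emb m k S T \<in> carrier_mat r (2 * (m + k))"
  by (auto simp: pair_emb_def)

lemma pair_emb_emb: "S \<in> carrier_mat r (2 * m) \<Longrightarrow> T \<in> carrier_mat r (2 * k) \<Longrightarrow> pair_emb m k S T * emb_left m k = S"
  "S \<in> carrier_mat r (2 * m) \<Longrightarrow> T \<in> carrier_mat r (2 * k) \<Longrightarrow> pair_emb m k S T * emb_right m k = T"
  by (auto simp: pair_emb_def mat_dist mat_assoc emb_orthonormal mat_unit mat_add_zero)

lemma sadj_zero: "sadj n k (0\<^sub>m (2 * n) (2 * k)) = 0\<^sub>m (2 * k) (2 * n)"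
  by (simp add: sadj_def mat_unit) (rule eq_matI, auto)

lemma semb_pair:
  assumes S: "semb n m S" and T: "semb n k T" and orth: "sadj n m S * T = 0\<^sub>m (2 * m) (2 * k)"
  shows "semb n (m + k) (pair_emb m k S T)"
    "sadj n (m + k) (pair_emb m k S T) = emb_left m k * sadj n m S + emb_right m k * sadj n k T"
proof -
  note c = semb_carrier[OF S] semb_carrier[OF T]
  have "sadj m k (sadj n m S * T) = sadj n k T * S"
    using sadj_mult[OF sadj_carrier c(2), of m S] sadj_sadj[OF c(1)] by simp
  then have orth': "sadj n k T * S = 0\<^sub>m (2 * k) (2 * m)"
    using sadj_zero[of m k] by (simp add: orth)
  show s: "sadj n (m + k) (pair_emb m k S T) = emb_left m k * sadj n m S + emb_right m k * sadj n k T"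
    unfolding pair_emb_def using c
    sadj_mult[OF c(1), of "(emb_left m k)\<^sup>T" "m + k"] sadj_mult[OF c(2), of "(emb_right m k)\<^sup>T" "m + k"]
    by (subst sadj_add) (auto simp: emb_transpose_sadj simp del: distrib_left_numeral)
  have "sadj n (m + k) (pair_emb m k S T) * pair_emb m k S T
    = emb_left m k * ((sadj n m S * S) * (emb_left m k)\<^sup>T) + emb_right m k * ((sadj n k T * S) * (emb_left m k)\<^sup>T)
      + (emb_left m k * ((sadj n m S * T) * (emb_right m k)\<^sup>T) + emb_right m k * ((sadj n k T * T) * (emb_right m k)\<^sup>T))"
    unfolding s unfolding pair_emb_def using c by (simp add: mat_dist mat_assoc)
  also have "\<dots> = 1\<^sub>m (2 * (m + k))"
    unfolding orth orth' semb_sadj[OF S] semb_sadj[OF T]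
    by (simp add: mat_unit mat_add_zero emb_complete)
  finally show "semb n (m + k) (pair_emb m k S T)"
    using c pair_emb_carrier semb_iff_sadj by blast
qed

lemma semb_emb: "semb (m + k) m (emb_left m k)" "semb (m + k) k (emb_right m k)"
  by (simp_all add: semb_def mat_assoc emb_symp del: distrib_left_numeral)

lemma diamond_Sp: assumes "M \<in> Sp m" "N \<in> Sp k" shows "M \<diamond> N \<in> Sp (m + k)"
proof -
  have M: "M \<in> carrier_mat (2 * m) (2 * m)" and N: "N \<in> carrier_mat (2 * k) (2 * k)" using assms Sp_carrier by auto
  have "semb (m + k) (m + k) (pair_emb m k (emb_left m k * M) (emb_right m k * N))"
  proof (rule semb_pair)
    show "semb (m + k) m (emb_left m k * M)" "semb (m + k) k (emb_right m k * N)"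
      using assms semb_mult[OF semb_emb(1)] semb_mult[OF semb_emb(2)] by (auto simp: Sp_iff_semb)
    show "sadj (m + k) m (emb_left m k * M) * (emb_right m k * N) = 0\<^sub>m (2 * m) (2 * k)"
      using M N sadj_mult[OF emb_carrier(1)[of m k] M]
      by (simp add: emb_left_sadj mat_assoc emb_cancel mat_unit del: distrib_left_numeral)
  qed
  moreover have "pair_emb m k (emb_left m k * M) (emb_right m k * N) = M \<diamond> N"
    unfolding diamond_eq[OF M N] pair_emb_def using M N by (simp add: mat_assoc)
  ultimately show ?thesis by (simp add: Sp_iff_semb)
qed

lemma symp_similar_diamond:
  assumes "symp_similar m M M'" "symp_similar k N N'"
  shows "symp_similar (m + k) (M \<diamond> N) (M' \<diamond> N')"
proof -
  obtain P where P: "P \<in> Sp m" "P * M = M' * P" and c: "M \<in> carrier_mat (2 * m) (2 * m)" "M' \<in> carrier_mat (2 * m) (2 * m)"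
    using symp_similarE[OF assms(1)] .
  obtain Q where Q: "Q \<in> Sp k" "Q * N = N' * Q" and d: "N \<in> carrier_mat (2 * k) (2 * k)" "N' \<in> carrier_mat (2 * k) (2 * k)"
    using symp_similarE[OF assms(2)] .
  show ?thesis
    by (rule symp_similarI[OF diamond_Sp[OF P(1) Q(1)]])
      (use P Q c d Sp_carrier[OF P(1)] Sp_carrier[OF Q(1)] in \<open>auto simp: diamond_mult\<close>)
qed

lemma diamond_commute:
  assumes M: "M \<in> carrier_mat (2 * m) (2 * m)" and N: "N \<in> carrier_mat (2 * k) (2 * k)"
  shows "symp_similar (m + k) (M \<diamond> N) (N \<diamond> M)"
proof -
  define P where "P = pair_emb m k (emb_right k m) (emb_left k m)"
  have s: "semb (m + k) m (emb_right k m)" "semb (m + k) k (emb_left k m)"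
    using semb_emb[of k m] by (simp_all add: add.commute)
  have "semb (m + k) (m + k) P" unfolding P_def
    by (rule semb_pair[OF s]) (simp add: emb_right_sadj[of k m, unfolded add.commute[of k m]] emb_orthonormal)
  then have P: "P \<in> Sp (m + k)" by (simp add: Sp_iff_semb)
  have "P * (M \<diamond> N) = (N \<diamond> M) * P"
    unfolding diamond_eq[OF M N] diamond_eq[OF N M] P_def pair_emb_def using M N
    by (simp add: mat_dist mat_assoc add.commute[of k m] emb_cancel mat_unit mat_add_zero emb_orthonormal)
  then show ?thesis using symp_similarI[OF P] M N diamond_carrier[OF M N] diamond_carrier[OF N M] by (simp add: add.commute)
qed

lemma diamond_zero_left: "M \<in> carrier_mat (2 * m) (2 * m) \<Longrightarrow> 0\<^sub>m 0 0 \<diamond> M = M"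
  by (rule eq_matI) (auto simp: diamond_def split_block_def Let_def)

lemma diamond_zero_right: "M \<in> carrier_mat (2 * m) (2 * m) \<Longrightarrow> M \<diamond> 0\<^sub>m 0 0 = M"
  by (rule eq_matI) (auto simp: diamond_def split_block_def Let_def)

lemma diamond_four_block:
  assumes "A1 \<in> carrier_mat m m" "B1 \<in> carrier_mat m m" "C1 \<in> carrier_mat m m" "D1 \<in> carrier_mat m m"
    "A2 \<in> carrier_mat k k" "B2 \<in> carrier_mat k k" "C2 \<in> carrier_mat k k" "D2 \<in> carrier_mat k k"
  shows "four_block_mat A1 B1 C1 D1 \<diamond> four_block_mat A2 B2 C2 D2
    = four_block_mat (diag_block_mat [A1, A2]) (diag_block_mat [B1, B2]) (diag_block_mat [C1, C2]) (diag_block_mat [D1, D2])"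
proof -
  have 1: "split_block (four_block_mat A1 B1 C1 D1) m m = (A1, B1, C1, D1)"
    unfolding split_block_def Let_def using assms(1-4) by (auto intro!: eq_matI)
  have 2: "split_block (four_block_mat A2 B2 C2 D2) k k = (A2, B2, C2, D2)"
    unfolding split_block_def Let_def using assms(5-8) by (auto intro!: eq_matI)
  have d: "dim_row (four_block_mat A1 B1 C1 D1) div 2 = m" "dim_col (four_block_mat A1 B1 C1 D1) div 2 = m"
    "dim_row (four_block_mat A2 B2 C2 D2) div 2 = k" "dim_col (four_block_mat A2 B2 C2 D2) div 2 = k"
    using assms by auto
  show ?thesis unfolding diamond_def d 1 2 Let_def by simp
qed

lemma diag_block_assoc: "diag_block_mat [diag_block_mat [A, B], C] = diag_block_mat [A, diag_block_mat [B, C :: real mat]]"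
proof -
  have 1: "diag_block_mat [X, Y] = four_block_mat X (0\<^sub>m (dim_row X) (dim_col Y)) (0\<^sub>m (dim_row Y) (dim_col X)) Y" for X Y :: "real mat"
    by (simp add: Let_def diag_block_mat.simps(2)[of X "[Y]"] del: diag_block_mat.simps)
  have "diag_block_mat [diag_block_mat [A, B], C] = diag_block_mat ([A, B] @ [C])"
    by (simp only: diag_block_mat_append 1[of "diag_block_mat [A, B]"] Let_def diag_block_mat_singleton)
  also have "\<dots> = diag_block_mat (A # [B, C])" by simp
  also have "\<dots> = diag_block_mat [A, diag_block_mat [B, C]]"
    by (simp only: diag_block_mat.simps(2)[of A "[B, C]"] 1[of A] Let_def)
  finally show ?thesis .
qed

lemma split_carrier:
  assumes "M \<in> carrier_mat (2 * m) (2 * m)"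
  obtains A B C D :: "real mat" where "A \<in> carrier_mat m m" "B \<in> carrier_mat m m" "C \<in> carrier_mat m m" "D \<in> carrier_mat m m"
    "M = four_block_mat A B C D"
proof -
  obtain A B C D where "split_block M m m = (A, B, C, D)" by (cases "split_block M m m")
  from split_block[OF this, of m m] show ?thesis using assms that by (auto simp: mult_2)
qed

text \<open>Associativity holds on the nose, so only commutativity has to be weakened to similarity.\<close>

lemma diamond_assoc:
  assumes "L \<in> carrier_mat (2 * l) (2 * l)" "M \<in> carrier_mat (2 * m) (2 * m)" "N \<in> carrier_mat (2 * k) (2 * k)"
  shows "L \<diamond> M \<diamond> N = L \<diamond> (M \<diamond> N)"
proof -
  obtain A1 B1 C1 D1 where 1: "A1 \<in> carrier_mat l l" "B1 \<in> carrier_mat l l" "C1 \<in> carrier_mat l l" "D1 \<in> carrier_mat l l"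
    "L = four_block_mat A1 B1 C1 D1" using split_carrier[OF assms(1)] by metis
  obtain A2 B2 C2 D2 where 2: "A2 \<in> carrier_mat m m" "B2 \<in> carrier_mat m m" "C2 \<in> carrier_mat m m" "D2 \<in> carrier_mat m m"
    "M = four_block_mat A2 B2 C2 D2" using split_carrier[OF assms(2)] by metis
  obtain A3 B3 C3 D3 where 3: "A3 \<in> carrier_mat k k" "B3 \<in> carrier_mat k k" "C3 \<in> carrier_mat k k" "D3 \<in> carrier_mat k k"
    "N = four_block_mat A3 B3 C3 D3" using split_carrier[OF assms(3)] by metis
  have c: "diag_block_mat [A, B] \<in> carrier_mat (r + s) (r + s)" if "A \<in> carrier_mat r r" "B \<in> carrier_mat s s" for A B :: "real mat" and r s
    using that by (auto simp: Let_def)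
  have LM: "L \<diamond> M = four_block_mat (diag_block_mat [A1, A2]) (diag_block_mat [B1, B2]) (diag_block_mat [C1, C2]) (diag_block_mat [D1, D2])"
    unfolding 1(5) 2(5) by (rule diamond_four_block[OF 1(1-4) 2(1-4)])
  have MN: "M \<diamond> N = four_block_mat (diag_block_mat [A2, A3]) (diag_block_mat [B2, B3]) (diag_block_mat [C2, C3]) (diag_block_mat [D2, D3])"
    unfolding 2(5) 3(5) by (rule diamond_four_block[OF 2(1-4) 3(1-4)])
  show ?thesis
    unfolding LM MN unfolding 1(5) 3(5)
      diamond_four_block[OF c[OF 1(1) 2(1)] c[OF 1(2) 2(2)] c[OF 1(3) 2(3)] c[OF 1(4) 2(4)] 3(1-4)]
      diamond_four_block[OF 1(1-4) c[OF 2(1) 3(1)] c[OF 2(2) 3(2)] c[OF 2(3) 3(3)] c[OF 2(4) 3(4)]]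
    by (simp only: diag_block_assoc)
qed

section \<open>Splitting off an invariant symplectic subspace\<close>

text \<open>Zero rows make the matrix square, with determinant zero.\<close>

lemma wide_mat_kernel:
  assumes A: "A \<in> carrier_mat r c" and "r < c"
  shows "\<exists>v :: real vec. v \<in> carrier_vec c \<and> v \<noteq> 0\<^sub>v c \<and> A *\<^sub>v v = 0\<^sub>v r"
proof -
  define B where "B = mat c c (\<lambda>(i, j). if i < r then A $$ (i, j) else 0)"
  have B: "B \<in> carrier_mat c c" by (simp add: B_def)
  have "row B (c - 1) = 0\<^sub>v c" using assms by (intro eq_vecI) (auto simp: B_def)
  then have "B\<^sup>T *\<^sub>v unit_vec c (c - 1) = 0\<^sub>v c" using assms(2)
    by (intro eq_vecI) (auto simp: B_def)
  moreover have "unit_vec c (c - 1) \<noteq> (0\<^sub>v c :: real vec)" using assms(2) by (intro unit_vec_nonzero) auto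
  ultimately have "det (B\<^sup>T) = 0"
    unfolding det_0_iff_vec_prod_zero[of "B\<^sup>T" c, simplified, OF B]
    by (intro exI[of _ "unit_vec c (c - 1)"]) auto
  then have "det B = 0" using det_transpose[OF B] by simp
  then obtain v where v: "v \<in> carrier_vec c" "v \<noteq> 0\<^sub>v c" "B *\<^sub>v v = 0\<^sub>v c"
    using det_0_iff_vec_prod_zero[OF B] by blast
  have "A *\<^sub>v v = 0\<^sub>v r"
  proof (rule eq_vecI)
    fix i assume i: "i < dim_vec (0\<^sub>v r :: real vec)"
    have "row A i = row B i" using i assms by (intro eq_vecI) (auto simp: B_def)
    then have "(A *\<^sub>v v) $ i = (B *\<^sub>v v) $ i" using i assms B by simp
    then show "(A *\<^sub>v v) $ i = 0\<^sub>v r $ i" using v(3) i assms by simp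
  qed (use A in auto)
  then show ?thesis using v by blast
qed

lemma semb_le: assumes "semb n k S" shows "k \<le> n"
proof (rule ccontr)
  assume "\<not> k \<le> n"
  then obtain v :: "real vec" where v: "v \<in> carrier_vec (2 * k)" "v \<noteq> 0\<^sub>v (2 * k)" "S *\<^sub>v v = 0\<^sub>v (2 * n)"
    using wide_mat_kernel[OF semb_carrier[OF assms]] by auto
  have "sadj n k S *\<^sub>v (S *\<^sub>v v) = v"
    using v(1) semb_dim[OF assms] by (simp add: mat_vec_assoc[symmetric] semb_sadj[OF assms])
  moreover have "sadj n k S *\<^sub>v 0\<^sub>v (2 * n) = 0\<^sub>v (2 * k)" by (rule eq_vecI) auto
  ultimately show False using v by simp
qed

section \<open>The symplectic form on vectors and orthogonal complements\<close>

text \<open>The symplectic form \<open>\<omega>\<close> on vectors.\<close>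

definition om :: "nat \<Rightarrow> real vec \<Rightarrow> real vec \<Rightarrow> real" where
  "om n u v = u \<bullet> (symp_form n *\<^sub>v v)"

lemma mat_vec_add: "dim_vec u = dim_col A \<Longrightarrow> dim_vec v = dim_col A \<Longrightarrow> A *\<^sub>v (u + v) = A *\<^sub>v u + A *\<^sub>v (v :: 'a :: comm_ring_1 vec)"
  by (rule mult_add_distrib_mat_vec) (auto intro: carrier_vecI)

lemma mat_vec_minus: "dim_vec u = dim_col A \<Longrightarrow> dim_vec v = dim_col A \<Longrightarrow> A *\<^sub>v (u - v) = A *\<^sub>v u - A *\<^sub>v (v :: 'a :: comm_ring_1 vec)"
  by (rule mult_minus_distrib_mat_vec) (auto intro: carrier_vecI)

lemma mat_vec_smult: "dim_vec v = dim_col A \<Longrightarrow> A *\<^sub>v (c \<cdot>\<^sub>v v) = c \<cdot>\<^sub>v (A *\<^sub>v (v :: 'a :: comm_ring_1 vec))"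
  by (rule eq_vecI) auto

lemma mat_vec_zero: "dim_col A = n \<Longrightarrow> A *\<^sub>v 0\<^sub>v n = (0\<^sub>v (dim_row A) :: 'a :: comm_ring_1 vec)"
  by (rule eq_vecI) auto

lemma mat_add_vec: "dim_row A = dim_row B \<Longrightarrow> dim_col A = dim_col B \<Longrightarrow> dim_vec v = dim_col A \<Longrightarrow>
    (A + B) *\<^sub>v v = A *\<^sub>v v + B *\<^sub>v (v :: 'a :: comm_ring_1 vec)"
  by (rule add_mult_distrib_mat_vec) (auto intro: carrier_vecI)

lemma mat_minus_vec: "dim_row A = dim_row B \<Longrightarrow> dim_col A = dim_col B \<Longrightarrow> dim_vec v = dim_col A \<Longrightarrow>
    (A - B) *\<^sub>v v = A *\<^sub>v v - B *\<^sub>v (v :: 'a :: comm_ring_1 vec)"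
  by (rule minus_mult_distrib_mat_vec) (auto intro: carrier_vecI)

lemma mat_smult_vec: "dim_vec v = dim_col A \<Longrightarrow> (c \<cdot>\<^sub>m A) *\<^sub>v v = c \<cdot>\<^sub>v (A *\<^sub>v (v :: 'a :: comm_ring_1 vec))"
  by (rule eq_vecI) (auto simp: scalar_prod_def sum_distrib_left mult.assoc)

lemma mat_uminus_vec: "dim_vec v = dim_col A \<Longrightarrow> (- A) *\<^sub>v v = - (A *\<^sub>v (v :: 'a :: comm_ring_1 vec))"
  by (rule eq_vecI) (auto simp: scalar_prod_def sum_negf)

lemma mat_one_vec: "dim_vec v = n \<Longrightarrow> 1\<^sub>m n *\<^sub>v v = (v :: 'a :: comm_ring_1 vec)"
  by (rule one_mult_mat_vec) (auto intro: carrier_vecI)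

lemma mat_zero_vec: "dim_vec v = c \<Longrightarrow> 0\<^sub>m r c *\<^sub>v v = (0\<^sub>v r :: 'a :: comm_ring_1 vec)"
  by (rule eq_vecI) auto

lemmas mat_vec = mat_vec_add mat_vec_minus mat_vec_smult mat_vec_zero mat_add_vec mat_minus_vec
  mat_smult_vec mat_uminus_vec mat_one_vec mat_zero_vec

lemma om_add_left: "u \<in> carrier_vec (2 * n) \<Longrightarrow> v \<in> carrier_vec (2 * n) \<Longrightarrow> om n (u + v) w = om n u w + om n v w"
  unfolding om_def by (rule add_scalar_prod_distrib) (auto intro!: carrier_vecI)

lemma om_add_right: "u \<in> carrier_vec (2 * n) \<Longrightarrow> v \<in> carrier_vec (2 * n) \<Longrightarrow> w \<in> carrier_vec (2 * n) \<Longrightarrow> om n w (u + v) = om n w u + om n w v"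
  unfolding om_def by (simp add: mat_vec_add) (rule scalar_prod_add_distrib, auto intro!: carrier_vecI)

lemma om_smult_left: "u \<in> carrier_vec (2 * n) \<Longrightarrow> om n (c \<cdot>\<^sub>v u) w = c * om n u w"
  unfolding om_def by simp

lemma om_smult_right: "u \<in> carrier_vec (2 * n) \<Longrightarrow> w \<in> carrier_vec (2 * n) \<Longrightarrow> om n w (c \<cdot>\<^sub>v u) = c * om n w u"
  unfolding om_def by (simp add: mat_vec_smult)

lemma om_minus_left: "u \<in> carrier_vec (2 * n) \<Longrightarrow> v \<in> carrier_vec (2 * n) \<Longrightarrow> om n (u - v) w = om n u w - om n v w"
  unfolding om_def by (rule minus_scalar_prod_distrib) (auto intro!: carrier_vecI)

lemma om_zero: "om n (0\<^sub>v (2 * n)) w = 0" "w \<in> carrier_vec (2 * n) \<Longrightarrow> om n w (0\<^sub>v (2 * n)) = 0"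
  unfolding om_def by (auto simp: mat_vec_zero intro!: scalar_prod_left_zero carrier_vecI)

lemma om_sym: assumes "u \<in> carrier_vec (2 * n)" "v \<in> carrier_vec (2 * n)" shows "om n u v = - om n v u"
proof -
  have "om n v u = ((symp_form n)\<^sup>T *\<^sub>v v) \<bullet> u"
    unfolding om_def by (rule transpose_vec_mult_scalar[symmetric]) (use assms in auto)
  also have "\<dots> = - ((symp_form n *\<^sub>v v) \<bullet> u)"
    using assms by (simp add: symp_form_transpose mat_uminus_vec)
  also have "(symp_form n *\<^sub>v v) \<bullet> u = om n u v"
    unfolding om_def by (rule comm_scalar_prod[of _ "2 * n"]) (use assms in \<open>auto intro!: carrier_vecI\<close>)
  finally show ?thesis by simp
qed

lemma om_self: "u \<in> carrier_vec (2 * n) \<Longrightarrow> om n u u = 0"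
  using om_sym[of u n u] by simp

lemma om_adj:
  assumes "A \<in> carrier_mat (2 * n) (2 * k)" "u \<in> carrier_vec (2 * k)" "v \<in> carrier_vec (2 * n)"
  shows "om n (A *\<^sub>v u) v = om k u (sadj n k A *\<^sub>v v)"
proof -
  have "symp_form k * sadj n k A = A\<^sup>T * symp_form n"
    using assms by (simp add: sadj_def mat_dist mat_neg symp_form_square')
  then have "symp_form k *\<^sub>v (sadj n k A *\<^sub>v v) = A\<^sup>T *\<^sub>v (symp_form n *\<^sub>v v)"
    using assms by (simp add: mat_vec_assoc[symmetric])
  then have "om k u (sadj n k A *\<^sub>v v) = u \<bullet> (A\<^sup>T *\<^sub>v (symp_form n *\<^sub>v v))" by (simp add: om_def)
  also have "\<dots> = (A\<^sup>T *\<^sub>v (symp_form n *\<^sub>v v)) \<bullet> u"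
    by (rule comm_scalar_prod[of _ "2 * k"]) (use assms in \<open>auto intro!: carrier_vecI\<close>)
  also have "\<dots> = (symp_form n *\<^sub>v v) \<bullet> (A *\<^sub>v u)"
    by (rule transpose_vec_mult_scalar[OF assms(1,2)]) (use assms in \<open>auto intro!: carrier_vecI\<close>)
  also have "\<dots> = om n (A *\<^sub>v u) v" unfolding om_def
    by (rule comm_scalar_prod[of _ "2 * n"]) (use assms in \<open>auto intro!: carrier_vecI\<close>)
  finally show ?thesis by simp
qed

lemma om_nondegenerate:
  assumes "u \<in> carrier_vec (2 * n)" "u \<noteq> 0\<^sub>v (2 * n)"
  shows "\<exists>v. v \<in> carrier_vec (2 * n) \<and> om n u v \<noteq> 0"
proof -
  have "symp_form n *\<^sub>v (symp_form n *\<^sub>v u) = - u"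
    using assms by (simp add: mat_vec_assoc[symmetric] symp_form_square mat_uminus_vec mat_one_vec)
  then have "om n u (symp_form n *\<^sub>v u) = - (u \<bullet> u)" using assms by (simp add: om_def)
  moreover have "u \<bullet> u \<noteq> 0" 
    using conjugate_square_eq_0_vec[OF assms(1)] assms(2) by (simp add: conjugate_id[where 'a = real])
  ultimately show ?thesis using assms by (intro exI[of _ "symp_form n *\<^sub>v u"]) (auto intro!: carrier_vecI)
qed

lemma transpose_form_mult_index:
  assumes "A \<in> carrier_mat (2 * n) c" "B \<in> carrier_mat (2 * n) d" "i < c" "j < d"
  shows "(A\<^sup>T * (symp_form n * B)) $$ (i, j) = om n (col A i) (col B j)"
proof -
  have "col (symp_form n * B) j = symp_form n *\<^sub>v col B j" using assms by (intro eq_vecI) auto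
  then show ?thesis using assms by (simp add: om_def)
qed

text \<open>A vector \<open>x\<close> orthogonal to the image of \<open>S\<close> exists because the dimension of the image is too small.
  Nondegeneracy gives a vector \<open>z\<close> with \<open>\<omega>(x, z) \<noteq> 0\<close>; projecting \<open>z\<close> along the image of \<open>S\<close> makes it
  orthogonal to that image as well and does not change its pairing with \<open>x\<close>.\<close>

lemma semb_extend_step:
  assumes S: "semb n k S" and "k < n"
  shows "\<exists>T. semb n 1 T \<and> sadj n k S * T = 0\<^sub>m (2 * k) (2 * 1)"
proof -
  note c = semb_carrier[OF S]
  obtain x :: "real vec" where x: "x \<in> carrier_vec (2 * n)" "x \<noteq> 0\<^sub>v (2 * n)" "sadj n k S *\<^sub>v x = 0\<^sub>v (2 * k)"
    using wide_mat_kernel[OF sadj_carrier] \<open>k < n\<close> by (metis mult_less_cancel1 zero_less_numeral)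
  obtain z where z: "z \<in> carrier_vec (2 * n)" "om n x z \<noteq> 0" using om_nondegenerate[OF x(1,2)] by blast
  define y where "y = z - S *\<^sub>v (sadj n k S *\<^sub>v z)"
  have y: "y \<in> carrier_vec (2 * n)" unfolding y_def using z c by (auto intro!: carrier_vecI)
  have Sz: "sadj n k S *\<^sub>v (S *\<^sub>v (sadj n k S *\<^sub>v z)) = sadj n k S *\<^sub>v z"
    using c z by (simp add: mat_vec_assoc[of "sadj n k S" S, symmetric] semb_sadj[OF S] mat_one_vec)
  have "sadj n k S *\<^sub>v y = sadj n k S *\<^sub>v z - sadj n k S *\<^sub>v (S *\<^sub>v (sadj n k S *\<^sub>v z))"
    unfolding y_def by (rule mat_vec_minus) (use c z in auto)
  moreover have "sadj n k S *\<^sub>v z - sadj n k S *\<^sub>v z = 0\<^sub>v (2 * k)"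
    by (rule minus_cancel_vec) (auto intro: carrier_vecI)
  ultimately have Sy: "sadj n k S *\<^sub>v y = 0\<^sub>v (2 * k)" unfolding Sz by (rule trans)
  have v: "sadj n k S *\<^sub>v z \<in> carrier_vec (2 * k)" by (rule carrier_vecI) simp
  have "om n (S *\<^sub>v (sadj n k S *\<^sub>v z)) x = 0"
    unfolding om_adj[OF c v x(1)] x(3) by (rule om_zero(2)[OF v])
  moreover have "om n y x = om n z x - om n (S *\<^sub>v (sadj n k S *\<^sub>v z)) x" unfolding y_def
    by (rule om_minus_left) (use z c in \<open>auto intro!: carrier_vecI\<close>)
  ultimately have yx: "om n y x \<noteq> 0" using om_sym[OF x(1) z(1)] z(2) by simp
  define T where "T = mat_of_cols (2 * n) [x, (1 / om n y x) \<cdot>\<^sub>v y]"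
  have T: "T \<in> carrier_mat (2 * n) (2 * 1)" by (auto simp: T_def mat_of_cols_def)
  have T0: "col T 0 = x" and T1: "col T 1 = (1 / om n y x) \<cdot>\<^sub>v y"
    using x y by (auto simp: T_def mat_of_cols_def intro!: eq_vecI)
  let ?w = "(1 / om n y x) \<cdot>\<^sub>v y"
  have w: "?w \<in> carrier_vec (2 * n)" using y by simp
  have "om n ?w x = 1" using y yx by (simp add: om_smult_left)
  then have om: "om n ?w x = 1" "om n x ?w = - 1" "om n x x = 0" "om n ?w ?w = 0"
    using om_sym[OF x(1) w] om_self[OF x(1)] om_self[OF w] by auto
  have "T\<^sup>T * (symp_form n * T) = symp_form 1"
  proof (rule eq_matI)
    fix i j assume "i < dim_row (symp_form 1)" "j < dim_col (symp_form 1)"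
    then have ij: "i < 2 * 1" "j < 2 * 1" by auto
    then consider "i = 0" "j = 0" | "i = 0" "j = 1" | "i = 1" "j = 0" | "i = 1" "j = 1" by linarith
    then show "(T\<^sup>T * (symp_form n * T)) $$ (i, j) = symp_form 1 $$ (i, j)"
      unfolding transpose_form_mult_index[OF T T ij] symp_form_index[OF ij] by cases (simp_all only: T0 T1 om, simp_all)
  qed (use T in auto)
  then have "semb n 1 T" using T by (simp add: semb_def mat_assoc)
  moreover have "sadj n k S * T = 0\<^sub>m (2 * k) (2 * 1)"
  proof (rule eq_matI)
    fix i j assume "i < dim_row (0\<^sub>m (2 * k) (2 * 1) :: real mat)" "j < dim_col (0\<^sub>m (2 * k) (2 * 1) :: real mat)"
    then have i: "i < 2 * k" and j: "j = 0 \<or> j = 1" by auto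
    have "sadj n k S *\<^sub>v col T j = 0\<^sub>v (2 * k)"
      using j T0 T1 x(3) Sy y by (auto simp: mat_vec)
    then have "(sadj n k S *\<^sub>v col T j) $ i = 0" using i by simp
    then show "(sadj n k S * T) $$ (i, j) = 0\<^sub>m (2 * k) (2 * 1) $$ (i, j)" using i j T by auto
  qed (use T in auto)
  ultimately show ?thesis by blast
qed

lemma semb_extend:
  "semb n k S \<Longrightarrow> \<exists>S'. semb n (n - k) S' \<and> sadj n k S * S' = 0\<^sub>m (2 * k) (2 * (n - k))"
proof (induction "n - k" arbitrary: k S)
  case 0
  then have "semb n (n - k) (0\<^sub>m (2 * n) 0)" by (auto simp: semb_def intro!: eq_matI)
  then show ?case using 0 by (intro exI[of _ "0\<^sub>m (2 * n) 0"]) (auto intro!: eq_matI)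
next
  case (Suc r)
  then obtain T where T: "semb n 1 T" "sadj n k S * T = 0\<^sub>m (2 * k) (2 * 1)"
    using semb_extend_step[OF Suc.prems] Suc.hyps(2) zero_less_diff zero_less_Suc by metis
  let ?S = "pair_emb k 1 S T"
  note p = semb_pair[OF Suc.prems T(1) T(2)]
  obtain S' where S': "semb n (n - (k + 1)) S'" "sadj n (k + 1) ?S * S' = 0\<^sub>m (2 * (k + 1)) (2 * (n - (k + 1)))"
    using Suc.hyps(1)[OF _ p(1)] Suc.hyps(2) by (metis Suc_eq_plus1 diff_Suc_1 diff_diff_left)
  note c = semb_carrier[OF Suc.prems] semb_carrier[OF T(1)] semb_carrier[OF S'(1)]
  have z: "emb_left k 1 * (sadj n k S * S') + emb_right k 1 * (sadj n 1 T * S') = 0\<^sub>m (2 * (k + 1)) (2 * (n - (k + 1)))"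
    using S'(2) c unfolding p(2) by (simp add: mat_dist mat_assoc)
  have 1: "sadj n k S * S' = 0\<^sub>m (2 * k) (2 * (n - (k + 1)))"
    using arg_cong[OF z, of "(*) ((emb_left k 1)\<^sup>T)"] c
    by (simp add: mat_dist emb_cancel mat_unit mat_add_zero)
  have 2: "sadj n 1 T * S' = 0\<^sub>m (2 * 1) (2 * (n - (k + 1)))"
    using arg_cong[OF z, of "(*) ((emb_right k 1)\<^sup>T)"] c
    by (simp add: mat_dist emb_cancel mat_unit mat_add_zero)
  have "1 + (n - (k + 1)) = n - k" using Suc.hyps(2) by auto
  then have "semb n (n - k) (pair_emb 1 (n - (k + 1)) T S')" using semb_pair(1)[OF T(1) S'(1) 2] by simp
  moreover have "sadj n k S * pair_emb 1 (n - (k + 1)) T S'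
     = (sadj n k S * T) * (emb_left 1 (n - (k + 1)))\<^sup>T + (sadj n k S * S') * (emb_right 1 (n - (k + 1)))\<^sup>T"
    unfolding pair_emb_def using c by (simp add: mat_dist mat_assoc)
  then have "sadj n k S * pair_emb 1 (n - (k + 1)) T S' = 0\<^sub>m (2 * k) (2 * (1 + (n - (k + 1))))"
    unfolding T(2) 1 by (simp add: mat_unit mat_add_zero)
  then have "sadj n k S * pair_emb 1 (n - (k + 1)) T S' = 0\<^sub>m (2 * k) (2 * (n - k))"
    unfolding \<open>1 + (n - (k + 1)) = n - k\<close> .
  ultimately show ?case by blast
qed

lemma invariant_semb_Sp:
  assumes X: "X \<in> Sp n" and S: "semb n k S" and H: "H \<in> carrier_mat (2 * k) (2 * k)" "X * S = S * H"
  shows "H \<in> Sp k"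
proof -
  have "semb n k (S * H)" unfolding H(2)[symmetric] using X S semb_mult Sp_iff_semb by blast
  then have "sadj n k (S * H) * (S * H) = 1\<^sub>m (2 * k)" by (rule semb_sadj)
  moreover have "sadj n k (S * H) * (S * H) = sadj k k H * ((sadj n k S * S) * H)"
    using semb_carrier[OF S] H(1) by (simp add: sadj_mult[of _ n k] mat_assoc)
  ultimately show ?thesis using H(1) by (simp add: semb_sadj[OF S] mat_unit Sp_iff_semb semb_iff_sadj)
qed

text \<open>The complement of an invariant nondegenerate subspace is invariant too: \<open>X S = S H\<close> with \<open>H\<close>
  invertible gives \<open>S\<^sup>* X = H S\<^sup>*\<close>, hence \<open>S\<^sup>* X S' = 0\<close> for the complementary embedding \<open>S'\<close>.\<close>

lemma symp_split_add:
  assumes X: "X \<in> Sp (k + r)" and S: "semb (k + r) k S" and H: "H \<in> carrier_mat (2 * k) (2 * k)" "X * S = S * H"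
  shows "\<exists>X'. X' \<in> Sp r \<and> H \<in> Sp k \<and> symp_similar (k + r) X (H \<diamond> X')"
proof -
  obtain S' where S': "semb (k + r) r S'" "sadj (k + r) k S * S' = 0\<^sub>m (2 * k) (2 * r)"
    using semb_extend[OF S] by auto
  have Hs: "H \<in> Sp k" by (rule invariant_semb_Sp[OF X S H])
  note c = semb_carrier[OF S] semb_carrier[OF S'(1)] H(1) Sp_carrier[OF X]
  let ?L = "emb_left k r" and ?R = "emb_right k r"
  define P where "P = pair_emb k r S S'"
  note p = semb_pair[OF S S'(1,2), folded P_def]
  have P: "P \<in> Sp (k + r)" using p(1) by (simp add: Sp_iff_semb)
  define X' where "X' = sadj (k + r) r S' * (X * S')"
  have X'c: "X' \<in> carrier_mat (2 * r) (2 * r)" unfolding X'_def using c by (auto intro!: carrier_matI)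
  have "S * sadj k k H = sadj (k + r) (k + r) X * ((X * S) * sadj k k H)"
    using c by (simp add: mat_assoc[symmetric] Sp_sadj_left[OF X] mat_unit)
  also have "\<dots> = (sadj (k + r) (k + r) X * S) * (H * sadj k k H)" unfolding H(2) using c by (simp add: mat_assoc)
  finally have "S * sadj k k H = sadj (k + r) (k + r) X * S" using c by (simp add: Sp_sadj_right[OF Hs] mat_unit)
  then have "sadj (k + r) k (S * sadj k k H) = sadj (k + r) k (sadj (k + r) (k + r) X * S)" by simp
  moreover have "sadj (k + r) k (sadj (k + r) (k + r) X * S) = sadj (k + r) k S * sadj (k + r) (k + r) (sadj (k + r) (k + r) X)"
    by (rule sadj_mult[OF sadj_carrier c(1)])
  moreover have "sadj (k + r) k (S * sadj k k H) = sadj k k (sadj k k H) * sadj (k + r) k S"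
    by (rule sadj_mult[OF c(1) sadj_carrier])
  ultimately have "H * sadj (k + r) k S = sadj (k + r) k S * X"
    by (simp only: sadj_sadj[OF c(4)] sadj_sadj[OF c(3)])
  then have "sadj (k + r) k S * (X * S') = H * (sadj (k + r) k S * S')" using c by (simp add: mat_assoc[symmetric])
  then have 0: "sadj (k + r) k S * (X * S') = 0\<^sub>m (2 * k) (2 * r)" using c unfolding S'(2) by (simp add: mat_unit)
  have Ps: "sadj (k + r) (k + r) P = ?L * sadj (k + r) k S + ?R * sadj (k + r) r S'" using p(2) by simp
  have "X * S' = P * (sadj (k + r) (k + r) P * (X * S'))"
    using c Sp_carrier[OF P] by (simp add: mat_assoc[symmetric] Sp_sadj_right[OF P] mat_unit)
  also have "\<dots> = (P * ?L) * (sadj (k + r) k S * (X * S')) + (P * ?R) * X'"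
    unfolding Ps X'_def using c Sp_carrier[OF P] by (simp add: mat_dist mat_assoc)
  also have "\<dots> = S' * X'" unfolding 0 P_def pair_emb_emb[OF c(1,2)] using X'c c by (simp add: mat_unit mat_add_zero)
  finally have XS': "X * S' = S' * X'" .
  have "P * (H \<diamond> X') = (P * ?L) * (H * ?L\<^sup>T) + (P * ?R) * (X' * ?R\<^sup>T)"
    unfolding diamond_eq[OF H(1) X'c] using c X'c Sp_carrier[OF P] by (simp add: mat_dist mat_assoc)
  also have "\<dots> = (S * H) * ?L\<^sup>T + (S' * X') * ?R\<^sup>T"
    unfolding P_def pair_emb_emb[OF c(1,2)] using c X'c by (simp add: mat_assoc)
  also have "\<dots> = X * P" unfolding H(2)[symmetric] XS'[symmetric] P_def pair_emb_def using c by (simp add: mat_dist mat_assoc)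
  finally have "symp_similar (k + r) (H \<diamond> X') X"
    using symp_similarI[OF P] c X'c diamond_carrier[OF H(1) X'c] by simp
  moreover have "X' \<in> Sp r" by (rule invariant_semb_Sp[OF X S'(1) X'c XS'])
  ultimately show ?thesis using Hs symp_similar_sym by blast
qed

lemma symp_split:
  assumes X: "X \<in> Sp n" and S: "semb n k S" and H: "H \<in> carrier_mat (2 * k) (2 * k)" "X * S = S * H"
  shows "\<exists>X'. X' \<in> Sp (n - k) \<and> H \<in> Sp k \<and> k \<le> n \<and> symp_similar n X (H \<diamond> X')"
proof -
  obtain r where n: "n = k + r" using semb_le[OF S] le_Suc_ex by blast
  obtain X' where X': "X' \<in> Sp r" "H \<in> Sp k" "symp_similar (k + r) X (H \<diamond> X')"
    using symp_split_add[OF X[unfolded n] S[unfolded n] H] by blast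
  show ?thesis by (intro exI[of _ X'] conjI) (use X' in \<open>simp_all add: n\<close>)
qed

section \<open>Wonenburger matrices and the normal form of a cyclic block\<close>

text \<open>The embeddings of the first and of the second half of the coordinates; block matrices become
  sums of products with them.\<close>

definition low_emb :: "nat \<Rightarrow> real mat" where "low_emb k = sel_mat (2 * k) k (\<lambda>j. j)"
definition high_emb :: "nat \<Rightarrow> real mat" where "high_emb k = sel_mat (2 * k) k (\<lambda>j. j + k)"

lemma low_high_dim [simp]: "dim_row (low_emb k) = 2 * k" "dim_col (low_emb k) = k"
  "dim_row (high_emb k) = 2 * k" "dim_col (high_emb k) = k"
  by (auto simp: low_emb_def high_emb_def)

lemma low_emb_mult: assumes "dim_row X = k" "i < 2 * k" "j < dim_col X"
  shows "(low_emb k * X) $$ (i, j) = (if i < k then X $$ (i, j) else 0)"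
  using assms by (simp add: scalar_prod_def low_emb_def sel_mat_def if_distrib[of "\<lambda>x. x * _"] cong: if_cong)

lemma high_emb_mult: assumes "dim_row X = k" "i < 2 * k" "j < dim_col X"
  shows "(high_emb k * X) $$ (i, j) = (if i < k then 0 else X $$ (i - k, j))"
proof -
  have "i = a + k \<longleftrightarrow> a = i - k \<and> \<not> i < k" for a by auto
  then show ?thesis using assms
    by (simp add: scalar_prod_def high_emb_def sel_mat_def if_distrib[of "\<lambda>x. x * _"] cong: if_cong) arith
qed

lemma mult_low_emb: assumes "dim_col X = k" "j < 2 * k" "i < dim_row X"
  shows "(X * (low_emb k)\<^sup>T) $$ (i, j) = (if j < k then X $$ (i, j) else 0)"
  using low_emb_mult[of "X\<^sup>T" k j i] assms mat_transpose_mult[of "low_emb k" "X\<^sup>T"]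
  by (metis (no_types, lifting) index_mult_mat(2,3) index_transpose_mat low_high_dim(1,2) transpose_transpose)

lemma mult_high_emb: assumes "dim_col X = k" "j < 2 * k" "i < dim_row X"
  shows "(X * (high_emb k)\<^sup>T) $$ (i, j) = (if j < k then 0 else X $$ (i, j - k))"
proof -
  have "X * (high_emb k)\<^sup>T = (high_emb k * X\<^sup>T)\<^sup>T"
    using assms by (simp add: mat_tr)
  then show ?thesis using high_emb_mult[of "X\<^sup>T" k j i] assms by (simp del: index_mult_mat(1))
qed

lemma four_block_mat_low_high:
  assumes "A \<in> carrier_mat k k" "B \<in> carrier_mat k k" "C \<in> carrier_mat k k" "D \<in> carrier_mat k k"
  shows "four_block_mat A B C D = low_emb k * (A * (low_emb k)\<^sup>T) + low_emb k * (B * (high_emb k)\<^sup>T)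
    + (high_emb k * (C * (low_emb k)\<^sup>T) + high_emb k * (D * (high_emb k)\<^sup>T))"
  by (rule eq_matI)
    (use assms in \<open>auto simp: low_emb_mult high_emb_mult mult_low_emb mult_high_emb simp del: index_mult_mat(1)\<close>)

lemma low_high_orthonormal:
  "(low_emb k)\<^sup>T * low_emb k = 1\<^sub>m k" "(low_emb k)\<^sup>T * high_emb k = 0\<^sub>m k k"
  "(high_emb k)\<^sup>T * low_emb k = 0\<^sub>m k k" "(high_emb k)\<^sup>T * high_emb k = 1\<^sub>m k"
  by (auto intro!: eq_matI simp: low_emb_def high_emb_def transpose_sel_mat_mult simp del: index_mult_mat(1))
    (auto simp: sel_mat_def)

lemma low_high_cancel:
  "dim_row A = k \<Longrightarrow> (low_emb k)\<^sup>T * (low_emb k * A) = A"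
  "dim_row A = k \<Longrightarrow> (low_emb k)\<^sup>T * (high_emb k * A) = 0\<^sub>m k (dim_col A)"
  "dim_row A = k \<Longrightarrow> (high_emb k)\<^sup>T * (low_emb k * A) = 0\<^sub>m k (dim_col A)"
  "dim_row A = k \<Longrightarrow> (high_emb k)\<^sup>T * (high_emb k * A) = A"
  by (simp_all add: mat_assoc[symmetric] low_high_orthonormal mat_unit)

lemma sadj_four_block:
  assumes "A \<in> carrier_mat k k" "B \<in> carrier_mat k k" "C \<in> carrier_mat k k" "D \<in> carrier_mat k k"
  shows "sadj k k (four_block_mat A B C D)
    = four_block_mat (D\<^sup>T) (- B\<^sup>T) (- C\<^sup>T) (A\<^sup>T)"
proof -
  have t: "(four_block_mat A B C D)\<^sup>T = four_block_mat (A\<^sup>T) (C\<^sup>T) (B\<^sup>T) (D\<^sup>T)"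
    by (rule transpose_four_block_mat[OF assms])
  have "(four_block_mat A B C D)\<^sup>T * symp_form k
    = four_block_mat (C\<^sup>T) (- A\<^sup>T) (D\<^sup>T) (- B\<^sup>T)"
    unfolding t symp_form_def using assms
    by (subst mult_four_block_mat[of _ k k _ k _ k _ _ k _ k]) (auto simp: mat_unit mat_dist mat_add_zero)
  then have "symp_form k * ((four_block_mat A B C D)\<^sup>T * symp_form k)
    = four_block_mat (- D\<^sup>T) (B\<^sup>T) (C\<^sup>T) (- A\<^sup>T)"
    unfolding symp_form_def using assms
    by (simp only:, subst mult_four_block_mat[of _ k k _ k _ k _ _ k _ k]) (auto simp: mat_unit mat_dist mat_add_zero mat_neg)
  then show ?thesis unfolding sadj_def using assms by (simp only:) (rule eq_matI, auto)
qed

lemma sadj_wblock: assumes "wonenburger_rel k A B C"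
  shows "sadj k k (wblock A B C) = four_block_mat A (- B) (- C) (A\<^sup>T)"
  using assms sadj_four_block[of A k B C "A\<^sup>T"]
  by (simp add: wonenburger_rel_def wblock_def)

lemma wblock_carrier: "wonenburger_rel k A B C \<Longrightarrow> wblock A B C \<in> carrier_mat (2 * k) (2 * k)"
  by (auto simp: wonenburger_rel_def wblock_def intro!: carrier_matI)

lemma wblock_Sp: assumes "wonenburger_rel k A B C" shows "wblock A B C \<in> Sp k"
proof -
  have c: "A \<in> carrier_mat k k" "B \<in> carrier_mat k k" "C \<in> carrier_mat k k"
    and s: "B\<^sup>T = B" "C\<^sup>T = C"
    and r: "A * B = B * A\<^sup>T" "A\<^sup>T * C = C * A" "A * A - B * C = 1\<^sub>m k"
    using assms by (auto simp: wonenburger_rel_def)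
  have r4: "A\<^sup>T * A\<^sup>T - C * B = 1\<^sub>m k"
    using arg_cong[OF r(3), of transpose_mat] c s by (simp add: mat_tr)
  have e: "X + - Y = X - Y" "- X + Y = Y - X" if "X \<in> carrier_mat k k" "Y \<in> carrier_mat k k" for X Y :: "real mat"
    using that by (auto intro!: eq_matI)
  have "sadj k k (wblock A B C) * wblock A B C = four_block_mat (1\<^sub>m k) (0\<^sub>m k k) (0\<^sub>m k k) (1\<^sub>m k)"
    unfolding sadj_wblock[OF assms] unfolding wblock_def
    by (subst mult_four_block_mat[of _ k k _ k _ k _ _ k _ k])
      (use c in \<open>auto simp: mat_dist e r(1)[symmetric] r(2)[symmetric] r(3) r4 mat_minus_self\<close>)
  also have "\<dots> = 1\<^sub>m (2 * k)" by (rule eq_matI) auto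
  finally show ?thesis using wblock_carrier[OF assms] by (simp add: Sp_iff_semb semb_iff_sadj)
qed

lemma wonenburger_Sp: "wonenburger k N \<Longrightarrow> N \<in> Sp k"
  by (auto simp: wonenburger_def wblock_Sp)

lemma diag_block_carrier: "A \<in> carrier_mat r r \<Longrightarrow> B \<in> carrier_mat s s \<Longrightarrow> diag_block_mat [A, B] \<in> carrier_mat (r + s) (r + s)"
  by (auto simp: Let_def)

lemma diag_block_two: "diag_block_mat [X, Y] = four_block_mat X (0\<^sub>m (dim_row X) (dim_col Y)) (0\<^sub>m (dim_row Y) (dim_col X)) (Y :: real mat)"
  by (simp add: Let_def diag_block_mat.simps(2)[of X "[Y]"] del: diag_block_mat.simps)

lemma diag_block_mult: "A \<in> carrier_mat r r \<Longrightarrow> B \<in> carrier_mat s s \<Longrightarrow> C \<in> carrier_mat r r \<Longrightarrow> D \<in> carrier_mat s s \<Longrightarrow>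
   diag_block_mat [A, B] * diag_block_mat [C, D] = diag_block_mat [A * C, B * (D :: real mat)]"
  unfolding diag_block_two by (subst mult_four_block_mat[of _ r r _ s _ s _ _ r _ s]) (auto simp: mat_unit mat_add_zero)

lemma diag_block_transpose: "A \<in> carrier_mat r r \<Longrightarrow> B \<in> carrier_mat s s \<Longrightarrow>
   (diag_block_mat [A, B])\<^sup>T = diag_block_mat [A\<^sup>T, (B :: real mat)\<^sup>T]"
  unfolding diag_block_two by (subst transpose_four_block_mat[of _ r r _ s _ s]) auto

lemma wonenburger_diamond: assumes "wonenburger m N" "wonenburger k N'" shows "wonenburger (m + k) (N \<diamond> N')"
proof -
  obtain A B C where 1: "wonenburger_rel m A B C" and N: "N = wblock A B C" using assms(1) by (auto simp: wonenburger_def)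
  obtain A' B' C' where 2: "wonenburger_rel k A' B' C'" and N': "N' = wblock A' B' C'" using assms(2) by (auto simp: wonenburger_def)
  have c: "A \<in> carrier_mat m m" "B \<in> carrier_mat m m" "C \<in> carrier_mat m m" "A' \<in> carrier_mat k k" "B' \<in> carrier_mat k k" "C' \<in> carrier_mat k k"
    using 1 2 by (auto simp: wonenburger_rel_def)
  have r: "B\<^sup>T = B" "C\<^sup>T = C" "A * B = B * A\<^sup>T" "A\<^sup>T * C = C * A" "A * A - B * C = 1\<^sub>m m"
    using 1 by (auto simp: wonenburger_rel_def)
  have r': "B'\<^sup>T = B'" "C'\<^sup>T = C'" "A' * B' = B' * A'\<^sup>T" "A'\<^sup>T * C' = C' * A'" "A' * A' - B' * C' = 1\<^sub>m k"
    using 2 by (auto simp: wonenburger_rel_def)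
  let ?A = "diag_block_mat [A, A']" and ?B = "diag_block_mat [B, B']" and ?C = "diag_block_mat [C, C']"
  have m: "diag_block_mat [X, Y] - diag_block_mat [Z, W] = diag_block_mat [X - Z, Y - W]"
    if "X \<in> carrier_mat m m" "Z \<in> carrier_mat m m" "Y \<in> carrier_mat k k" "W \<in> carrier_mat k k" for X Y Z W :: "real mat"
    unfolding diag_block_two using that by (auto intro!: eq_matI)
  have o: "diag_block_mat [1\<^sub>m m, 1\<^sub>m k :: real mat] = 1\<^sub>m (m + k)"
    unfolding diag_block_two by (rule eq_matI) auto
  have "wonenburger_rel (m + k) ?A ?B ?C" unfolding wonenburger_rel_def
    using c diag_block_carrier[OF c(1,4)] diag_block_carrier[OF c(2,5)] diag_block_carrier[OF c(3,6)]
    by (auto simp: diag_block_mult[of _ m _ k] diag_block_transpose[of _ m _ k] m r r' o simp del: diag_block_mat.simps)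
  moreover have "N \<diamond> N' = wblock ?A ?B ?C" unfolding N N' wblock_def
    using c by (subst diamond_four_block[of _ m _ _ _ _ k]) (auto simp: diag_block_transpose[of _ m _ k] simp del: diag_block_mat.simps)
  ultimately show ?thesis by (auto simp: wonenburger_def)
qed

text \<open>If \<open>B\<close> is invertible, the last relation determines \<open>C\<close>, and it then satisfies the others because
  \<open>B\<close> conjugates \<open>A\<^sup>T\<close> to \<open>A\<close>.\<close>

lemma wonenburger_relI:
  assumes A: "A \<in> carrier_mat k k" and B: "B \<in> carrier_mat k k" and B': "B' \<in> carrier_mat k k"
    and inv: "B * B' = 1\<^sub>m k" "B' * B = 1\<^sub>m k" and sym: "B\<^sup>T = B" and AB: "A * B = B * A\<^sup>T"
  shows "wonenburger_rel k A B (B' * (A * A - 1\<^sub>m k))"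
proof -
  have "B'\<^sup>T = B'\<^sup>T * (B * B')" using B' inv by (simp add: mat_unit)
  also have "\<dots> = (B * B')\<^sup>T * B'" using B B' sym by (simp add: mat_tr mat_assoc)
  finally have symB': "B'\<^sup>T = B'" using B' inv by (simp add: mat_unit transpose_one)
  have "B' * A = B' * ((A * B) * B')" using A B B' inv by (simp add: mat_assoc mat_unit)
  also have "\<dots> = (B' * B) * (A\<^sup>T * B')" unfolding AB using A B B' by (simp add: mat_assoc)
  finally have c: "B' * A = A\<^sup>T * B'" using A B' inv by (simp add: mat_unit)
  have cA: "B' * (A * X) = A\<^sup>T * (B' * X)" if "dim_row X = k" for X
    using c that A B' by (simp add: mat_assoc[symmetric])
  have BB: "B * (B' * X) = X" if "dim_row X = k" for X
    using that B B' inv by (simp add: mat_assoc[symmetric] mat_unit)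
  have "A * A - (A * A - 1\<^sub>m k) = 1\<^sub>m k" using A by (intro eq_matI) auto
  then have 1: "A * A - B * (B' * (A * A - 1\<^sub>m k)) = 1\<^sub>m k" using A by (simp only: BB[of "A * A - 1\<^sub>m k"] index_minus_mat index_one_mat)
  have 2: "(B' * (A * A - 1\<^sub>m k))\<^sup>T = B' * (A * A - 1\<^sub>m k)"
    using A B' symB' by (simp add: mat_tr mat_dist mat_unit mat_assoc cA c)
  have 3: "A\<^sup>T * (B' * (A * A - 1\<^sub>m k)) = B' * (A * A - 1\<^sub>m k) * A"
    using A B' symB' by (simp add: mat_tr mat_dist mat_unit mat_assoc cA c)
  show ?thesis unfolding wonenburger_rel_def
    using A B B' sym AB 1 2 3 by (auto intro!: carrier_matI)
qed

lemma antidiag_sel: "antidiag_mat k = sel_mat k k (\<lambda>j. k - 1 - j)"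
  by (rule eq_matI) (auto simp: antidiag_mat_def sel_mat_def)

lemma antidiag_dim [simp]: "dim_row (antidiag_mat k) = k" "dim_col (antidiag_mat k) = k"
  by (auto simp: antidiag_mat_def)

lemma antidiag_carrier [simp]: "antidiag_mat k \<in> carrier_mat k k"
  by (rule carrier_matI) auto

lemma antidiag_transpose: "(antidiag_mat k)\<^sup>T = antidiag_mat k"
  by (rule eq_matI) (auto simp: antidiag_mat_def add.commute)

lemma mult_antidiag: "dim_col A = k \<Longrightarrow> i < dim_row A \<Longrightarrow> j < k \<Longrightarrow> (A * antidiag_mat k) $$ (i, j) = A $$ (i, k - 1 - j)"
  unfolding antidiag_sel by (subst mult_sel_mat) auto

lemma antidiag_mult: "dim_row A = k \<Longrightarrow> i < k \<Longrightarrow> j < dim_col A \<Longrightarrow> (antidiag_mat k * A) $$ (i, j) = A $$ (k - 1 - i, j)"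
proof -
  assume a: "dim_row A = k" "i < k" "j < dim_col A"
  have "antidiag_mat k = (sel_mat k k (\<lambda>j. k - 1 - j))\<^sup>T"
    by (simp only: antidiag_sel[symmetric] antidiag_transpose)
  then show ?thesis using a by (simp only:, subst transpose_sel_mat_mult) auto
qed

lemma antidiag_square: "antidiag_mat k * antidiag_mat k = 1\<^sub>m k"
  by (rule eq_matI) (auto simp: mult_antidiag simp del: index_mult_mat(1), auto simp: antidiag_mat_def)

lemma antidiag_jordan: "jordan_block k a * antidiag_mat k = antidiag_mat k * (jordan_block k (a :: real))\<^sup>T"
  by (rule eq_matI) (auto simp: mult_antidiag antidiag_mult simp del: index_mult_mat(1))

lemma jordan_block_dim [simp]: "dim_row (jordan_block k (a :: real)) = k" "dim_col (jordan_block k a) = k"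
  using jordan_block_carrier[of k a] by auto

text \<open>The normal form, with sign \<open>s\<close>, of a cyclic symplectic map \<open>M\<close> for which \<open>(M + M\<^sup>-\<^sup>1)/2 - \<mu>\<close> is
  nilpotent of order \<open>k\<close>. For \<open>\<mu> = -1\<close> it is an even summand, for \<open>\<mu> = (l + 1/l)/2\<close> its eigenvalues
  are \<open>l\<close> and \<open>1/l\<close>, and for \<open>\<mu> = 0\<close> they are \<open>\<plusminus>i\<close>.\<close>

definition wnf :: "nat \<Rightarrow> real \<Rightarrow> real \<Rightarrow> real mat" where
  "wnf k s \<mu> = wblock (jordan_block k \<mu>) (s \<cdot>\<^sub>m antidiag_mat k)
     ((s \<cdot>\<^sub>m antidiag_mat k) * (jordan_block k \<mu> * jordan_block k \<mu> - 1\<^sub>m k))"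

lemma wnf_rel: assumes "s * s = 1"
  shows "wonenburger_rel k (jordan_block k \<mu>) (s \<cdot>\<^sub>m antidiag_mat k)
     ((s \<cdot>\<^sub>m antidiag_mat k) * (jordan_block k \<mu> * jordan_block k \<mu> - 1\<^sub>m k))"
  by (rule wonenburger_relI)
    (auto simp: mat_dist mat_smult_smult assms antidiag_square mat_tr antidiag_transpose antidiag_jordan intro!: eq_matI)

lemma wnf_wonenburger: "s * s = 1 \<Longrightarrow> wonenburger k (wnf k s \<mu>)"
  unfolding wonenburger_def wnf_def using wnf_rel by blast

lemma wnf_Sp: "s * s = 1 \<Longrightarrow> wnf k s \<mu> \<in> Sp k"
  using wnf_wonenburger wonenburger_Sp by blast

section \<open>Self-adjoint and anti-self-adjoint parts\<close>

text \<open>For symplectic \<open>M\<close> the two parts are \<open>(M + M\<^sup>-\<^sup>1)/2\<close> and \<open>(M - M\<^sup>-\<^sup>1)/2\<close>. They commute, the first is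
  self-adjoint, the second anti-self-adjoint, and they are related like hyperbolic cosine and sine.
  Vanishing of moments of a vector follows from these symmetries.\<close>

definition sym_part :: "nat \<Rightarrow> real mat \<Rightarrow> real mat" where
  "sym_part n M = (1 / 2) \<cdot>\<^sub>m (M + sadj n n M)"

definition alt_part :: "nat \<Rightarrow> real mat \<Rightarrow> real mat" where
  "alt_part n M = (1 / 2) \<cdot>\<^sub>m (M - sadj n n M)"

lemma part_dim [simp]: "dim_row (sym_part n M) = 2 * n" "dim_col (sym_part n M) = 2 * n"
  "dim_row (alt_part n M) = 2 * n" "dim_col (alt_part n M) = 2 * n"
  by (auto simp: sym_part_def alt_part_def)

lemma part_carrier [simp]: "sym_part n M \<in> carrier_mat (2 * n) (2 * n)" "alt_part n M \<in> carrier_mat (2 * n) (2 * n)"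
  by (auto intro!: carrier_matI)

lemma sadj_sym_part: "M \<in> carrier_mat (2 * n) (2 * n) \<Longrightarrow> sadj n n (sym_part n M) = sym_part n M"
  unfolding sym_part_def
  by (subst sadj_smult[of _ n n], auto intro!: carrier_matI simp: sadj_add sadj_sadj)

lemma sadj_alt_part: "M \<in> carrier_mat (2 * n) (2 * n) \<Longrightarrow> sadj n n (alt_part n M) = - alt_part n M"
  unfolding alt_part_def
  by (subst sadj_smult[of _ n n], auto intro!: carrier_matI simp: sadj_minus sadj_sadj)
    (rule eq_matI, auto simp: algebra_simps diff_divide_distrib)

lemma sym_alt_sum: "M \<in> carrier_mat (2 * n) (2 * n) \<Longrightarrow> M = sym_part n M + alt_part n M"
  unfolding sym_part_def alt_part_def by (rule eq_matI) (auto simp: field_simps)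

lemma Sp_cancel:
  assumes "X \<in> Sp n" "dim_row A = 2 * n"
  shows "X * (sadj n n X * A) = A" "sadj n n X * (X * A) = A"
  using assms Sp_carrier[OF assms(1)]
  by (simp_all add: mat_assoc[symmetric] Sp_sadj_left Sp_sadj_right mat_unit)

lemma alt_part_square:
  assumes "M \<in> Sp n" shows "alt_part n M * alt_part n M = sym_part n M * sym_part n M - 1\<^sub>m (2 * n)"
proof -
  note c = Sp_carrier[OF assms]
  show ?thesis unfolding sym_part_def alt_part_def using c
    by (simp add: mat_dist mat_smult_smult Sp_sadj_left[OF assms] Sp_sadj_right[OF assms])
      (rule eq_matI, auto simp: field_simps simp del: index_mult_mat(1))
qed

lemma sym_alt_commute:
  assumes "M \<in> Sp n" shows "sym_part n M * alt_part n M = alt_part n M * sym_part n M"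
proof -
  note c = Sp_carrier[OF assms]
  show ?thesis unfolding sym_part_def alt_part_def using c
    by (simp add: mat_dist mat_smult_smult Sp_sadj_left[OF assms] Sp_sadj_right[OF assms])
      (rule eq_matI, auto simp: field_simps simp del: index_mult_mat(1))
qed

lemma sadj_square: "X \<in> Sp n \<Longrightarrow> sadj n n (X * X) = sadj n n X * sadj n n X"
  using Sp_carrier sadj_mult by blast

lemma sym_part_square:
  assumes "X \<in> Sp n"
  shows "sym_part n (X * X) = 2 \<cdot>\<^sub>m (sym_part n X * sym_part n X) - 1\<^sub>m (2 * n)"
  unfolding sym_part_def sadj_square[OF assms] using Sp_carrier[OF assms]
  by (simp add: mat_dist mat_smult_smult Sp_sadj_left[OF assms] Sp_sadj_right[OF assms])
      (rule eq_matI, auto simp: field_simps simp del: index_mult_mat(1))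

lemma alt_part_of_square:
  assumes "X \<in> Sp n"
  shows "alt_part n (X * X) = 2 \<cdot>\<^sub>m (alt_part n X * sym_part n X)"
  unfolding sym_part_def alt_part_def sadj_square[OF assms] using Sp_carrier[OF assms]
  by (simp add: mat_dist mat_smult_smult Sp_sadj_left[OF assms] Sp_sadj_right[OF assms])
      (rule eq_matI, auto simp: field_simps simp del: index_mult_mat(1))

lemma part_square_commute:
  assumes "X \<in> Sp n"
  shows "sym_part n (X * X) * X = X * sym_part n (X * X)" "alt_part n (X * X) * X = X * alt_part n (X * X)"
  unfolding sym_part_def alt_part_def sadj_square[OF assms] using Sp_carrier[OF assms]
  by (simp_all add: mat_dist mat_assoc Sp_cancel[OF assms] Sp_sadj_left[OF assms] Sp_sadj_right[OF assms] mat_unit)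

abbreviation mpow :: "real mat \<Rightarrow> nat \<Rightarrow> real vec \<Rightarrow> real vec" where
  "mpow T j w \<equiv> ((\<lambda>v. T *\<^sub>v v) ^^ j) w"

lemma mpow_carrier: "T \<in> carrier_mat m m \<Longrightarrow> w \<in> carrier_vec m \<Longrightarrow> mpow T j w \<in> carrier_vec m"
  by (induction j) auto

lemma mpow_mpow: "mpow T i (mpow T j w) = mpow T (i + j) w"
  by (simp add: funpow_add)

lemma mpow_commute:
  assumes "T \<in> carrier_mat m m" "Z \<in> carrier_mat m m" "T * Z = Z * T" "w \<in> carrier_vec m"
  shows "mpow T j (Z *\<^sub>v w) = Z *\<^sub>v mpow T j w"
proof (induction j)
  case (Suc j)
  have "T *\<^sub>v (Z *\<^sub>v mpow T j w) = Z *\<^sub>v (T *\<^sub>v mpow T j w)"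
    using assms mpow_carrier[OF assms(1,4), of j] by (simp flip: assoc_mult_mat_vec)
  then show ?case using Suc by simp
qed simp

lemma mpow_zero: "T \<in> carrier_mat m m \<Longrightarrow> mpow T j (0\<^sub>v m) = 0\<^sub>v m"
  by (induction j) (auto simp: mat_vec_zero)

lemma mpow_beyond: "T \<in> carrier_mat m m \<Longrightarrow> mpow T k w = 0\<^sub>v m \<Longrightarrow> k \<le> j \<Longrightarrow> mpow T j w = 0\<^sub>v m"
  using mpow_mpow[where T = T and i = "j - k" and j = k and w = w] by (simp add: mpow_zero)

lemma mpow_add: "T \<in> carrier_mat m m \<Longrightarrow> u \<in> carrier_vec m \<Longrightarrow> v \<in> carrier_vec m \<Longrightarrow>
    mpow T j (u + v) = mpow T j u + mpow T j v"
proof (induction j)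
  case (Suc j)
  then show ?case using mpow_carrier[of T m u j] mpow_carrier[of T m v j] by (simp add: mat_vec_add)
qed simp

lemma mpow_smult: "T \<in> carrier_mat m m \<Longrightarrow> u \<in> carrier_vec m \<Longrightarrow> mpow T j (c \<cdot>\<^sub>v u) = c \<cdot>\<^sub>v mpow T j u"
proof (induction j)
  case (Suc j)
  then show ?case using mpow_carrier[of T m u j] by (simp add: mat_vec_smult)
qed simp

lemma om_selfadj: "T \<in> carrier_mat (2 * n) (2 * n) \<Longrightarrow> sadj n n T = T \<Longrightarrow> u \<in> carrier_vec (2 * n) \<Longrightarrow> v \<in> carrier_vec (2 * n) \<Longrightarrow>
    om n (T *\<^sub>v u) v = om n u (T *\<^sub>v v)"
  using om_adj[of T n n u v] by simp

lemma om_mpow: "T \<in> carrier_mat (2 * n) (2 * n) \<Longrightarrow> sadj n n T = T \<Longrightarrow> u \<in> carrier_vec (2 * n) \<Longrightarrow> v \<in> carrier_vec (2 * n) \<Longrightarrow>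
    om n (mpow T j u) v = om n u (mpow T j v)"
proof (induction j arbitrary: v)
  case (Suc j)
  have "om n (mpow T (Suc j) u) v = om n (mpow T j u) (T *\<^sub>v v)"
    using Suc.prems mpow_carrier[of T "2 * n" u j] om_selfadj by simp
  also have "\<dots> = om n u (mpow T j (T *\<^sub>v v))" using Suc by (intro Suc.IH) auto
  also have "mpow T j (T *\<^sub>v v) = mpow T (Suc j) v" by (simp add: funpow_swap1)
  finally show ?case .
qed simp

section \<open>Cyclic blocks\<close>

definition krylov :: "nat \<Rightarrow> nat \<Rightarrow> real mat \<Rightarrow> real vec \<Rightarrow> real mat" where
  "krylov n k T w = mat (2 * n) k (\<lambda>(i, j). mpow T j w $ i)"

lemma krylov_dim [simp]: "dim_row (krylov n k T w) = 2 * n" "dim_col (krylov n k T w) = k"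
  by (auto simp: krylov_def)

lemma krylov_carrier [simp]: "krylov n k T w \<in> carrier_mat (2 * n) k" by (rule carrier_matI) auto

lemma krylov_col: "T \<in> carrier_mat (2 * n) (2 * n) \<Longrightarrow> w \<in> carrier_vec (2 * n) \<Longrightarrow> j < k \<Longrightarrow>
    col (krylov n k T w) j = mpow T j w"
  using mpow_carrier[of T "2 * n" w j] by (intro eq_vecI) (auto simp: krylov_def)

lemma krylov_shift:
  assumes A: "A \<in> carrier_mat (2 * n) (2 * n)" and T: "T = A - \<mu> \<cdot>\<^sub>m 1\<^sub>m (2 * n)"
    and w: "w \<in> carrier_vec (2 * n)" "mpow T k w = 0\<^sub>v (2 * n)"
  shows "A * krylov n k T w = krylov n k T w * (jordan_block k \<mu>)\<^sup>T"
proof (rule eq_matI)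
  fix i j assume "i < dim_row (krylov n k T w * (jordan_block k \<mu>)\<^sup>T)"
    "j < dim_col (krylov n k T w * (jordan_block k \<mu>)\<^sup>T)"
  then have i: "i < 2 * n" and j: "j < k" by auto
  have Tc: "T \<in> carrier_mat (2 * n) (2 * n)" using A T by auto
  note v = mpow_carrier[OF Tc w(1), of j]
  have "A *\<^sub>v mpow T j w = mpow T (Suc j) w + \<mu> \<cdot>\<^sub>v mpow T j w"
  proof -
    have "T *\<^sub>v mpow T j w = A *\<^sub>v mpow T j w - \<mu> \<cdot>\<^sub>v mpow T j w"
      unfolding T using A v[unfolded T] by (simp add: mat_minus_vec mat_smult_vec mat_one_vec)
    then show ?thesis using A v by (auto intro!: eq_vecI)
  qed
  moreover have "(A * krylov n k T w) $$ (i, j) = (A *\<^sub>v mpow T j w) $ i"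
    using A i j krylov_col[OF Tc w(1) j] by simp
  ultimately have l: "(A * krylov n k T w) $$ (i, j) = mpow T (Suc j) w $ i + \<mu> * mpow T j w $ i"
    using v i mpow_carrier[OF Tc w(1), of "Suc j"] by simp
  have "(krylov n k T w * (jordan_block k \<mu>)\<^sup>T) $$ (i, j)
    = (\<Sum>a = 0..<k. mpow T a w $ i * (if a = j then \<mu> else if a = Suc j then 1 else 0))"
    using i j by (simp add: scalar_prod_def krylov_def) (rule sum.cong, auto)
  also have "\<dots> = (\<Sum>a = 0..<k. (if a = j then \<mu> * mpow T a w $ i else 0) + (if a = Suc j then mpow T a w $ i else 0))"
    by (rule sum.cong) auto
  also have "\<dots> = \<mu> * mpow T j w $ i + (if Suc j < k then mpow T (Suc j) w $ i else 0)"
    using j by (simp add: sum.distrib)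
  also have "(if Suc j < k then mpow T (Suc j) w $ i else 0) = mpow T (Suc j) w $ i"
  proof (cases "Suc j < k")
    case False
    then have "Suc j = k" using j by simp
    then show ?thesis using w(2) i by (metis False index_zero_vec(1))
  qed simp
  finally show "(A * krylov n k T w) $$ (i, j) = (krylov n k T w * (jordan_block k \<mu>)\<^sup>T) $$ (i, j)"
    using l by simp
qed (use A in auto)

text \<open>The moments \<open>\<omega>(T\<^sup>j w, w)\<close> vanish because \<open>T\<close> is self-adjoint and \<open>\<omega>\<close> is alternating. If the moments
  \<open>\<omega>(D T\<^sup>j w, w)\<close> vanish as well, except for \<open>-s\<close> at \<open>j = k - 1\<close>, then \<open>\<omega>\<close> is known on the span of all
  \<open>T\<^sup>j w\<close> and \<open>D T\<^sup>j w\<close>, since \<open>D\<^sup>2\<close> is a polynomial in \<open>T\<close>: the vectors \<open>s D T\<^sup>k\<^sup>-\<^sup>1\<^sup>-\<^sup>j w\<close> and \<open>T\<^sup>j w\<close> are a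
  symplectic basis of this span. In this basis \<open>M = T + \<mu> + D\<close> is in normal form.\<close>

locale cyclic_data =
  fixes n k :: nat and s \<mu> :: real and M T D :: "real mat" and w :: "real vec"
  assumes M: "M \<in> Sp n" and s: "s * s = 1" and w: "w \<in> carrier_vec (2 * n)"
    and T_def: "T = sym_part n M - \<mu> \<cdot>\<^sub>m 1\<^sub>m (2 * n)" and D_def: "D = alt_part n M"
    and nil: "mpow T k w = 0\<^sub>v (2 * n)"
    and form: "\<And>j. om n (D *\<^sub>v mpow T j w) w = (if Suc j = k then - s else 0)"
begin

definition "F = krylov n k T w"
definition "E = s \<cdot>\<^sub>m (D * (F * antidiag_mat k))"
definition "S = E * (low_emb k)\<^sup>T + F * (high_emb k)\<^sup>T"

lemma Mc: "M \<in> carrier_mat (2 * n) (2 * n)" using M Sp_carrier by blast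
lemma Tc: "T \<in> carrier_mat (2 * n) (2 * n)" by (rule carrier_matI) (simp_all add: T_def)
lemma Dc: "D \<in> carrier_mat (2 * n) (2 * n)" by (simp add: D_def)
lemma Fd [simp]: "dim_row F = 2 * n" "dim_col F = k" by (simp_all add: F_def)
lemma Fc: "F \<in> carrier_mat (2 * n) k" by (simp add: F_def)
lemma Ed [simp]: "dim_row E = 2 * n" "dim_col E = k" using Dc by (simp_all add: E_def)
lemma Sd [simp]: "dim_row S = 2 * n" "dim_col S = 2 * k" by (simp_all add: S_def)
lemma T_selfadj: "sadj n n T = T"
  unfolding T_def using Mc by (subst sadj_minus) (auto simp: sadj_sym_part sadj_smult[of _ n n] sadj_one)

lemma form_mult: "D\<^sup>T * symp_form n = - (symp_form n * D)"
proof -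
  have "symp_form n * sadj n n D = D\<^sup>T * symp_form n"
    using Dc by (simp add: sadj_def mat_dist mat_neg symp_form_square')
  moreover have "sadj n n D = - D" unfolding D_def by (rule sadj_alt_part[OF Mc])
  ultimately show ?thesis using Dc by (simp add: mat_uminus_right)
qed

lemma form_mult': "dim_row A = 2 * n \<Longrightarrow> D\<^sup>T * (symp_form n * A) = - (symp_form n * (D * A))"
  using arg_cong[OF form_mult, of "\<lambda>X. X * A"] Dc by (simp add: mat_assoc mat_uminus_left)

lemma sym_F: "sym_part n M * F = F * (jordan_block k \<mu>)\<^sup>T"
  unfolding F_def by (rule krylov_shift[OF _ T_def w nil]) simp

lemma DDF: "dim_row A = 2 * n \<Longrightarrow> D * (D * A) = sym_part n M * (sym_part n M * A) - A"
  using arg_cong[OF alt_part_square[OF M], of "\<lambda>X. X * A"]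
  by (simp add: D_def mat_assoc mat_minus_right mat_unit)

lemma FJF: "F\<^sup>T * (symp_form n * F) = 0\<^sub>m k k"
proof (rule eq_matI)
  fix i j assume "i < dim_row (0\<^sub>m k k :: real mat)" "j < dim_col (0\<^sub>m k k :: real mat)"
  then have ij: "i < k" "j < k" by auto
  have v: "mpow T a w \<in> carrier_vec (2 * n)" for a by (rule mpow_carrier[OF Tc w])
  have "om n (mpow T i w) (mpow T j w) = om n w (mpow T (i + j) w)"
    using om_mpow[OF Tc T_selfadj w v, of i j] by (simp add: mpow_mpow)
  moreover have "om n w (mpow T (i + j) w) = 0"
    using om_mpow[OF Tc T_selfadj w w, of "i + j"] om_sym[OF w v, of "i + j"] by simp
  ultimately show "(F\<^sup>T * (symp_form n * F)) $$ (i, j) = 0\<^sub>m k k $$ (i, j)"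
    using transpose_form_mult_index[OF Fc Fc ij] ij krylov_col[OF Tc w] by (simp add: F_def del: index_mult_mat(1))
qed auto

lemma FJDF: "F\<^sup>T * (symp_form n * (D * F)) = s \<cdot>\<^sub>m antidiag_mat k"
proof (rule eq_matI)
  fix i j assume "i < dim_row (s \<cdot>\<^sub>m antidiag_mat k)" "j < dim_col (s \<cdot>\<^sub>m antidiag_mat k)"
  then have ij: "i < k" "j < k" by auto
  have v: "mpow T a w \<in> carrier_vec (2 * n)" for a by (rule mpow_carrier[OF Tc w])
  have DT: "T * D = D * T" unfolding T_def D_def using sym_alt_commute[OF M] by (simp add: mat_dist mat_unit)
  have c: "col (D * F) j = D *\<^sub>v mpow T j w" using ij krylov_col[OF Tc w ij(2)] Dc by (intro eq_vecI) (auto simp: F_def)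
  have Dv: "D *\<^sub>v mpow T j w \<in> carrier_vec (2 * n)" using Dc v by auto
  have "om n (mpow T i w) (D *\<^sub>v mpow T j w) = om n w (mpow T i (D *\<^sub>v mpow T j w))"
    by (rule om_mpow[OF Tc T_selfadj w Dv])
  also have "\<dots> = om n w (D *\<^sub>v mpow T (i + j) w)"
    using mpow_commute[OF Tc Dc DT v, of i j] by (simp add: mpow_mpow)
  also have "\<dots> = - om n (D *\<^sub>v mpow T (i + j) w) w"
    using om_sym[OF w, of "D *\<^sub>v mpow T (i + j) w"] Dc v by auto
  also have "\<dots> = (s \<cdot>\<^sub>m antidiag_mat k) $$ (i, j)" using ij by (simp add: form antidiag_mat_def)
  finally show "(F\<^sup>T * (symp_form n * (D * F))) $$ (i, j) = (s \<cdot>\<^sub>m antidiag_mat k) $$ (i, j)"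
    using transpose_form_mult_index[OF Fc _ ij, of "D * F"] Dc Fc c krylov_col[OF Tc w ij(1)]
    by (simp add: F_def del: index_mult_mat(1))
qed (use Dc in auto)

lemma antidiag_square': "dim_row A = k \<Longrightarrow> antidiag_mat k * (antidiag_mat k * A) = A"
  using arg_cong[OF antidiag_square[of k], of "\<lambda>X. X * A"] by (simp add: mat_assoc mat_unit)

lemma FJE: "F\<^sup>T * (symp_form n * E) = 1\<^sub>m k"
proof -
  have "F\<^sup>T * (symp_form n * E) = s \<cdot>\<^sub>m ((F\<^sup>T * (symp_form n * (D * F))) * antidiag_mat k)"
    unfolding E_def using Dc by (simp add: mat_dist mat_assoc)
  then show ?thesis unfolding FJDF by (simp add: mat_dist mat_smult_smult s antidiag_square) (rule eq_matI, auto)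
qed

lemma EJF: "E\<^sup>T * (symp_form n * F) = - 1\<^sub>m k"
proof -
  have "(F\<^sup>T * (symp_form n * E))\<^sup>T = - (E\<^sup>T * (symp_form n * F))"
    by (simp add: mat_tr mat_assoc symp_form_transpose mat_dist)
  then show ?thesis unfolding FJE by (metis mat_uminus_uminus transpose_one)
qed

lemma EJE: "E\<^sup>T * (symp_form n * E) = 0\<^sub>m k k"
proof -
  have "F\<^sup>T * (symp_form n * (D * (D * F)))
    = (F\<^sup>T * (symp_form n * F)) * ((jordan_block k \<mu>)\<^sup>T * (jordan_block k \<mu>)\<^sup>T) - F\<^sup>T * (symp_form n * F)"
    using Dc by (simp add: DDF mat_dist mat_assoc sym_F)
      (simp add: mat_assoc[symmetric] sym_F)
  then have z: "F\<^sup>T * (symp_form n * (D * (D * F))) = 0\<^sub>m k k" unfolding FJF by (simp add: mat_unit mat_minus_self)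
  have "E\<^sup>T * (symp_form n * E)
    = - (antidiag_mat k * ((F\<^sup>T * (symp_form n * (D * (D * F)))) * antidiag_mat k))"
    unfolding E_def using Dc by (simp add: mat_tr mat_dist mat_neg mat_assoc form_mult' mat_smult_smult antidiag_transpose s)
      (rule eq_matI, auto)
  then show ?thesis unfolding z by (simp add: mat_unit) (rule eq_matI, auto)
qed

lemma semb_S: "semb n k S"
proof -
  have "S\<^sup>T * (symp_form n * S) =
     low_emb k * ((E\<^sup>T * (symp_form n * E)) * (low_emb k)\<^sup>T) + high_emb k * ((F\<^sup>T * (symp_form n * E)) * (low_emb k)\<^sup>T)
   + (low_emb k * ((E\<^sup>T * (symp_form n * F)) * (high_emb k)\<^sup>T) + high_emb k * ((F\<^sup>T * (symp_form n * F)) * (high_emb k)\<^sup>T))"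
    unfolding S_def by (simp add: mat_tr mat_dist mat_assoc)
  also have "\<dots> = high_emb k * (low_emb k)\<^sup>T + - (low_emb k * (high_emb k)\<^sup>T)"
    unfolding EJE FJE EJF FJF by (simp add: mat_unit mat_add_zero mat_dist)
  also have "\<dots> = - (low_emb k * (high_emb k)\<^sup>T) + high_emb k * (low_emb k)\<^sup>T"
    by (rule comm_add_mat[of _ "2 * k" "2 * k"]) (auto intro!: carrier_matI)
  also have "\<dots> = symp_form k" unfolding symp_form_def
    by (subst four_block_mat_low_high[of _ k]) (auto simp: mat_unit mat_add_zero mat_dist)
  finally show ?thesis by (simp add: semb_def mat_assoc carrier_matI)
qed

lemma M_S: "M * S = S * wnf k s \<mu>"
proof -
  let ?A = "jordan_block k \<mu>" and ?K = "antidiag_mat k"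
  let ?C = "(s \<cdot>\<^sub>m ?K) * (?A * ?A - 1\<^sub>m k)"
  have Meq: "M = sym_part n M + D" unfolding D_def by (rule sym_alt_sum[OF Mc])
  have KA: "?A * ?K = ?K * ?A\<^sup>T" by (rule antidiag_jordan)
  have AK: "?A\<^sup>T * ?K = ?K * ?A"
  proof -
    have "?A\<^sup>T * ?K = ?K * ((?K * ?A\<^sup>T) * ?K)" by (simp add: mat_assoc antidiag_square')
    also have "\<dots> = ?K * ?A" unfolding KA[symmetric] by (simp add: mat_assoc antidiag_square mat_unit)
    finally show ?thesis .
  qed
  have AK': "?A\<^sup>T * (?K * B) = ?K * (?A * B)" if "dim_row B = k" for B
    using arg_cong[OF AK, of "\<lambda>X. X * B"] that by (simp add: mat_assoc)
  have EK: "E * (s \<cdot>\<^sub>m ?K) = D * F"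
    unfolding E_def using Dc by (simp add: mat_dist mat_assoc mat_smult_smult s antidiag_square mat_unit) (rule eq_matI, auto)
  have "M * F = (sym_part n M + D) * F" using Meq by simp
  also have "\<dots> = E * (s \<cdot>\<^sub>m ?K) + F * ?A\<^sup>T"
    unfolding EK using Dc by (simp add: mat_dist sym_F) (rule comm_add_mat[of _ "2 * n" k], auto)
  finally have MF: "M * F = E * (s \<cdot>\<^sub>m ?K) + F * ?A\<^sup>T" .
  have SD: "sym_part n M * (D * B) = D * (sym_part n M * B)" if "dim_row B = 2 * n" for B
    using arg_cong[OF sym_alt_commute[OF M], of "\<lambda>X. X * B"] that by (simp add: D_def mat_assoc)
  have SF: "sym_part n M * (F * B) = F * (?A\<^sup>T * B)" if "dim_row B = k" for B
    using arg_cong[OF sym_F, of "\<lambda>X. X * B"] that by (simp add: mat_assoc)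
  have "M * E = (sym_part n M + D) * E" using Meq by simp
  also have "\<dots> = s \<cdot>\<^sub>m (D * (F * (?K * ?A)) + (F * (?K * (?A * ?A)) - F * ?K))"
    unfolding E_def using Dc by (simp add: mat_dist mat_assoc SD SF DDF AK AK')
  also have "\<dots> = s \<cdot>\<^sub>m (D * (F * (?K * ?A))) + s \<cdot>\<^sub>m (F * (?K * (?A * ?A)) - F * ?K)"
    by (rule add_smult_distrib_left_mat[of _ "2 * n" k]) (use Dc in \<open>auto intro!: carrier_matI\<close>)
  also have "s \<cdot>\<^sub>m (D * (F * (?K * ?A))) = E * ?A"
    unfolding E_def using Dc by (simp add: mat_dist mat_assoc mat_unit)
  also have "s \<cdot>\<^sub>m (F * (?K * (?A * ?A)) - F * ?K) = F * ?C"
    by (simp add: mat_dist mat_assoc mat_unit mat_smult_minus)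
  finally have ME: "M * E = E * ?A + F * ?C" .
  have "M * S = (M * E) * (low_emb k)\<^sup>T + (M * F) * (high_emb k)\<^sup>T"
    unfolding S_def using Mc by (simp add: mat_dist mat_assoc)
  also have "\<dots> = S * wnf k s \<mu>"
    unfolding ME MF wnf_def wblock_def S_def
    by (subst four_block_mat_low_high[of _ k])
      (auto simp: mat_dist mat_assoc low_high_cancel mat_unit mat_add_zero intro!: carrier_matI)
  finally show ?thesis .
qed

end

section \<open>Doubled blocks\<close>

text \<open>The block matrix with rows \<open>(0, N)\<close> and \<open>(1, 0)\<close>, written in diamond coordinates. Its square is
  \<open>N \<diamond> N\<close>, and it is symplectic together with \<open>N\<close>; so every doubled summand has a square root.\<close>

definition swap_root :: "nat \<Rightarrow> real mat \<Rightarrow> real mat" where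
  "swap_root k N = pair_emb k k (emb_right k k) (emb_left k k * N)"

lemma swap_root_Sp: assumes N: "N \<in> Sp k" shows "swap_root k N \<in> Sp (k + k)"
proof -
  have s: "semb (k + k) k (emb_left k k * N)" using semb_mult[OF semb_emb(1)] N by (simp add: Sp_iff_semb)
  have "sadj (k + k) k (emb_right k k) * (emb_left k k * N) = 0\<^sub>m (2 * k) (2 * k)"
    unfolding emb_right_sadj using Sp_carrier[OF N] by (simp add: emb_cancel)
  from semb_pair(1)[OF semb_emb(2) s this] show ?thesis by (simp add: swap_root_def Sp_iff_semb)
qed

lemma swap_root_square: assumes N: "N \<in> carrier_mat (2 * k) (2 * k)" shows "swap_root k N * swap_root k N = N \<diamond> N"
  unfolding swap_root_def pair_emb_def diamond_eq[OF N N] using N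
  by (simp add: mat_dist mat_assoc emb_cancel mat_unit mat_add_zero emb_orthonormal)

text \<open>For \<open>M = X\<^sup>2\<close> the map \<open>X\<close> carries the cyclic block \<open>U\<close> of \<open>w\<close> isometrically to the block \<open>X U\<close>. The
  vanishing of all \<open>\<omega>(X T\<^sup>j w, w)\<close> makes the two orthogonal, and \<open>X\<close> then acts on their sum as
  \<open>swap_root\<close> of the normal form of \<open>M\<close> on \<open>U\<close>.\<close>

locale double_data = cyclic_data n k s \<mu> "X * X" T D w
  for n k s \<mu> X T D w +
  assumes X: "X \<in> Sp n" and cross: "\<And>j. om n (X *\<^sub>v mpow T j w) w = 0"
begin

lemma Xc: "X \<in> carrier_mat (2 * n) (2 * n)" using X Sp_carrier by blast
lemma Xd [simp]: "dim_row X = 2 * n" "dim_col X = 2 * n" using Xc by auto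
lemma Dd [simp]: "dim_row D = 2 * n" "dim_col D = 2 * n" using Dc by auto

lemma FJXF: "F\<^sup>T * (symp_form n * (X * F)) = 0\<^sub>m k k"
proof (rule eq_matI)
  fix i j assume "i < dim_row (0\<^sub>m k k :: real mat)" "j < dim_col (0\<^sub>m k k :: real mat)"
  then have ij: "i < k" "j < k" by auto
  have v: "mpow T a w \<in> carrier_vec (2 * n)" for a by (rule mpow_carrier[OF Tc w])
  have XT: "T * X = X * T" unfolding T_def using part_square_commute[OF X] Xc by (simp add: mat_dist mat_unit)
  have c: "col (X * F) j = X *\<^sub>v mpow T j w" using ij krylov_col[OF Tc w ij(2)] Xc by (intro eq_vecI) (auto simp: F_def)
  have Xv: "X *\<^sub>v mpow T a w \<in> carrier_vec (2 * n)" for a using Xc v by auto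
  have "om n (mpow T i w) (X *\<^sub>v mpow T j w) = om n w (mpow T i (X *\<^sub>v mpow T j w))"
    by (rule om_mpow[OF Tc T_selfadj w Xv])
  also have "\<dots> = om n w (X *\<^sub>v mpow T (i + j) w)"
    using mpow_commute[OF Tc Xc XT v, of i j] by (simp add: mpow_mpow)
  also have "\<dots> = 0"
    using om_sym[OF w Xv, of "i + j"] cross by auto
  finally show "(F\<^sup>T * (symp_form n * (X * F))) $$ (i, j) = 0\<^sub>m k k $$ (i, j)"
    using transpose_form_mult_index[OF Fc _ ij, of "X * F"] Xc Fc c krylov_col[OF Tc w ij(1)] ij
    by (simp add: F_def del: index_mult_mat(1))
qed auto

lemma FJXiF: "F\<^sup>T * (symp_form n * (sadj n n X * F)) = 0\<^sub>m k k"
proof -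
  have "symp_form n * (sadj n n X * F) = X\<^sup>T * (symp_form n * F)"
    by (simp add: sadj_def mat_dist mat_assoc mat_neg symp_form_square')
  then have "F\<^sup>T * (symp_form n * (sadj n n X * F)) = - (F\<^sup>T * (symp_form n * (X * F)))\<^sup>T"
    by (simp add: mat_tr mat_dist mat_assoc symp_form_transpose mat_neg)
  then show ?thesis unfolding FJXF by (simp, intro eq_matI, auto)
qed

text \<open>With \<open>M = X\<^sup>2\<close> one has \<open>X D = X (M + M\<^sup>-\<^sup>1)/2 - X\<^sup>-\<^sup>1\<close>, which brings the cross terms with \<open>D\<close> back to those
  without it.\<close>

lemma XD: "dim_row A = 2 * n \<Longrightarrow> X * (D * A) = X * (sym_part n (X * X) * A) - sadj n n X * A"
proof -
  assume A: "dim_row A = 2 * n"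
  have "D = sym_part n (X * X) - sadj n n (X * X)" unfolding D_def sym_part_def alt_part_def
    by (rule eq_matI) (auto simp: field_simps simp del: index_mult_mat(1))
  then have "D * A = sym_part n (X * X) * A - sadj n n X * (sadj n n X * A)"
    using A by (simp add: mat_dist sadj_square[OF X] mat_assoc)
  then show ?thesis using A by (simp add: mat_dist Sp_cancel[OF X])
qed

lemma sym_F': "dim_row A = k \<Longrightarrow> sym_part n (X * X) * (F * A) = F * ((jordan_block k \<mu>)\<^sup>T * A)"
  using arg_cong[OF sym_F, of "\<lambda>X. X * A"] by (simp add: mat_assoc)

lemma zero_mult: "F\<^sup>T * (symp_form n * B) = 0\<^sub>m k k \<Longrightarrow> dim_row B = 2 * n \<Longrightarrow> dim_col B = k \<Longrightarrow> dim_row A = k \<Longrightarrow>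
    F\<^sup>T * (symp_form n * (B * A)) = 0\<^sub>m k (dim_col A)"
proof -
  assume a: "F\<^sup>T * (symp_form n * B) = 0\<^sub>m k k" "dim_row B = 2 * n" "dim_col B = k" "dim_row A = k"
  have "F\<^sup>T * (symp_form n * (B * A)) = (F\<^sup>T * (symp_form n * B)) * A"
    using a(2-4) by (simp add: mat_assoc)
  then show ?thesis unfolding a(1) using a(4) by (simp add: mat_unit)
qed

lemma FJXDF: "F\<^sup>T * (symp_form n * (X * (D * F))) = 0\<^sub>m k k"
  using zero_mult[OF FJXF, of "(jordan_block k \<mu>)\<^sup>T"]
  by (simp add: XD sym_F mat_dist FJXiF mat_assoc mat_minus_self)

lemma FJXDDF: "F\<^sup>T * (symp_form n * (X * (D * (D * F)))) = 0\<^sub>m k k"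
  using zero_mult[OF FJXF, of "(jordan_block k \<mu>)\<^sup>T * (jordan_block k \<mu>)\<^sup>T"]
  by (simp add: DDF sym_F sym_F' mat_dist FJXF mat_assoc mat_minus_self)

lemma DX: "dim_row A = 2 * n \<Longrightarrow> D * (X * A) = X * (D * A)"
  using arg_cong[OF part_square_commute(2)[OF X], of "\<lambda>X. X * A"] by (simp add: D_def mat_assoc)

lemma SJXS: "sadj n k S * (X * S) = 0\<^sub>m (2 * k) (2 * k)"
proof -
  let ?K = "antidiag_mat k"
  have z: "- 0\<^sub>m a b = (0\<^sub>m a b :: real mat)" "c \<cdot>\<^sub>m 0\<^sub>m a b = (0\<^sub>m a b :: real mat)" for a b c by (auto intro!: eq_matI)
  have FE: "F\<^sup>T * (symp_form n * (X * E)) = 0\<^sub>m k k"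
    using zero_mult[OF FJXDF, of ?K] by (simp add: E_def mat_dist mat_assoc z)
  have EF: "E\<^sup>T * (symp_form n * (X * F)) = 0\<^sub>m k k"
    by (simp add: E_def mat_tr mat_dist mat_assoc form_mult' DX FJXDF mat_unit z)
  have EE: "E\<^sup>T * (symp_form n * (X * E)) = 0\<^sub>m k k"
    using zero_mult[OF FJXDDF, of ?K] by (simp add: E_def mat_tr mat_dist mat_assoc form_mult' DX mat_unit z)
  have "S\<^sup>T * (symp_form n * (X * S)) =
     low_emb k * ((E\<^sup>T * (symp_form n * (X * E))) * (low_emb k)\<^sup>T) + high_emb k * ((F\<^sup>T * (symp_form n * (X * E))) * (low_emb k)\<^sup>T)
   + (low_emb k * ((E\<^sup>T * (symp_form n * (X * F))) * (high_emb k)\<^sup>T) + high_emb k * ((F\<^sup>T * (symp_form n * (X * F))) * (high_emb k)\<^sup>T))"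
    unfolding S_def by (simp add: mat_tr mat_dist mat_assoc)
  also have "\<dots> = 0\<^sub>m (2 * k) (2 * k)" unfolding FE EF EE FJXF by (simp add: mat_unit mat_add_zero)
  finally show ?thesis by (simp add: sadj_def mat_dist mat_assoc mat_unit z)
qed

lemma double_split:
  "\<exists>X'. X' \<in> Sp (n - (k + k)) \<and> k + k \<le> n \<and> symp_similar n X (swap_root k (wnf k s \<mu>) \<diamond> X')"
proof -
  let ?N = "wnf k s \<mu>" and ?L = "emb_left k k" and ?R = "emb_right k k"
  have N: "?N \<in> carrier_mat (2 * k) (2 * k)" using wnf_Sp[OF s] Sp_carrier by blast
  have XS: "semb n k (X * S)" using X semb_S semb_mult Sp_iff_semb by blast
  note p = semb_pair(1)[OF semb_S XS SJXS]
  have XXS: "X * (X * S) = S * ?N" using M_S by (simp add: mat_assoc)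
  have "X * pair_emb k k S (X * S) = X * S * ?L\<^sup>T + X * (X * S) * ?R\<^sup>T"
    unfolding pair_emb_def by (simp add: mat_dist mat_assoc)
  also have "\<dots> = X * S * ?L\<^sup>T + S * ?N * ?R\<^sup>T" unfolding XXS ..
  also have "\<dots> = pair_emb k k S (X * S) * swap_root k ?N"
    unfolding pair_emb_def swap_root_def using N
    by (simp add: mat_dist mat_assoc emb_cancel mat_unit mat_add_zero emb_orthonormal)
  finally have "X * pair_emb k k S (X * S) = pair_emb k k S (X * S) * swap_root k ?N" .
  moreover have "swap_root k ?N \<in> carrier_mat (2 * (k + k)) (2 * (k + k))"
    using swap_root_Sp[OF wnf_Sp[OF s]] Sp_carrier by blast
  ultimately show ?thesis using symp_split[OF X p] by blast
qed

end

section \<open>Finding a good cyclic vector\<close>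

text \<open>The linear combination of the vectors \<open>T\<^sup>j y\<close>, \<open>j < k\<close>, with coefficients \<open>f j\<close>.\<close>

fun lin_krylov :: "nat \<Rightarrow> real mat \<Rightarrow> (nat \<Rightarrow> real) \<Rightarrow> nat \<Rightarrow> real vec \<Rightarrow> real vec" where
  "lin_krylov d T f 0 y = 0\<^sub>v d"
| "lin_krylov d T f (Suc k) y = lin_krylov d T f k y + f k \<cdot>\<^sub>v mpow T k y"

lemma lin_krylov_carrier: "T \<in> carrier_mat d d \<Longrightarrow> y \<in> carrier_vec d \<Longrightarrow> lin_krylov d T f k y \<in> carrier_vec d"
  by (induction k) (auto simp: mpow_carrier)

lemma lin_krylov_shift:
  assumes "T \<in> carrier_mat d d" "y \<in> carrier_vec d"
  shows "lin_krylov d T f (Suc k) y = f 0 \<cdot>\<^sub>v y + T *\<^sub>v lin_krylov d T (\<lambda>j. f (Suc j)) k y"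
proof (induction k)
  case 0 then show ?case using assms by (simp add: mat_vec_zero)
next
  case (Suc k)
  let ?g = "\<lambda>j. f (Suc j)"
  note c = lin_krylov_carrier[OF assms, of ?g k] mpow_carrier[OF assms, of k] mpow_carrier[OF assms, of "Suc k"]
  have c2: "T *\<^sub>v lin_krylov d T ?g k y \<in> carrier_vec d" using c assms by auto
  have "lin_krylov d T f (Suc (Suc k)) y = lin_krylov d T f (Suc k) y + f (Suc k) \<cdot>\<^sub>v mpow T (Suc k) y"
    by (rule lin_krylov.simps(2))
  also have "\<dots> = f 0 \<cdot>\<^sub>v y + (T *\<^sub>v lin_krylov d T ?g k y + f (Suc k) \<cdot>\<^sub>v mpow T (Suc k) y)"
    unfolding Suc by (rule assoc_add_vec) (use c2 c assms in auto)
  also have "T *\<^sub>v lin_krylov d T ?g k y + f (Suc k) \<cdot>\<^sub>v mpow T (Suc k) y = T *\<^sub>v (lin_krylov d T ?g k y + f (Suc k) \<cdot>\<^sub>v mpow T k y)"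
    using c assms by (simp add: mat_vec_add mat_vec_smult)
  finally show ?case by simp
qed

text \<open>A linear relation among the \<open>T\<^sup>j y\<close> is solved for its lowest term. Induction strips off vanishing
  low coefficients and collects the corresponding powers of \<open>T\<close> in \<open>m\<close>.\<close>

lemma lin_krylov_relation:
  assumes "T \<in> carrier_mat d d" "y \<in> carrier_vec d"
  shows "mpow T m (lin_krylov d T f k y) = 0\<^sub>v d \<Longrightarrow> \<exists>j<k. f j \<noteq> 0 \<Longrightarrow>
    \<exists>j<m + k. \<exists>z\<in>carrier_vec d. mpow T j y = mpow T (Suc j) z"
proof (induction k arbitrary: m f)
  case (Suc k)
  let ?g = "\<lambda>j. f (Suc j)"
  let ?h = "lin_krylov d T ?g k y"
  have h: "?h \<in> carrier_vec d" by (rule lin_krylov_carrier[OF assms])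
  have r: "mpow T m (T *\<^sub>v x) = mpow T (Suc m) x" for x by (simp add: funpow_swap1)
  have "mpow T m (f 0 \<cdot>\<^sub>v y + T *\<^sub>v ?h) = 0\<^sub>v d" using Suc.prems(1) unfolding lin_krylov_shift[OF assms] .
  then have e: "f 0 \<cdot>\<^sub>v mpow T m y + mpow T (Suc m) ?h = 0\<^sub>v d"
    using h assms by (simp add: mpow_add[OF assms(1)] mpow_smult[OF assms(1)] r del: funpow.simps)
  show ?case
  proof (cases "f 0 = 0")
    case True
    have "0 \<cdot>\<^sub>v mpow T m y + mpow T (Suc m) ?h = mpow T (Suc m) ?h"
      using mpow_carrier[OF assms, of m] mpow_carrier[OF assms(1) h, of "Suc m"]
      by (intro eq_vecI) (auto simp del: funpow.simps)
    then have "mpow T (Suc m) ?h = 0\<^sub>v d" using e True by (simp del: funpow.simps)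
    moreover have "\<exists>j<k. ?g j \<noteq> 0" using Suc.prems(2) True by (metis less_Suc_eq_0_disj)
    ultimately show ?thesis using Suc.IH[of "Suc m" ?g] by auto
  next
    case False
    let ?z = "(- 1 / f 0) \<cdot>\<^sub>v ?h"
    have "mpow T (Suc m) ?z = (- 1 / f 0) \<cdot>\<^sub>v mpow T (Suc m) ?h" by (rule mpow_smult[OF assms(1) h])
    moreover have "mpow T m y = (- 1 / f 0) \<cdot>\<^sub>v mpow T (Suc m) ?h"
    proof (rule eq_vecI)
      note c = mpow_carrier[OF assms, of m] mpow_carrier[OF assms(1) h, of "Suc m"]
      fix i assume "i < dim_vec ((- 1 / f 0) \<cdot>\<^sub>v mpow T (Suc m) ?h)"
      then have i: "i < d" using c by (simp del: funpow.simps)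
      have "(f 0 \<cdot>\<^sub>v mpow T m y + mpow T (Suc m) ?h) $ i = 0" using e i by simp
      then have "f 0 * mpow T m y $ i + mpow T (Suc m) ?h $ i = 0" using c i by (simp del: funpow.simps)
      then show "mpow T m y $ i = ((- 1 / f 0) \<cdot>\<^sub>v mpow T (Suc m) ?h) $ i"
        using c i False by (simp del: funpow.simps add: field_simps)
    qed (use mpow_carrier[OF assms, of m] mpow_carrier[OF assms(1) h, of "Suc m"] in \<open>simp del: funpow.simps\<close>)
    ultimately show ?thesis using h by (intro exI[of _ m]) (auto simp del: funpow.simps intro!: bexI[of _ ?z])
  qed
qed simp

lemma lin_krylov_index:
  assumes "T \<in> carrier_mat d d" "y \<in> carrier_vec d" "i < d"
  shows "lin_krylov d T f k y $ i = (\<Sum>j = 0..<k. f j * mpow T j y $ i)"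
proof (induction k)
  case (Suc k)
  then show ?case using lin_krylov_carrier[OF assms(1,2), of f k] mpow_carrier[OF assms(1,2), of k] assms(3) by simp
qed (use assms in auto)

lemma fitting_step:
  assumes T: "T \<in> carrier_mat d d" and y: "y \<in> carrier_vec d"
  shows "\<exists>z\<in>carrier_vec d. mpow T d y = mpow T (Suc d) z"
proof -
  define B where "B = mat d (Suc d) (\<lambda>(i, j). mpow T j y $ i)"
  have "B \<in> carrier_mat d (Suc d)" by (simp add: B_def)
  from wide_mat_kernel[OF this] obtain v where v: "v \<in> carrier_vec (Suc d)" "v \<noteq> 0\<^sub>v (Suc d)" "B *\<^sub>v v = 0\<^sub>v d" by auto
  have "lin_krylov d T (\<lambda>j. v $ j) (Suc d) y = B *\<^sub>v v"
  proof (rule eq_vecI)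
    fix i assume "i < dim_vec (B *\<^sub>v v)"
    then have i: "i < d" by (simp add: B_def)
    then show "lin_krylov d T (\<lambda>j. v $ j) (Suc d) y $ i = (B *\<^sub>v v) $ i"
      using v(1) unfolding lin_krylov_index[OF T y i]
      by (simp add: B_def scalar_prod_def mult.commute del: sum.op_ivl_Suc funpow.simps)
  qed (use lin_krylov_carrier[OF T y, of _ "Suc d"] in \<open>auto simp: B_def simp del: lin_krylov.simps\<close>)
  then have "mpow T 0 (lin_krylov d T (\<lambda>j. v $ j) (Suc d) y) = 0\<^sub>v d" unfolding v(3) funpow_0 .
  moreover have "\<exists>j<Suc d. v $ j \<noteq> 0" using v(1,2) by (metis carrier_vecD eq_vecI index_zero_vec(1,2))
  ultimately have "\<exists>j<0 + Suc d. \<exists>z\<in>carrier_vec d. mpow T j y = mpow T (Suc j) z"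
    by (rule lin_krylov_relation[OF T y])
  then obtain j z where j: "j < Suc d" "z \<in> carrier_vec d" "mpow T j y = mpow T (Suc j) z"
    unfolding add_0 by blast
  have "mpow T d y = mpow T (d - j) (mpow T j y)" using j(1) by (simp add: mpow_mpow)
  also have "\<dots> = mpow T (Suc d) z" unfolding j(3) mpow_mpow using j(1) by (simp add: Suc_diff_le del: funpow.simps)
  finally show ?thesis using j(2) by blast
qed

text \<open>The image of \<open>T\<^sup>d\<close> does not shrink any further, so the space is the sum of this image and of the
  kernel of \<open>T\<^sup>d\<close>.\<close>

lemma fitting:
  assumes T: "T \<in> carrier_mat d d" and y: "y \<in> carrier_vec d"
  shows "\<exists>z\<in>carrier_vec d. mpow T d y = mpow T (d + m) z"
proof (induction m)
  case (Suc m)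
  then obtain z where z: "z \<in> carrier_vec d" "mpow T d y = mpow T (d + m) z" by blast
  obtain z' where z': "z' \<in> carrier_vec d" "mpow T d z = mpow T (Suc d) z'" using fitting_step[OF T z(1)] by blast
  have "mpow T (d + m) z = mpow T m (mpow T d z)" by (simp add: mpow_mpow add.commute)
  also have "\<dots> = mpow T (d + Suc m) z'" unfolding z'(2) mpow_mpow by (simp add: add.commute del: funpow.simps)
  finally have "mpow T d y = mpow T (d + Suc m) z'" by (rule trans[OF z(2)])
  then show ?case using z'(1) by (rule bexI)
qed (use y in auto)

lemma om_antiadj:
  assumes G: "G \<in> carrier_mat (2 * n) (2 * n)" "sadj n n G = - G"
    and u: "u \<in> carrier_vec (2 * n)" "v \<in> carrier_vec (2 * n)"
  shows "om n (G *\<^sub>v u) v = - om n u (G *\<^sub>v v)"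
proof -
  have v: "G *\<^sub>v v \<in> carrier_vec (2 * n)" using G u by auto
  have "om n (G *\<^sub>v u) v = om n u (- (G *\<^sub>v v))"
    using om_adj[OF G(1) u] G u by (simp add: mat_uminus_vec)
  also have "- (G *\<^sub>v v) = (- 1) \<cdot>\<^sub>v (G *\<^sub>v v)" by (rule eq_vecI) auto
  also have "om n u \<dots> = - om n u (G *\<^sub>v v)" using om_smult_right[OF v u(1), of "- 1"] by simp
  finally show ?thesis .
qed

lemma commute_vec:
  assumes "A \<in> carrier_mat m m" "B \<in> carrier_mat m m" "A * B = B * A" "v \<in> carrier_vec m"
  shows "A *\<^sub>v (B *\<^sub>v v) = B *\<^sub>v (A *\<^sub>v (v :: real vec))"
  using assms by (simp flip: assoc_mult_mat_vec)

text \<open>\<open>\<omega>(G u, v)\<close> is a symmetric bilinear form because \<open>G\<close> is anti-self-adjoint, and \<open>T\<close> is self-adjoint for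
  this form as well because it commutes with \<open>G\<close>.\<close>

locale form_ops =
  fixes n :: nat and G T :: "real mat"
  assumes Gc: "G \<in> carrier_mat (2 * n) (2 * n)" and Ga: "sadj n n G = - G"
    and Tc: "T \<in> carrier_mat (2 * n) (2 * n)" and Ts: "sadj n n T = T"
    and GT: "T * G = G * T"
begin

lemma form_sym: assumes "u \<in> carrier_vec (2 * n)" "v \<in> carrier_vec (2 * n)"
  shows "om n (G *\<^sub>v u) v = om n (G *\<^sub>v v) u"
  using om_antiadj[OF Gc Ga assms] om_sym[of u n "G *\<^sub>v v"] assms Gc by auto

lemma form_mpow: assumes "u \<in> carrier_vec (2 * n)" "v \<in> carrier_vec (2 * n)"
  shows "om n (G *\<^sub>v u) (mpow T j v) = om n (G *\<^sub>v mpow T j u) v"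
proof -
  have "om n (G *\<^sub>v u) (mpow T j v) = om n (mpow T j (G *\<^sub>v u)) v"
    by (rule om_mpow[OF Tc Ts, symmetric]) (use assms Gc in auto)
  then show ?thesis using mpow_commute[OF Tc Gc GT assms(1), of j] by simp
qed

lemma form_self: assumes Z: "Z \<in> carrier_mat (2 * n) (2 * n)" "sadj n n Z = Z" "Z * G = G * Z"
  and v: "u \<in> carrier_vec (2 * n)" "v \<in> carrier_vec (2 * n)"
  shows "om n (G *\<^sub>v u) (Z *\<^sub>v v) = om n (G *\<^sub>v (Z *\<^sub>v u)) v"
proof -
  have "om n (G *\<^sub>v u) (Z *\<^sub>v v) = om n (Z *\<^sub>v (G *\<^sub>v u)) v"
    by (rule om_selfadj[OF Z(1,2), symmetric]) (use v Gc in auto)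
  then show ?thesis using commute_vec[OF Z(1) Gc Z(3) v(1)] by simp
qed

lemma form_zero: "mpow T k v = 0\<^sub>v (2 * n) \<Longrightarrow> k \<le> j \<Longrightarrow> om n (G *\<^sub>v mpow T j v) u = 0"
  using mpow_beyond[OF Tc, of k v j] Gc by (simp add: mat_vec_zero om_zero)

text \<open>Let \<open>k + 1\<close> be the least exponent for which the power of \<open>T\<close> kills the generalised kernel \<open>K\<close> of \<open>T\<close>. By
  the Fitting decomposition \<open>\<omega>\<close> is nondegenerate on \<open>K\<close>, so the symmetric form \<open>\<omega>(G T\<^sup>k u, v)\<close> does not
  vanish on \<open>K\<close>; by polarization it takes a nonzero value on the diagonal.\<close>

lemma exists_good_vector:
  assumes det: "det T = 0" and inj: "\<And>u. u \<in> carrier_vec (2 * n) \<Longrightarrow> T *\<^sub>v u = 0\<^sub>v (2 * n) \<Longrightarrow> G *\<^sub>v u = 0\<^sub>v (2 * n) \<Longrightarrow> u = 0\<^sub>v (2 * n)"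
  shows "\<exists>k w. w \<in> carrier_vec (2 * n) \<and> mpow T (Suc k) w = 0\<^sub>v (2 * n) \<and> om n (G *\<^sub>v mpow T k w) w \<noteq> 0"
proof -
  let ?N = "2 * n"
  define K where "K = {x \<in> carrier_vec ?N. mpow T ?N x = 0\<^sub>v ?N}"
  obtain u0 where u0: "u0 \<in> carrier_vec ?N" "u0 \<noteq> 0\<^sub>v ?N" "T *\<^sub>v u0 = 0\<^sub>v ?N"
    using det_0_iff_vec_prod_zero[OF Tc] det by blast
  have "?N \<noteq> 0"
  proof
    assume "?N = 0"
    then have "u0 = 0\<^sub>v ?N" using u0(1) by (intro eq_vecI) auto
    then show False using u0 by simp
  qed
  then have N1: "1 \<le> ?N" by simp
  have kill: "mpow T ?N u = 0\<^sub>v ?N" if "T *\<^sub>v u = 0\<^sub>v ?N" for u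
    using mpow_beyond[OF Tc, of 1 u ?N] that N1 by simp
  have u0K: "u0 \<in> K" using u0 kill unfolding K_def by simp
  define k0 where "k0 = (LEAST k. \<forall>x\<in>K. mpow T k x = 0\<^sub>v ?N)"
  have "\<forall>x\<in>K. mpow T ?N x = 0\<^sub>v ?N" by (auto simp: K_def)
  then have k0: "\<forall>x\<in>K. mpow T k0 x = 0\<^sub>v ?N" unfolding k0_def by (rule LeastI)
  then have "k0 \<noteq> 0" using u0K u0(2) by (metis funpow_0)
  then obtain k where k: "k0 = Suc k" using not0_implies_Suc by blast
  then have "\<not> (\<forall>x\<in>K. mpow T k x = 0\<^sub>v ?N)" using not_less_Least[of k "\<lambda>k. \<forall>x\<in>K. mpow T k x = 0\<^sub>v ?N"] k0_def by simp
  then obtain x where x: "x \<in> K" "mpow T k x \<noteq> 0\<^sub>v ?N" by blast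
  have xc: "x \<in> carrier_vec ?N" using x by (simp add: K_def)
  have Suck: "mpow T (Suc k) x = 0\<^sub>v ?N" if "x \<in> K" for x using k0 that k by auto
  define u where "u = mpow T k x"
  have u: "u \<in> carrier_vec ?N" "u \<noteq> 0\<^sub>v ?N" "T *\<^sub>v u = 0\<^sub>v ?N"
    using mpow_carrier[OF Tc xc] x(2) Suck[OF x(1)] by (auto simp: u_def)
  have Gu: "G *\<^sub>v u \<in> carrier_vec ?N" using u Gc by auto
  have "G *\<^sub>v u \<noteq> 0\<^sub>v ?N" using inj[OF u(1,3)] u(2) by blast
  then obtain y where y: "y \<in> carrier_vec ?N" "om n (G *\<^sub>v u) y \<noteq> 0" using om_nondegenerate[OF Gu] by blast
  obtain z where z: "z \<in> carrier_vec ?N" "mpow T ?N y = mpow T (?N + ?N) z" using fitting[OF Tc y(1)] by blast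
  define y1 where "y1 = y + (- 1) \<cdot>\<^sub>v mpow T ?N z"
  have Tz: "mpow T ?N z \<in> carrier_vec ?N" by (rule mpow_carrier[OF Tc z(1)])
  have y1: "y1 \<in> carrier_vec ?N" unfolding y1_def using y Tz by auto
  have "mpow T ?N y1 = mpow T ?N y + (- 1) \<cdot>\<^sub>v mpow T (?N + ?N) z"
    unfolding y1_def using y Tz by (simp add: mpow_add[OF Tc] mpow_smult[OF Tc] mpow_mpow)
  then have "mpow T ?N y1 = 0\<^sub>v ?N" unfolding z(2) using mpow_carrier[OF Tc z(1), of "?N + ?N"] by (intro eq_vecI) auto
  then have y1K: "y1 \<in> K" using y1 by (simp add: K_def)
  have "om n (G *\<^sub>v u) (mpow T ?N z) = om n (G *\<^sub>v mpow T ?N u) z" by (rule form_mpow[OF u(1) z(1)])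
  also have "\<dots> = 0" unfolding kill[OF u(3)] using Gc by (simp add: mat_vec_zero om_zero)
  finally have "om n (G *\<^sub>v u) y1 = om n (G *\<^sub>v u) y"
    unfolding y1_def using y Tz Gu by (simp add: om_add_right om_smult_right)
  then have xy: "om n (G *\<^sub>v mpow T k x) y1 \<noteq> 0" using y(2) by (simp add: u_def)
  let ?q = "\<lambda>a b. om n (G *\<^sub>v mpow T k a) b"
  have yx: "?q y1 x = ?q x y1"
    using form_sym[OF mpow_carrier[OF Tc y1] xc] form_mpow[OF xc y1] by simp
  have qc: "G *\<^sub>v mpow T k a \<in> carrier_vec ?N" if "a \<in> carrier_vec ?N" for a
    using Gc mpow_carrier[OF Tc that, of k] by auto
  have "?q (x + y1) (x + y1) = ?q x x + ?q x y1 + (?q y1 x + ?q y1 y1)"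
    using xc y1 qc[OF xc] qc[OF y1] Gc mpow_carrier[OF Tc xc, of k] mpow_carrier[OF Tc y1, of k]
    by (simp add: mpow_add[OF Tc] mat_vec_add om_add_left om_add_right)
  then have "?q x x \<noteq> 0 \<or> ?q y1 y1 \<noteq> 0 \<or> ?q (x + y1) (x + y1) \<noteq> 0" using xy yx by auto
  moreover have "mpow T (Suc k) (x + y1) = mpow T (Suc k) x + mpow T (Suc k) y1" by (rule mpow_add[OF Tc xc y1])
  then have "mpow T (Suc k) (x + y1) = 0\<^sub>v ?N" unfolding Suck[OF x(1)] Suck[OF y1K] by simp
  moreover have "x + y1 \<in> carrier_vec ?N" using xc y1 by simp
  ultimately show ?thesis using xc y1 Suck[OF x(1)] Suck[OF y1K] by blast
qed

text \<open>The operator \<open>1 + c T\<^sup>i Z\<close> is self-adjoint for the form and commutes with everything in sight, so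
  its square can be moved to one side and expanded.\<close>

lemma form_expand:
  assumes W: "W \<in> carrier_mat (2 * n) (2 * n)" "sadj n n W = W" "W * G = G * W" "T * W = W * T"
    and Z: "Z \<in> carrier_mat (2 * n) (2 * n)" "sadj n n Z = Z" "Z * G = G * Z" "T * Z = Z * T"
    and WZ: "W * Z = Z * W" and v: "v \<in> carrier_vec (2 * n)"
    and v': "v' = v + c \<cdot>\<^sub>v mpow T i (Z *\<^sub>v v)"
  shows "om n (G *\<^sub>v mpow T m (W *\<^sub>v v')) v' = om n (G *\<^sub>v mpow T m (W *\<^sub>v v)) v
    + 2 * c * om n (G *\<^sub>v mpow T (m + i) (W *\<^sub>v (Z *\<^sub>v v))) v
    + c * c * om n (G *\<^sub>v mpow T (m + i + i) (W *\<^sub>v (Z *\<^sub>v (Z *\<^sub>v v)))) v"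
proof -
  let ?N = "2 * n"
  define u where "u = mpow T i (Z *\<^sub>v v)"
  have Zv: "Z *\<^sub>v v \<in> carrier_vec ?N" "Z *\<^sub>v (Z *\<^sub>v v) \<in> carrier_vec ?N" using Z v by auto
  have u: "u \<in> carrier_vec ?N" unfolding u_def by (rule mpow_carrier[OF Tc Zv(1)])
  have Wc: "W *\<^sub>v a \<in> carrier_vec ?N" if "a \<in> carrier_vec ?N" for a using W that by auto
  let ?q = "\<lambda>a b. om n (G *\<^sub>v mpow T m (W *\<^sub>v a)) b"
  have mc: "mpow T m (W *\<^sub>v a) \<in> carrier_vec ?N" if "a \<in> carrier_vec ?N" for a
    by (rule mpow_carrier[OF Tc Wc[OF that]])
  have qc: "G *\<^sub>v mpow T m (W *\<^sub>v a) \<in> carrier_vec ?N" if "a \<in> carrier_vec ?N" for a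
    using Gc mc[OF that] by auto
  have lin: "G *\<^sub>v mpow T m (W *\<^sub>v (v + c \<cdot>\<^sub>v u)) = G *\<^sub>v mpow T m (W *\<^sub>v v) + c \<cdot>\<^sub>v (G *\<^sub>v mpow T m (W *\<^sub>v u))"
    using v u W Gc Wc[OF v] Wc[OF u] mc[OF v] mc[OF u]
    by (simp add: mat_vec_add mat_vec_smult mpow_add[OF Tc] mpow_smult[OF Tc])
  have "?q (v + c \<cdot>\<^sub>v u) (v + c \<cdot>\<^sub>v u) = ?q v v + c * ?q v u + (c * ?q u v + c * (c * ?q u u))"
    unfolding lin using v u qc[OF v] qc[OF u]
    by (simp add: om_add_left om_add_right om_smult_left om_smult_right algebra_simps)
  moreover have "?q v u = om n (G *\<^sub>v mpow T (m + i) (W *\<^sub>v (Z *\<^sub>v v))) v"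
  proof -
    have "?q v u = om n (G *\<^sub>v mpow T i (mpow T m (W *\<^sub>v v))) (Z *\<^sub>v v)"
      unfolding u_def by (rule form_mpow[OF mc[OF v] Zv(1)])
    also have "\<dots> = om n (G *\<^sub>v (Z *\<^sub>v mpow T (i + m) (W *\<^sub>v v))) v"
      unfolding mpow_mpow by (rule form_self[OF Z(1-3) mpow_carrier[OF Tc Wc[OF v]] v])
    also have "Z *\<^sub>v mpow T (i + m) (W *\<^sub>v v) = mpow T (i + m) (W *\<^sub>v (Z *\<^sub>v v))"
      using mpow_commute[OF Tc Z(1,4) Wc[OF v], of "i + m"] commute_vec[OF Z(1) W(1) WZ[symmetric] v] by simp
    finally show ?thesis by (simp add: add.commute)
  qed
  moreover have qu: "W *\<^sub>v u = mpow T i (W *\<^sub>v (Z *\<^sub>v v))"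
    unfolding u_def by (rule mpow_commute[OF Tc W(1,4) Zv(1), symmetric])
  then have "?q u v = om n (G *\<^sub>v mpow T (m + i) (W *\<^sub>v (Z *\<^sub>v v))) v" by (simp add: mpow_mpow)
  moreover have "?q u u = om n (G *\<^sub>v mpow T (m + i + i) (W *\<^sub>v (Z *\<^sub>v (Z *\<^sub>v v)))) v"
  proof -
    have "?q u u = om n (G *\<^sub>v mpow T i (mpow T m (W *\<^sub>v u))) (Z *\<^sub>v v)"
      by (subst (2) u_def, rule form_mpow[OF mc[OF u] Zv(1)])
    also have "\<dots> = om n (G *\<^sub>v mpow T (i + m + i) (W *\<^sub>v (Z *\<^sub>v v))) (Z *\<^sub>v v)"
      unfolding qu mpow_mpow by (simp add: add.assoc)
    also have "\<dots> = om n (G *\<^sub>v (Z *\<^sub>v mpow T (i + m + i) (W *\<^sub>v (Z *\<^sub>v v)))) v"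
      by (rule form_self[OF Z(1-3) mpow_carrier[OF Tc Wc[OF Zv(1)]] v])
    also have "Z *\<^sub>v mpow T (i + m + i) (W *\<^sub>v (Z *\<^sub>v v)) = mpow T (i + m + i) (W *\<^sub>v (Z *\<^sub>v (Z *\<^sub>v v)))"
      using mpow_commute[OF Tc Z(1,4) Wc[OF Zv(1)], of "i + m + i"] commute_vec[OF Z(1) W(1) WZ[symmetric] Zv(1)] by simp
    finally show ?thesis by (simp add: add.commute)
  qed
  ultimately show ?thesis unfolding v' u_def[symmetric] by (simp add: algebra_simps)
qed

lemma form_one: "1\<^sub>m (2 * n) \<in> carrier_mat (2 * n) (2 * n)" "sadj n n (1\<^sub>m (2 * n)) = 1\<^sub>m (2 * n)"
  "1\<^sub>m (2 * n) * G = G * 1\<^sub>m (2 * n)" "T * 1\<^sub>m (2 * n) = 1\<^sub>m (2 * n) * T"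
  using Gc Tc by (auto simp: sadj_one mat_unit)

text \<open>Passing from \<open>v\<close> to \<open>v + c T\<^sup>i\<^sup>+\<^sup>1 Z v\<close> adds \<open>2 c \<omega>(G T\<^sup>k Z v, v)\<close> to the moment with index \<open>k - (i + 1)\<close>, and
  leaves those with larger index unchanged since \<open>T\<^sup>k\<^sup>+\<^sup>1 v = 0\<close>. So the moments below index \<open>k\<close> can be
  removed from the top down. For \<open>Z = 1\<close> the new vector is a polynomial in \<open>T\<close> applied to \<open>v\<close>, which
  preserves the vanishing of all moments of any other form; the last conjunct records this.\<close>

lemma clear_lower:
  assumes Z: "Z \<in> carrier_mat (2 * n) (2 * n)" "sadj n n Z = Z" "Z * G = G * Z" "T * Z = Z * T"
    and v: "v \<in> carrier_vec (2 * n)" "mpow T (Suc k) v = 0\<^sub>v (2 * n)"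
    and eta: "om n (G *\<^sub>v mpow T k (Z *\<^sub>v v)) v \<noteq> 0"
  shows "i \<le> k \<Longrightarrow> \<exists>v'. v' \<in> carrier_vec (2 * n) \<and> mpow T (Suc k) v' = 0\<^sub>v (2 * n)
    \<and> om n (G *\<^sub>v mpow T k (Z *\<^sub>v v')) v' = om n (G *\<^sub>v mpow T k (Z *\<^sub>v v)) v
    \<and> om n (G *\<^sub>v mpow T k v') v' = om n (G *\<^sub>v mpow T k v) v
    \<and> (\<forall>m. k - i \<le> m \<and> m < k \<longrightarrow> om n (G *\<^sub>v mpow T m v') v' = 0)
    \<and> (Z = 1\<^sub>m (2 * n) \<longrightarrow> (\<forall>G'. form_ops n G' T \<and> (\<forall>m. om n (G' *\<^sub>v mpow T m v) v = 0) \<longrightarrow> (\<forall>m. om n (G' *\<^sub>v mpow T m v') v' = 0)))"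
proof (induction i)
  case 0
  then show ?case using v by (intro exI[of _ v]) auto
next
  case (Suc i)
  let ?N = "2 * n"
  obtain v1 where v1: "v1 \<in> carrier_vec ?N" "mpow T (Suc k) v1 = 0\<^sub>v ?N"
    "om n (G *\<^sub>v mpow T k (Z *\<^sub>v v1)) v1 = om n (G *\<^sub>v mpow T k (Z *\<^sub>v v)) v"
    "om n (G *\<^sub>v mpow T k v1) v1 = om n (G *\<^sub>v mpow T k v) v"
    "\<forall>m. k - i \<le> m \<and> m < k \<longrightarrow> om n (G *\<^sub>v mpow T m v1) v1 = 0"
    "Z = 1\<^sub>m ?N \<longrightarrow> (\<forall>G'. form_ops n G' T \<and> (\<forall>m. om n (G' *\<^sub>v mpow T m v) v = 0) \<longrightarrow> (\<forall>m. om n (G' *\<^sub>v mpow T m v1) v1 = 0))"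
    using Suc.IH Suc.prems by (meson Suc_leD)
  define m0 where "m0 = k - Suc i"
  have m0: "m0 + Suc i = k" using Suc.prems by (simp add: m0_def)
  define c where "c = - om n (G *\<^sub>v mpow T m0 v1) v1 / (2 * om n (G *\<^sub>v mpow T k (Z *\<^sub>v v1)) v1)"
  define v2 where "v2 = v1 + c \<cdot>\<^sub>v mpow T (Suc i) (Z *\<^sub>v v1)"
  have Zv: "Z *\<^sub>v a \<in> carrier_vec ?N" if "a \<in> carrier_vec ?N" for a using Z that by auto
  have kill: "mpow T j (A *\<^sub>v a) = 0\<^sub>v ?N" if "mpow T (Suc k) a = 0\<^sub>v ?N" "Suc k \<le> j" "A \<in> carrier_mat ?N ?N" "T * A = A * T" "a \<in> carrier_vec ?N" for j A a
    using mpow_commute[OF Tc that(3,4,5), of j] mpow_beyond[OF Tc that(1,2)] that(3) by (simp add: mat_vec_zero del: funpow.simps)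
  have Zv1: "mpow T (Suc k) (Z *\<^sub>v v1) = 0\<^sub>v ?N" "mpow T (Suc k) (Z *\<^sub>v (Z *\<^sub>v v1)) = 0\<^sub>v ?N"
    using kill[OF v1(2) _ Z(1,4) v1(1)] kill[OF _ _ Z(1,4) Zv[OF v1(1)]] by (auto simp del: funpow.simps)
  have WZv1: "mpow T j (W *\<^sub>v (Z *\<^sub>v v1)) = 0\<^sub>v ?N" "mpow T j (W *\<^sub>v (Z *\<^sub>v (Z *\<^sub>v v1))) = 0\<^sub>v ?N"
    if "Suc k \<le> j" "W \<in> carrier_mat ?N ?N" "T * W = W * T" for j W
    using kill[OF Zv1(1) that Zv[OF v1(1)]] kill[OF Zv1(2) that Zv[OF Zv[OF v1(1)]]] by auto
  have G0: "om n (G *\<^sub>v 0\<^sub>v ?N) a = 0" for a using Gc by (simp add: mat_vec_zero om_zero)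
  have v2: "v2 \<in> carrier_vec ?N" unfolding v2_def using v1(1) mpow_carrier[OF Tc Zv[OF v1(1)], of "Suc i"] by simp
  have "mpow T (Suc k) v2 = mpow T (Suc k) v1 + c \<cdot>\<^sub>v mpow T (Suc k + Suc i) (Z *\<^sub>v v1)"
    unfolding v2_def using v1(1) mpow_carrier[OF Tc Zv[OF v1(1)], of "Suc i"]
    by (simp add: mpow_add[OF Tc] mpow_smult[OF Tc] mpow_mpow del: funpow.simps)
  then have v2k: "mpow T (Suc k) v2 = 0\<^sub>v ?N" unfolding v1(2) using kill[OF v1(2) _ Z(1,4) v1(1), of "Suc k + Suc i"] by (simp add: smult_zero_v del: funpow.simps)
  have exp1: "om n (G *\<^sub>v mpow T m v2) v2 = om n (G *\<^sub>v mpow T m v1) v1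
    + 2 * c * om n (G *\<^sub>v mpow T (m + Suc i) (Z *\<^sub>v v1)) v1" if "Suc k \<le> m + Suc i + Suc i" for m
    using form_expand[OF form_one Z, of v1 v2 c "Suc i" m, OF _ v1(1) v2_def] v1(1) v2 Z(1) Zv[OF v1(1)] Zv[OF Zv[OF v1(1)]]
      WZv1(2)[OF that form_one(1,4)]
    by (simp add: mat_unit mat_one_vec G0 del: funpow.simps)
  have q: "om n (G *\<^sub>v mpow T m v2) v2 = om n (G *\<^sub>v mpow T m v1) v1" if "k - i \<le> m" for m
  proof -
    have "Suc k \<le> m + Suc i" using that by auto
    then show ?thesis using exp1[of m] kill[OF v1(2) _ Z(1,4) v1(1), of "m + Suc i"] by (simp add: G0 del: funpow.simps)
  qed
  have r: "om n (G *\<^sub>v mpow T k (Z *\<^sub>v v2)) v2 = om n (G *\<^sub>v mpow T k (Z *\<^sub>v v1)) v1"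
    using form_expand[OF Z Z refl v1(1) v2_def, of k] WZv1[OF _ Z(1,4)] by (simp add: G0 del: funpow.simps)
  have new: "om n (G *\<^sub>v mpow T m0 v2) v2 = 0"
  proof -
    have "Suc k \<le> m0 + Suc i + Suc i" using m0 by simp
    from exp1[OF this, unfolded m0] eta[folded v1(3)] show ?thesis by (simp add: c_def)
  qed
  have "om n (G *\<^sub>v mpow T m v2) v2 = 0" if "k - Suc i \<le> m" "m < k" for m
    using that new q[of m] v1(5) by (cases "m = m0") (auto simp: m0_def)
  moreover have "om n (G' *\<^sub>v mpow T m v2) v2 = 0"
    if "Z = 1\<^sub>m ?N" "form_ops n G' T" "\<forall>m. om n (G' *\<^sub>v mpow T m v) v = 0" for G' m
  proof -
    interpret g: form_ops n G' T by fact
    have 0: "om n (G' *\<^sub>v mpow T m v1) v1 = 0" for m using v1(6) that by blast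
    have "v2 = v1 + c \<cdot>\<^sub>v mpow T (Suc i) (1\<^sub>m ?N *\<^sub>v v1)" using v2_def that(1) by simp
    from g.form_expand[OF g.form_one g.form_one refl v1(1) this, of m]
    show ?thesis using v1(1) v2 0 by (simp add: mat_one_vec del: funpow.simps)
  qed
  ultimately show ?case using v2 v2k r v1(3,4) q[of k] by (intro exI[of _ v2]) (simp del: funpow.simps)
qed

text \<open>Clear the lower moments with \<open>Z = 1\<close> and rescale; only the sign of the top moment survives.\<close>

lemma normalize:
  assumes v: "v \<in> carrier_vec (2 * n)" "mpow T (Suc k) v = 0\<^sub>v (2 * n)" "om n (G *\<^sub>v mpow T k v) v \<noteq> 0"
  shows "\<exists>w s. s = - sgn (om n (G *\<^sub>v mpow T k v) v) \<and> w \<in> carrier_vec (2 * n) \<and> mpow T (Suc k) w = 0\<^sub>v (2 * n) \<and> s * s = 1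
    \<and> (\<forall>j. om n (G *\<^sub>v mpow T j w) w = (if Suc j = Suc k then - s else 0))
    \<and> (\<forall>G'. form_ops n G' T \<and> (\<forall>m. om n (G' *\<^sub>v mpow T m v) v = 0) \<longrightarrow> (\<forall>m. om n (G' *\<^sub>v mpow T m w) w = 0))"
proof -
  let ?N = "2 * n"
  have "om n (G *\<^sub>v mpow T k (1\<^sub>m ?N *\<^sub>v v)) v \<noteq> 0" using v by (simp add: mat_one_vec)
  from clear_lower[OF form_one v(1,2) this, of k]
  obtain v' where v': "v' \<in> carrier_vec ?N" "mpow T (Suc k) v' = 0\<^sub>v ?N"
    "om n (G *\<^sub>v mpow T k v') v' = om n (G *\<^sub>v mpow T k v) v" "om n (G *\<^sub>v mpow T k v') v' \<noteq> 0" "\<forall>m<k. om n (G *\<^sub>v mpow T m v') v' = 0"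
    "\<forall>G'. form_ops n G' T \<and> (\<forall>m. om n (G' *\<^sub>v mpow T m v) v = 0) \<longrightarrow> (\<forall>m. om n (G' *\<^sub>v mpow T m v') v' = 0)"
    using v(3) by auto
  define e where "e = om n (G *\<^sub>v mpow T k v') v'"
  define a where "a = 1 / sqrt \<bar>e\<bar>"
  have sc: "om n (A *\<^sub>v mpow T j (a \<cdot>\<^sub>v v')) (a \<cdot>\<^sub>v v') = a * a * om n (A *\<^sub>v mpow T j v') v'"
    if "A \<in> carrier_mat ?N ?N" for A j
  proof -
    have c: "A *\<^sub>v mpow T j v' \<in> carrier_vec ?N" using that mpow_carrier[OF Tc v'(1), of j] by auto
    then show ?thesis using v'(1) that mpow_carrier[OF Tc v'(1), of j]
      by (simp add: mpow_smult[OF Tc] mat_vec_smult om_smult_left om_smult_right)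
  qed
  have aa: "a * a = 1 / \<bar>e\<bar>" by (simp add: a_def)
  have "mpow T (Suc k) (a \<cdot>\<^sub>v v') = 0\<^sub>v ?N" using v'(1,2) by (simp add: mpow_smult[OF Tc] smult_zero_v del: funpow.simps)
  moreover have "(- sgn e) * (- sgn e) = 1" using v'(4) by (simp add: e_def[symmetric] sgn_if)
  moreover have "om n (G *\<^sub>v mpow T j (a \<cdot>\<^sub>v v')) (a \<cdot>\<^sub>v v') = (if Suc j = Suc k then - (- sgn e) else 0)" for j
  proof (cases j k rule: linorder_cases)
    case less then show ?thesis using v'(5) by (simp add: sc[OF Gc])
  next
    case equal then show ?thesis using v'(4) by (simp add: sc[OF Gc] aa e_def[symmetric] sgn_if)
  next
    case greater then show ?thesis using form_zero[OF v'(2), of j v'] by (simp add: sc[OF Gc])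
  qed
  moreover have "om n (G' *\<^sub>v mpow T m (a \<cdot>\<^sub>v v')) (a \<cdot>\<^sub>v v') = 0"
    if "form_ops n G' T" "\<forall>m. om n (G' *\<^sub>v mpow T m v) v = 0" for G' m
    using sc[OF form_ops.Gc[OF that(1)]] v'(6) that by simp
  ultimately show ?thesis using v'(1,3) by (intro exI[of _ "a \<cdot>\<^sub>v v'"] exI[of _ "- sgn e"]) (auto simp: e_def simp del: funpow.simps)
qed

end

section \<open>Splitting blocks off a symplectic matrix according to its square\<close>

lemma eigenvalue_det_sym_part:
  assumes M: "M \<in> Sp n" and l: "eigenvalue M l" "l \<noteq> 0"
  shows "det (sym_part n M - ((l + 1 / l) / 2) \<cdot>\<^sub>m 1\<^sub>m (2 * n)) = 0"
proof -
  note c = Sp_carrier[OF M]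
  let ?\<mu> = "(l + 1 / l) / 2"
  obtain v where v: "v \<in> carrier_vec (2 * n)" "v \<noteq> 0\<^sub>v (2 * n)" "M *\<^sub>v v = l \<cdot>\<^sub>v v"
    using l(1) c by (auto simp: eigenvalue_def eigenvector_def)
  have "l \<cdot>\<^sub>v (sadj n n M *\<^sub>v v) = sadj n n M *\<^sub>v (M *\<^sub>v v)" unfolding v(3) using v(1) by (simp add: mat_vec_smult)
  also have "\<dots> = v" using v(1) c by (simp add: mat_vec_assoc[symmetric] Sp_sadj_left[OF M] mat_one_vec)
  finally have e: "l \<cdot>\<^sub>v (sadj n n M *\<^sub>v v) = v" .
  have inv: "sadj n n M *\<^sub>v v = (1 / l) \<cdot>\<^sub>v v"
    by (subst (2) e[symmetric]) (use l(2) in \<open>auto intro!: eq_vecI\<close>)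
  have "sym_part n M *\<^sub>v v = (1 / 2) \<cdot>\<^sub>v (l \<cdot>\<^sub>v v + (1 / l) \<cdot>\<^sub>v v)"
    unfolding sym_part_def v(3)[symmetric] inv[symmetric] using c v(1)
    by (simp add: mat_smult_vec mat_add_vec)
  then have "(sym_part n M - ?\<mu> \<cdot>\<^sub>m 1\<^sub>m (2 * n)) *\<^sub>v v = 0\<^sub>v (2 * n)"
    using v(1) by (simp add: mat_minus_vec mat_smult_vec mat_one_vec) (rule eq_vecI, auto simp: field_simps)
  moreover have "sym_part n M - ?\<mu> \<cdot>\<^sub>m 1\<^sub>m (2 * n) \<in> carrier_mat (2 * n) (2 * n)" by (auto intro!: carrier_matI)
  ultimately show ?thesis using det_0_iff_vec_prod_zero v(1,2) by blast
qed

lemma mpow_double: "T \<in> carrier_mat m m \<Longrightarrow> w \<in> carrier_vec m \<Longrightarrow>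
    mpow (2 \<cdot>\<^sub>m (T * T)) j w = (2 ^ j) \<cdot>\<^sub>v mpow T (2 * j) w"
proof (induction j)
  case 0 then show ?case by simp
next
  case (Suc j)
  have c: "mpow T (2 * j) w \<in> carrier_vec m" by (rule mpow_carrier[OF Suc.prems])
  have "mpow (2 \<cdot>\<^sub>m (T * T)) (Suc j) w = (2 \<cdot>\<^sub>m (T * T)) *\<^sub>v ((2 ^ j) \<cdot>\<^sub>v mpow T (2 * j) w)"
    using Suc by simp
  also have "\<dots> = (2 ^ Suc j) \<cdot>\<^sub>v (T *\<^sub>v (T *\<^sub>v mpow T (2 * j) w))"
    using c Suc.prems by (simp add: mat_smult_vec mat_vec_smult mat_vec_assoc smult_smult_assoc mult.commute)
  finally show ?case by simp
qed

locale sqrt_data =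
  fixes n :: nat and X :: "real mat"
  assumes X: "X \<in> Sp n"
begin

abbreviation "t \<equiv> sym_part n X"
abbreviation "d \<equiv> alt_part n X"

lemma Xc: "X \<in> carrier_mat (2 * n) (2 * n)" using X Sp_carrier by blast

lemma XX: "X * X \<in> Sp n" using X Sp_mult by blast

lemma XXc: "X * X \<in> carrier_mat (2 * n) (2 * n)" using XX Sp_carrier by blast

lemma td: "t * d = d * t" by (rule sym_alt_commute[OF X])

lemma om_sym_zero: assumes "w \<in> carrier_vec (2 * n)" "T \<in> carrier_mat (2 * n) (2 * n)" "sadj n n T = T" "T * t = t * T"
  shows "om n (t *\<^sub>v mpow T j w) w = 0"
proof -
  have w: "mpow T j w \<in> carrier_vec (2 * n)" "t *\<^sub>v w \<in> carrier_vec (2 * n)" "t *\<^sub>v mpow T j w \<in> carrier_vec (2 * n)"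
    using mpow_carrier[OF assms(2,1), of j] assms(1) by (auto intro: carrier_vecI)
  have "om n (t *\<^sub>v mpow T j w) w = om n (mpow T j w) (t *\<^sub>v w)"
    by (rule om_selfadj) (use w assms(1) sadj_sym_part[OF Xc] in auto)
  also have "\<dots> = om n w (mpow T j (t *\<^sub>v w))" by (rule om_mpow[OF assms(2,3,1) w(2)])
  also have "mpow T j (t *\<^sub>v w) = t *\<^sub>v mpow T j w" by (rule mpow_commute[OF assms(2) _ assms(4,1)]) simp
  also have "om n w (t *\<^sub>v mpow T j w) = - om n (t *\<^sub>v mpow T j w) w" by (rule om_sym[OF assms(1) w(3)])
  finally show ?thesis by simp
qed

lemma om_X: assumes "w \<in> carrier_vec (2 * n)" "u \<in> carrier_vec (2 * n)"
  shows "om n (X *\<^sub>v u) w = om n (t *\<^sub>v u) w + om n (d *\<^sub>v u) w"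
proof -
  have "X *\<^sub>v u = (t + d) *\<^sub>v u" using sym_alt_sum[OF Xc] by (rule arg_cong)
  also have "\<dots> = t *\<^sub>v u + d *\<^sub>v u" using assms by (simp add: mat_add_vec)
  finally have "X *\<^sub>v u = t *\<^sub>v u + d *\<^sub>v u" .
  then show ?thesis by (simp only:) (rule om_add_left; auto intro: carrier_vecI)
qed

lemma form_ops_d:
  assumes "T \<in> carrier_mat (2 * n) (2 * n)" "sadj n n T = T" "T * d = d * T"
  shows "form_ops n d T"
  by unfold_locales (use assms sadj_alt_part[OF Xc] in auto)

lemma dd_vec: assumes "u \<in> carrier_vec (2 * n)" shows "d *\<^sub>v (d *\<^sub>v u) = t *\<^sub>v (t *\<^sub>v u) - u"
  using arg_cong[OF alt_part_square[OF X], of "\<lambda>A. A *\<^sub>v u"] assms by (simp add: mat_vec_assoc mat_minus_vec mat_one_vec)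

text \<open>On the kernel of \<open>t\<close> the square of \<open>d\<close> is \<open>-1\<close>, so \<open>\<omega>(d u, v)\<close> has no radical there.\<close>

lemma cyclic_unipotent:
  assumes "det t = 0"
  shows "\<exists>k s w. w \<in> carrier_vec (2 * n) \<and> mpow t (Suc k) w = 0\<^sub>v (2 * n) \<and> s * s = 1
    \<and> (\<forall>j. om n (d *\<^sub>v mpow t j w) w = (if Suc j = Suc k then - s else 0))"
proof -
  interpret f: form_ops n d t by (rule form_ops_d) (use sadj_sym_part[OF Xc] td in auto)
  have "u = 0\<^sub>v (2 * n)" if u: "u \<in> carrier_vec (2 * n)" "t *\<^sub>v u = 0\<^sub>v (2 * n)" "d *\<^sub>v u = 0\<^sub>v (2 * n)" for u
  proof -
    have "0\<^sub>v (2 * n) = 0\<^sub>v (2 * n) - u" using dd_vec[OF u(1), unfolded u(2,3)] by (simp add: mat_vec_zero)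
    then have "\<forall>i<2 * n. (0\<^sub>v (2 * n) :: real vec) $ i = (0\<^sub>v (2 * n) - u) $ i" by simp
    then show ?thesis using u(1) by (intro eq_vecI) auto
  qed
  from f.exists_good_vector[OF assms this] obtain k w where
    "w \<in> carrier_vec (2 * n)" "mpow t (Suc k) w = 0\<^sub>v (2 * n)" "om n (d *\<^sub>v mpow t k w) w \<noteq> 0" by blast
  from f.normalize[OF this] show ?thesis by blast
qed

lemma split_odd:
  assumes w: "w \<in> carrier_vec (2 * n)" "mpow t k w = 0\<^sub>v (2 * n)" "s * s = 1"
    "\<And>j. om n (d *\<^sub>v mpow t j w) w = (if Suc j = k then - s else 0)"
  shows "\<exists>X'. X' \<in> Sp (n - k) \<and> wnf k s 0 \<in> Sp k \<and> k \<le> n \<and> symp_similar n X (wnf k s 0 \<diamond> X')"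
proof -
  interpret c: cyclic_data n k s 0 X t d w
    by unfold_locales (use X w in \<open>auto intro!: eq_matI\<close>)
  show ?thesis by (rule symp_split[OF X c.semb_S Sp_carrier[OF wnf_Sp[OF w(3)]] c.M_S])
qed

text \<open>For \<open>M = X\<^sup>2\<close> and \<open>\<mu> = -1\<close> the parts of \<open>M\<close> are \<open>T = 2 t\<^sup>2\<close> and \<open>D = 2 d t\<close>. Hence the moments of \<open>w\<close>
  with odd index are, up to scaling, its moments for \<open>M\<close>, and those with even index are the cross
  terms. As the order \<open>2 m\<close> of the block is even, the single nonzero moment has odd index: \<open>w\<close> is
  normalised for \<open>M\<close> too, and the cross terms vanish.\<close>

lemma split_even:
  assumes w: "w \<in> carrier_vec (2 * n)" "mpow t (2 * m) w = 0\<^sub>v (2 * n)" "s * s = 1"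
    "\<And>j. om n (d *\<^sub>v mpow t j w) w = (if Suc j = 2 * m then - s else 0)"
  shows "\<exists>X'. X' \<in> Sp (n - (m + m)) \<and> m + m \<le> n \<and> symp_similar n X (swap_root m (wnf m s (- 1)) \<diamond> X')"
proof -
  define T where "T = sym_part n (X * X) - (- 1) \<cdot>\<^sub>m 1\<^sub>m (2 * n)"
  define D where "D = alt_part n (X * X)"
  \<comment> \<open>compensates the factor \<open>2 ^ m\<close> in \<open>D T\<^sup>m\<^sup>-\<^sup>1 = 2 ^ m d t\<^sup>2\<^sup>m\<^sup>-\<^sup>1\<close>\<close>
  define a where "a = 1 / sqrt (2 ^ m)"
  have aa: "a * a = 1 / 2 ^ m" by (simp add: a_def)
  have T: "T = 2 \<cdot>\<^sub>m (t * t)" unfolding T_def sym_part_square[OF X] by (rule eq_matI) auto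
  have D: "D = 2 \<cdot>\<^sub>m (d * t)" unfolding D_def by (rule alt_part_of_square[OF X])
  have tc: "t \<in> carrier_mat (2 * n) (2 * n)" by simp
  have p: "mpow T j (a \<cdot>\<^sub>v w) = (2 ^ j * a) \<cdot>\<^sub>v mpow t (2 * j) w" for j
    unfolding T using mpow_double[OF tc, of "a \<cdot>\<^sub>v w" j] w(1) mpow_carrier[OF tc w(1), of "2 * j"]
    by (simp add: mpow_smult[OF tc] smult_smult_assoc)
  note c = mpow_carrier[OF tc w(1)]
  have Dv: "D *\<^sub>v mpow T j (a \<cdot>\<^sub>v w) = (2 * 2 ^ j * a) \<cdot>\<^sub>v (d *\<^sub>v mpow t (Suc (2 * j)) w)" for j
    unfolding p D using c[of "2 * j"]
    by (simp add: mat_smult_vec mat_vec_smult mat_vec_assoc smult_smult_assoc mult_ac)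
  have fin: "Suc (Suc (2 * j)) = 2 * m \<longleftrightarrow> Suc j = m" for j by auto
  have parity: "Suc (2 * j) \<noteq> 2 * m" for j by presburger
  have kill: "mpow T m (a \<cdot>\<^sub>v w) = 0\<^sub>v (2 * n)" by (subst p, subst w(2), rule smult_zero_v)
  have aw: "a \<cdot>\<^sub>v w \<in> carrier_vec (2 * n)" using w(1) by simp
  have form: "om n (D *\<^sub>v mpow T j (a \<cdot>\<^sub>v w)) (a \<cdot>\<^sub>v w) = (if Suc j = m then - s else 0)" for j
    proof -
      have "om n (D *\<^sub>v mpow T j (a \<cdot>\<^sub>v w)) (a \<cdot>\<^sub>v w) = (2 * 2 ^ j) * (a * a) * om n (d *\<^sub>v mpow t (Suc (2 * j)) w) w"
        unfolding Dv using c[of "Suc (2 * j)"] w(1)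
        by (simp add: om_smult_left om_smult_right mv_carrier del: funpow.simps)
      also have "\<dots> = (if Suc j = m then - s else 0)" unfolding w(4) aa fin by auto
      finally show ?thesis .
    qed
  have cross: "om n (X *\<^sub>v mpow T j (a \<cdot>\<^sub>v w)) (a \<cdot>\<^sub>v w) = 0" for j
    proof -
      have "om n (X *\<^sub>v mpow T j (a \<cdot>\<^sub>v w)) (a \<cdot>\<^sub>v w) = (2 ^ j * a) * a * om n (X *\<^sub>v mpow t (2 * j) w) w"
        unfolding p using c[of "2 * j"] w(1) Xc
        by (simp add: mat_vec_smult om_smult_left om_smult_right mv_carrier del: funpow.simps)
      also have "om n (X *\<^sub>v mpow t (2 * j) w) w = 0"
        unfolding om_X[OF w(1) c] w(4) using om_sym_zero[OF w(1) tc sadj_sym_part[OF Xc] refl] parity by simp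
      finally show ?thesis by simp
    qed
  interpret dd: double_data n m s "- 1" X T D "a \<cdot>\<^sub>v w"
    by unfold_locales (rule XX w(3) aw T_def D_def kill form X cross)+
  show ?thesis by (rule dd.double_split)
qed

text \<open>Here \<open>T = 2 (t\<^sup>2 + \<rho>)\<close> with \<open>\<rho> > 0\<close> and \<open>D = 2 d t\<close>. A vector is needed for which the cross terms
  \<open>\<omega>(d T\<^sup>j w, w)\<close> vanish and \<open>y = \<omega>(d t T\<^sup>k w, w)\<close> does not. At the top level \<open>t\<close> acts as a square root of
  \<open>-\<rho>\<close>, so \<open>x = \<omega>(d T\<^sup>k w, w)\<close> and \<open>y\<close> behave like the two components of a complex number which
  \<open>v \<mapsto> v + c t v\<close> multiplies by a nonzero square; some real \<open>c\<close> makes \<open>x\<close> vanish, and then \<open>y\<close> cannot.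
  The lower cross terms are cleared with \<open>Z = t\<close>, and the final normalisation for \<open>D\<close> keeps them zero.\<close>

lemma split_hyperbolic:
  assumes l: "l < 0" "l \<noteq> - 1" and ev: "eigenvalue (X * X) l"
  shows "\<exists>m s X'. m \<ge> 1 \<and> s * s = 1 \<and> X' \<in> Sp (n - (m + m)) \<and> m + m \<le> n \<and>
    symp_similar n X (swap_root m (wnf m s ((l + 1 / l) / 2)) \<diamond> X')"
proof -
  let ?N = "2 * n"
  define \<mu> where "\<mu> = (l + 1 / l) / 2"
  define \<rho> where "\<rho> = - (1 + \<mu>) / 2"
  define T where "T = sym_part n (X * X) - \<mu> \<cdot>\<^sub>m 1\<^sub>m ?N"
  define D where "D = alt_part n (X * X)"
  have "\<rho> = (l + 1)\<^sup>2 / (- 4 * l)" using l by (simp add: \<rho>_def \<mu>_def field_simps power2_eq_square)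
  moreover have "(l + 1)\<^sup>2 > 0" using l(2) by (simp add: add_eq_0_iff2)
  moreover have "- 4 * l > 0" using l(1) by simp
  ultimately have rho: "\<rho> > 0" using divide_pos_pos[of "(l + 1)\<^sup>2" "- 4 * l"] by linarith
  have T: "T = 2 \<cdot>\<^sub>m (t * t) + (2 * \<rho>) \<cdot>\<^sub>m 1\<^sub>m ?N" unfolding T_def sym_part_square[OF X]
    by (rule eq_matI) (auto simp: \<rho>_def field_simps simp del: index_mult_mat(1))
  have D: "D = 2 \<cdot>\<^sub>m (d * t)" unfolding D_def by (rule alt_part_of_square[OF X])
  have tc: "t \<in> carrier_mat ?N ?N" by simp
  have dc: "d \<in> carrier_mat ?N ?N" by simp
  have Tc: "T \<in> carrier_mat ?N ?N" unfolding T_def by (auto intro!: carrier_matI)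
  have Dc: "D \<in> carrier_mat ?N ?N" unfolding D_def by simp
  have ts: "sadj n n t = t" by (rule sadj_sym_part[OF Xc])
  have Ts: "sadj n n T = T" unfolding T_def by (subst sadj_minus) (auto simp: sadj_sym_part[OF XXc] sadj_smult[of _ n n] sadj_one)
  have tdA: "t * (d * A) = d * (t * A)" if "dim_row A = ?N" for A
    using arg_cong[OF td, of "\<lambda>B. B * A"] that by (simp add: mat_assoc)
  have Td: "T * d = d * T" unfolding T by (simp add: mat_dist mat_assoc mat_unit td tdA)
  have Tt: "T * t = t * T" unfolding T by (simp add: mat_dist mat_assoc mat_unit)
  have TD: "T * D = D * T" unfolding T D by (simp add: mat_dist mat_assoc mat_unit td tdA mat_smult_smult mat_smult_add)
  have ttu: "t *\<^sub>v (t *\<^sub>v u) = (1 / 2) \<cdot>\<^sub>v (T *\<^sub>v u) - \<rho> \<cdot>\<^sub>v u" if "u \<in> carrier_vec ?N" for u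
  proof -
    have "T *\<^sub>v u = 2 \<cdot>\<^sub>v (t *\<^sub>v (t *\<^sub>v u)) + (2 * \<rho>) \<cdot>\<^sub>v u"
      unfolding T using that by (simp add: mat_add_vec mat_smult_vec mat_one_vec mat_vec_assoc)
    then show ?thesis using that by (intro eq_vecI) (auto simp: field_simps simp del: index_mult_mat_vec)
  qed
  interpret f: form_ops n d T by (rule form_ops_d[OF Tc Ts Td])
  have "u = 0\<^sub>v ?N" if u: "u \<in> carrier_vec ?N" "T *\<^sub>v u = 0\<^sub>v ?N" "d *\<^sub>v u = 0\<^sub>v ?N" for u
  proof (rule eq_vecI)
    have "d *\<^sub>v (d *\<^sub>v u) = 0\<^sub>v ?N" unfolding u(3) by (simp add: mat_vec_zero)
    then have "0\<^sub>v ?N = ((1 / 2) \<cdot>\<^sub>v (T *\<^sub>v u) - \<rho> \<cdot>\<^sub>v u) - u"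
      using dd_vec[OF u(1)] ttu[OF u(1)] by simp
    then have e: "0\<^sub>v ?N = ((1 / 2) \<cdot>\<^sub>v 0\<^sub>v ?N - \<rho> \<cdot>\<^sub>v u) - u" unfolding u(2) .
    fix i assume "i < dim_vec (0\<^sub>v ?N :: real vec)"
    then have "(0\<^sub>v ?N :: real vec) $ i = (((1 / 2) \<cdot>\<^sub>v 0\<^sub>v ?N - \<rho> \<cdot>\<^sub>v u) - u) $ i" "i < ?N" using e by auto
    then have "(1 + \<rho>) * u $ i = 0" using u(1) by (auto simp: algebra_simps)
    then show "u $ i = 0\<^sub>v ?N $ i" using rho \<open>i < ?N\<close> by simp
  qed (use that in auto)
  moreover have "det T = 0" unfolding T_def \<mu>_def using eigenvalue_det_sym_part[OF XX ev] l(1) by auto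
  ultimately obtain k v where v: "v \<in> carrier_vec ?N" "mpow T (Suc k) v = 0\<^sub>v ?N" "om n (d *\<^sub>v mpow T k v) v \<noteq> 0"
    using f.exists_good_vector by blast
  define x where "x = om n (d *\<^sub>v mpow T k v) v"
  define y where "y = om n (d *\<^sub>v mpow T k (t *\<^sub>v v)) v"
  have ttk: "om n (d *\<^sub>v mpow T k (t *\<^sub>v (t *\<^sub>v u))) v = - \<rho> * om n (d *\<^sub>v mpow T k u) v"
    if u: "u \<in> carrier_vec ?N" "mpow T (Suc k) u = 0\<^sub>v ?N" for u
  proof -
    have "t *\<^sub>v (t *\<^sub>v u) = (1 / 2) \<cdot>\<^sub>v (T *\<^sub>v u) + (- \<rho>) \<cdot>\<^sub>v u" unfolding ttu[OF u(1)] using Tc u(1) by (intro eq_vecI) auto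
    moreover have "mpow T k (T *\<^sub>v u) = 0\<^sub>v ?N" using u(2) by (simp add: funpow_swap1)
    ultimately have "mpow T k (t *\<^sub>v (t *\<^sub>v u)) = (- \<rho>) \<cdot>\<^sub>v mpow T k u"
      using u(1) Tc mpow_carrier[OF Tc u(1), of k] by (simp add: mpow_add[OF Tc] mpow_smult[OF Tc] smult_zero_v)
    then show ?thesis using mpow_carrier[OF Tc u(1), of k] by (simp add: mat_vec_smult om_smult_left mv_carrier)
  qed
  have tv: "t *\<^sub>v v \<in> carrier_vec ?N" using v(1) by (auto intro: carrier_vecI)
  have tvk: "mpow T (Suc k) (t *\<^sub>v v) = 0\<^sub>v ?N" using mpow_commute[OF Tc tc Tt v(1), of "Suc k"] v(2) by (simp add: mat_vec_zero)
  define q where "q = sqrt (y * y + \<rho> * (x * x))"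
  \<comment> \<open>a root of the quadratic equation \<open>x + 2 c y - \<rho> c\<^sup>2 x = 0\<close>\<close>
  define c where "c = (y + q) / (\<rho> * x)"
  have x0: "x \<noteq> 0" using v(3) by (simp add: x_def)
  have q2: "q * q = y * y + \<rho> * (x * x)" unfolding q_def using rho by simp
  have cx: "\<rho> * x * c = y + q" using rho x0 by (simp add: c_def)
  define v1 where "v1 = v + c \<cdot>\<^sub>v mpow T 0 (t *\<^sub>v v)"
  have v1: "v1 \<in> carrier_vec ?N" unfolding v1_def using v(1) tv by simp
  have v1k: "mpow T (Suc k) v1 = 0\<^sub>v ?N" unfolding v1_def funpow_0
    using v(1,2) tv tvk by (simp add: mpow_add[OF Tc] mpow_smult[OF Tc] smult_zero_v del: funpow.simps)
  have t_ok: "t * d = d * t" "T * t = t * T" by (fact td Tt)+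
  have x1: "om n (d *\<^sub>v mpow T k v1) v1 = x + 2 * c * y + c * c * (- \<rho> * x)"
    using f.form_expand[OF f.form_one tc ts t_ok _ v(1) v1_def, of k] v1 v(1) tv ttk[OF v(1,2)] mpow_carrier[OF Tc v(1)]
    by (simp add: mat_unit mat_one_vec x_def y_def mv_carrier)
  have y1: "om n (d *\<^sub>v mpow T k (t *\<^sub>v v1)) v1 = y + 2 * c * (- \<rho> * x) + c * c * (- \<rho> * y)"
    using f.form_expand[OF tc ts t_ok tc ts t_ok refl v(1) v1_def, of k] ttk[OF v(1,2)] ttk[OF tv tvk]
    by (simp add: x_def y_def)
  have "(\<rho> * x) * (x + 2 * c * y + c * c * (- \<rho> * x)) = \<rho> * (x * x) + 2 * (\<rho> * x * c) * y - (\<rho> * x * c) * (\<rho> * x * c)"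
    by (simp add: algebra_simps)
  also have "\<dots> = 0" unfolding cx using q2 by (simp add: algebra_simps)
  finally have x1_0: "x + 2 * c * y + c * c * (- \<rho> * x) = 0" using rho x0 by simp
  have y1_0: "y + 2 * c * (- \<rho> * x) + c * c * (- \<rho> * y) \<noteq> 0"
  proof
    assume a: "y + 2 * c * (- \<rho> * x) + c * c * (- \<rho> * y) = 0"
    \<comment> \<open>\<open>(x, y)\<close> would solve a homogeneous linear system with positive determinant\<close>
    let ?\<alpha> = "1 - \<rho> * (c * c)"
    have 1: "?\<alpha> * x + 2 * c * y = 0" "?\<alpha> * y - 2 * c * \<rho> * x = 0" using a x1_0 by (simp_all add: algebra_simps)
    have "(?\<alpha> * ?\<alpha> + 4 * (c * c) * \<rho>) * x = ?\<alpha> * (?\<alpha> * x + 2 * c * y) - 2 * c * (?\<alpha> * y - 2 * c * \<rho> * x)"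
      by (simp add: algebra_simps)
    then have "?\<alpha> * ?\<alpha> + 4 * (c * c) * \<rho> = 0" using 1 x0 by simp
    moreover have "?\<alpha> * ?\<alpha> \<ge> 0" "4 * (c * c) * \<rho> \<ge> 0" using rho by simp_all
    ultimately have "?\<alpha> * ?\<alpha> = 0" "4 * (c * c) * \<rho> = 0" by linarith+
    then show False using rho by auto
  qed
  have eta: "om n (d *\<^sub>v mpow T k (t *\<^sub>v v1)) v1 \<noteq> 0" using y1 y1_0 by simp
  obtain v2 where v2: "v2 \<in> carrier_vec ?N" "mpow T (Suc k) v2 = 0\<^sub>v ?N" "om n (d *\<^sub>v mpow T k (t *\<^sub>v v2)) v2 \<noteq> 0"
    "om n (d *\<^sub>v mpow T k v2) v2 = 0" "\<forall>m<k. om n (d *\<^sub>v mpow T m v2) v2 = 0"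
    using f.clear_lower[OF tc ts t_ok v1 v1k eta, of k] x1 x1_0 eta by auto
  have d2: "om n (d *\<^sub>v mpow T j v2) v2 = 0" for j
    using v2(4,5) f.form_zero[OF v2(2), of j v2] by (cases j k rule: linorder_cases) auto
  interpret g: form_ops n D T
    by unfold_locales (use Dc Tc Ts TD sadj_alt_part[OF XXc] in \<open>auto simp: D_def\<close>)
  have "D *\<^sub>v mpow T k v2 = 2 \<cdot>\<^sub>v (d *\<^sub>v mpow T k (t *\<^sub>v v2))"
    unfolding D using mpow_carrier[OF Tc v2(1), of k] mpow_commute[OF Tc tc Tt v2(1), of k]
    by (simp add: mat_smult_vec mat_vec_assoc)
  then have "om n (D *\<^sub>v mpow T k v2) v2 \<noteq> 0" using v2(3) by (simp add: om_smult_left mv_carrier)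
  from g.normalize[OF v2(1,2) this] d2 f.form_ops_axioms
  obtain w s where w: "w \<in> carrier_vec ?N" "mpow T (Suc k) w = 0\<^sub>v ?N" "s * s = 1"
    "\<forall>j. om n (D *\<^sub>v mpow T j w) w = (if Suc j = Suc k then - s else 0)" "\<forall>m. om n (d *\<^sub>v mpow T m w) w = 0" by blast
  interpret dd: double_data n "Suc k" s \<mu> X T D w
    by unfold_locales
      (use XX X w T_def D_def om_sym_zero[OF w(1) Tc Ts Tt] mpow_carrier[OF Tc w(1)] in \<open>auto simp: om_X simp del: funpow.simps\<close>)
  show ?thesis using dd.double_split w(3) unfolding \<mu>_def by (intro exI[of _ "Suc k"] exI[of _ s]) auto
qed

lemma split_minus_one:
  assumes ev: "eigenvalue (X * X) (- 1)"
  shows "\<exists>k s X'. s * s = 1 \<and> k \<ge> 1 \<and>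
    (odd k \<and> X' \<in> Sp (n - k) \<and> k \<le> n \<and> symp_similar n X (wnf k s 0 \<diamond> X')
     \<or> X' \<in> Sp (n - (k + k)) \<and> k + k \<le> n \<and> symp_similar n X (swap_root k (wnf k s (- 1)) \<diamond> X'))"
proof -
  have "sym_part n (X * X) - ((- 1 + 1 / - 1) / 2) \<cdot>\<^sub>m 1\<^sub>m (2 * n) = 2 \<cdot>\<^sub>m (t * t)"
    unfolding sym_part_square[OF X] by (rule eq_matI) auto
  then have "det (2 \<cdot>\<^sub>m (t * t)) = 0" using eigenvalue_det_sym_part[OF XX ev] by simp
  then have "det t * det t = 0" using det_mult[of t "2 * n" t] det_smult[of 2 "t * t"] by simp
  then have "det t = 0" by simp
  from cyclic_unipotent[OF this] obtain k s w where w: "w \<in> carrier_vec (2 * n)" "mpow t (Suc k) w = 0\<^sub>v (2 * n)" "s * s = 1"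
    "\<And>j. om n (d *\<^sub>v mpow t j w) w = (if Suc j = Suc k then - s else 0)" by blast
  show ?thesis
  proof (cases "odd (Suc k)")
    case True
    then show ?thesis using split_odd[OF w] w(3) by (intro exI[of _ "Suc k"] exI[of _ s]) auto
  next
    case False
    then have "even (Suc k)" by blast
    then obtain m where m: "Suc k = 2 * m" by (rule evenE)
    show ?thesis using split_even[OF w[unfolded m]] w(3) m by (intro exI[of _ m] exI[of _ s]) auto
  qed
qed

end

section \<open>Odd blocks for the eigenvalue -1\<close>

text \<open>For a Wonenburger matrix \<open>X\<close> the inverse differs from \<open>X\<close> only in the signs of the off-diagonal
  blocks, so this is the double angle formula for its parts.\<close>

lemma wonenburger_square:
  assumes "wonenburger_rel k a b c"
  shows "wblock a b c * wblock a b c = wblock (2 \<cdot>\<^sub>m (a * a) - 1\<^sub>m k) (2 \<cdot>\<^sub>m (a * b)) (2 \<cdot>\<^sub>m (c * a))"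
    "wonenburger_rel k (2 \<cdot>\<^sub>m (a * a) - 1\<^sub>m k) (2 \<cdot>\<^sub>m (a * b)) (2 \<cdot>\<^sub>m (c * a))"
proof -
  have c: "a \<in> carrier_mat k k" "b \<in> carrier_mat k k" "c \<in> carrier_mat k k"
    and s: "b\<^sup>T = b" "c\<^sup>T = c"
    and r: "a * b = b * a\<^sup>T" "a\<^sup>T * c = c * a" "a * a - b * c = 1\<^sub>m k"
    using assms by (auto simp: wonenburger_rel_def)
  have bc: "b * c = a * a - 1\<^sub>m k"
  proof -
    have "b * c = a * a - (a * a - b * c)" using c by (intro eq_matI) auto
    then show ?thesis using r(3) by simp
  qed
  have cb: "c * b = a\<^sup>T * a\<^sup>T - 1\<^sub>m k"
    using arg_cong[OF bc, of transpose_mat] c s by (simp add: mat_tr)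
  have d2: "X + X = 2 \<cdot>\<^sub>m X" "X + (X - 1\<^sub>m k) = 2 \<cdot>\<^sub>m X - 1\<^sub>m k" "(X - 1\<^sub>m k) + X = 2 \<cdot>\<^sub>m X - 1\<^sub>m k"
    if "X \<in> carrier_mat k k" for X :: "real mat"
    using that by (auto intro!: eq_matI)
  show "wblock a b c * wblock a b c = wblock (2 \<cdot>\<^sub>m (a * a) - 1\<^sub>m k) (2 \<cdot>\<^sub>m (a * b)) (2 \<cdot>\<^sub>m (c * a))"
    unfolding wblock_def
    by (subst mult_four_block_mat[of _ k k _ k _ k _ _ k _ k])
      (use c in \<open>auto simp: bc cb r(1)[symmetric] r(2) d2 mat_tr\<close>)
  have ab: "b * (a\<^sup>T * X) = a * (b * X)" if "dim_row X = k" for X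
    using arg_cong[OF r(1), of "\<lambda>A. A * X"] that c by (simp add: mat_assoc)
  have ac: "a\<^sup>T * (c * X) = c * (a * X)" if "dim_row X = k" for X
    using arg_cong[OF r(2), of "\<lambda>A. A * X"] that c by (simp add: mat_assoc)
  have bc': "b * (c * X) = a * (a * X) - X" if "dim_row X = k" for X
    using arg_cong[OF bc, of "\<lambda>A. A * X"] that c by (simp add: mat_assoc mat_minus_right mat_unit)
  let ?A = "2 \<cdot>\<^sub>m (a * a) - 1\<^sub>m k" and ?B = "2 \<cdot>\<^sub>m (a * b)" and ?C = "2 \<cdot>\<^sub>m (c * a)"
  have 1: "?B\<^sup>T = ?B" "?C\<^sup>T = ?C" using c s r by (simp_all add: mat_tr)
  have 2: "?A * ?B = ?B * ?A\<^sup>T"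
    using c by (simp add: mat_tr mat_dist mat_assoc mat_unit ab r(1)[symmetric] mat_smult_smult mat_smult_minus)
  have 3: "?A\<^sup>T * ?C = ?C * ?A"
    using c by (simp add: mat_tr mat_dist mat_assoc mat_unit ac r(2) mat_smult_smult mat_smult_minus)
  have 4: "?A * ?A - ?B * ?C = 1\<^sub>m k"
    using c by (simp add: mat_dist mat_assoc mat_unit bc' mat_smult_smult mat_smult_minus)
      (rule eq_matI, auto simp: algebra_simps simp del: index_mult_mat(1))
  show "wonenburger_rel k ?A ?B ?C" unfolding wonenburger_rel_def
    using c 1 2 3 4 by (auto intro!: carrier_matI)
qed

definition mono_mat :: "nat \<Rightarrow> (nat \<Rightarrow> nat) \<Rightarrow> (nat \<Rightarrow> real) \<Rightarrow> real mat" where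
  "mono_mat k p c = mat k k (\<lambda>(i, j). if j = p i then c i else 0)"

lemma mono_mat_dim [simp]: "dim_row (mono_mat k p c) = k" "dim_col (mono_mat k p c) = k"
  by (auto simp: mono_mat_def)

lemma mono_mat_carrier [simp]: "mono_mat k p c \<in> carrier_mat k k" by (rule carrier_matI) auto

lemma mono_mat_index: "i < k \<Longrightarrow> j < k \<Longrightarrow> mono_mat k p c $$ (i, j) = (if j = p i then c i else 0)"
  by (simp add: mono_mat_def)

lemma mono_mat_mult: assumes "dim_row X = k" "i < k" "j < dim_col X" "p i < k"
  shows "(mono_mat k p c * X) $$ (i, j) = c i * X $$ (p i, j)"
  using assms by (simp add: scalar_prod_def mono_mat_def if_distrib[of "\<lambda>x. x * _"] cong: if_cong)

text \<open>Twice \<open>root_a\<close> is, after rescaling the basis vectors, a nilpotent shift along a single chain of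
  length \<open>2 l + 1\<close>. The basis lists the even steps of the chain first and the odd steps after them, so
  that the square splits into shifts of lengths \<open>l + 1\<close> and \<open>l\<close>, as in \<open>odd_A\<close>.\<close>

definition root_a :: "nat \<Rightarrow> real mat" where
  "root_a l = mono_mat (2 * l + 1) (\<lambda>i. if i < l then i + l + 1 else i - l) (\<lambda>i. if i < l then 1 else if i = l then 0 else 1 / 2)"

text \<open>On the chain of \<open>root_a\<close> this is the flip that reverses it, up to scaling: it preserves the
  even steps and the odd steps.\<close>

definition root_b :: "nat \<Rightarrow> real \<Rightarrow> real \<Rightarrow> real mat" where
  "root_b l t u = mono_mat (2 * l + 1) (\<lambda>i. if i \<le> l then l - i else 3 * l + 1 - i) (\<lambda>i. if i \<le> l then t else u)"

lemma root_dim [simp]: "dim_row (root_a l) = 2 * l + 1" "dim_col (root_a l) = 2 * l + 1"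
  "dim_row (root_b l t u) = 2 * l + 1" "dim_col (root_b l t u) = 2 * l + 1"
  by (auto simp: root_a_def root_b_def)

lemma root_b_mult:
  assumes "t * t' = 1" "u * u' = 1"
  shows "root_b l t u * root_b l t' u' = 1\<^sub>m (2 * l + 1)"
proof (rule eq_matI)
  fix i j assume "i < dim_row (1\<^sub>m (2 * l + 1) :: real mat)" "j < dim_col (1\<^sub>m (2 * l + 1) :: real mat)"
  then have ij: "i < 2 * l + 1" "j < 2 * l + 1" by auto
  then show "(root_b l t u * root_b l t' u') $$ (i, j) = 1\<^sub>m (2 * l + 1) $$ (i, j)"
    using assms unfolding root_b_def by (subst mono_mat_mult) (auto simp: mono_mat_index)
qed auto

lemma root_b_sym: "(root_b l t u)\<^sup>T = root_b l t u"
  by (rule eq_matI) (auto simp: root_b_def mono_mat_index)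

lemma root_ab_index:
  assumes "i < 2 * l + 1" "j < 2 * l + 1"
  shows "(root_a l * root_b l t (t / 2)) $$ (i, j) = (if i + j = 2 * l \<and> i \<noteq> l then t / 2 else 0)"
proof (cases i l rule: linorder_cases)
  case less
  have "(root_a l * root_b l t (t / 2)) $$ (i, j) = root_b l t (t / 2) $$ (i + l + 1, j)"
    using assms less unfolding root_a_def by (subst mono_mat_mult) simp_all
  also have "\<dots> = (if j = 3 * l + 1 - (i + l + 1) then t / 2 else 0)"
    using assms less unfolding root_b_def by (subst mono_mat_index) simp_all
  also have "j = 3 * l + 1 - (i + l + 1) \<longleftrightarrow> i + j = 2 * l \<and> i \<noteq> l" using less by arith
  finally show ?thesis .
next
  case equal
  then show ?thesis using assms unfolding root_a_def by (subst mono_mat_mult) simp_all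
next
  case greater
  have "(root_a l * root_b l t (t / 2)) $$ (i, j) = 1 / 2 * root_b l t (t / 2) $$ (i - l, j)"
    using assms greater unfolding root_a_def by (subst mono_mat_mult) simp_all
  also have "\<dots> = (if j = l - (i - l) then t / 2 else 0)"
    using assms greater le_diff_conv[of i l l] unfolding root_b_def by (subst mono_mat_index) simp_all
  also have "j = l - (i - l) \<longleftrightarrow> i + j = 2 * l \<and> i \<noteq> l" using greater assms by arith
  finally show ?thesis .
qed

lemma root_ab_comm: "root_a l * root_b l t (t / 2) = root_b l t (t / 2) * (root_a l)\<^sup>T"
proof -
  have "(root_a l * root_b l t (t / 2))\<^sup>T = root_a l * root_b l t (t / 2)"
    by (rule eq_matI) (auto simp: root_ab_index simp del: index_mult_mat(1))
  then show ?thesis by (simp add: mat_tr root_b_sym)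
qed

lemma odd_dim [simp]: "dim_row (odd_A l) = 2 * l + 1" "dim_col (odd_A l) = 2 * l + 1"
  "dim_row (odd_B l t) = 2 * l + 1" "dim_col (odd_B l t) = 2 * l + 1"
  by (auto simp: odd_A_def odd_B_def diag_block_two simp del: diag_block_mat.simps)

lemma odd_carrier [simp]: "odd_A l \<in> carrier_mat (2 * l + 1) (2 * l + 1)" "odd_B l t \<in> carrier_mat (2 * l + 1) (2 * l + 1)"
  by (rule carrier_matI; simp)+

lemma odd_A_index: "i < 2 * l + 1 \<Longrightarrow> j < 2 * l + 1 \<Longrightarrow>
    odd_A l $$ (i, j) = (if i = j then - 1 else if j = i + 1 \<and> i \<noteq> l then 1 else 0)"
  by (auto simp: odd_A_def diag_block_two simp del: diag_block_mat.simps)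

lemma root_aa_index:
  assumes "i < 2 * l + 1" "j < 2 * l + 1"
  shows "(root_a l * root_a l) $$ (i, j) = (if j = i + 1 \<and> i \<noteq> l then 1 / 2 else 0)"
proof (cases i l rule: linorder_cases)
  case less
  have "(root_a l * root_a l) $$ (i, j) = root_a l $$ (i + l + 1, j)"
    using assms less by (subst (1) root_a_def, subst mono_mat_mult) simp_all
  also have "\<dots> = (if j = i + l + 1 - l then 1 / 2 else 0)"
    using assms less unfolding root_a_def by (subst mono_mat_index) simp_all
  finally show ?thesis using less by simp
next
  case equal
  then show ?thesis using assms by (subst (1) root_a_def, subst mono_mat_mult) simp_all
next
  case greater
  have "(root_a l * root_a l) $$ (i, j) = 1 / 2 * root_a l $$ (i - l, j)"
    using assms greater by (subst (1) root_a_def, subst mono_mat_mult) simp_all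
  also have "\<dots> = 1 / 2 * (if j = (if i - l < l then i - l + l + 1 else i - l - l) then (if i - l < l then 1 else if i - l = l then 0 else 1 / 2) else 0)"
    using assms greater unfolding root_a_def by (subst mono_mat_index) simp_all
  also have "\<dots> = (if j = i + 1 \<and> i \<noteq> l then 1 / 2 else 0)"
  proof (cases "i - l < l")
    case True
    then show ?thesis using greater by simp
  next
    case False
    then have "i = 2 * l" using assms by simp
    then show ?thesis using assms greater by simp
  qed
  finally show ?thesis .
qed

lemma root_aa: "2 \<cdot>\<^sub>m (root_a l * root_a l) - 1\<^sub>m (2 * l + 1) = odd_A l"
  by (rule eq_matI) (auto simp: root_aa_index odd_A_index simp del: index_mult_mat(1))

lemma root_ab: "2 \<cdot>\<^sub>m (root_a l * root_b l t (t / 2)) = odd_B l t"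
  by (rule eq_matI) (auto simp: root_ab_index odd_B_def simp del: index_mult_mat(1))

text \<open>The Wonenburger matrix with first blocks \<open>a\<close> and \<open>b\<close> chosen such that \<open>2 a\<^sup>2 - 1\<close> is \<open>odd_A\<close> and \<open>2 a b\<close> is
  \<open>odd_B\<close>; its square is an odd summand. It is cyclic with eigenvalues \<open>\<plusminus>i\<close>.\<close>

definition odd_root :: "nat \<Rightarrow> real \<Rightarrow> real mat" where
  "odd_root l t = wblock (root_a l) (root_b l t (t / 2))
     (root_b l t (2 * t) * (root_a l * root_a l - 1\<^sub>m (2 * l + 1)))"

lemma odd_root_rel: assumes "t * t = 1"
  shows "wonenburger_rel (2 * l + 1) (root_a l) (root_b l t (t / 2)) (root_b l t (2 * t) * (root_a l * root_a l - 1\<^sub>m (2 * l + 1)))"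
  by (rule wonenburger_relI) (use assms in \<open>auto simp: root_b_mult root_b_sym root_ab_comm simp del: One_nat_def intro!: carrier_matI\<close>)

lemma odd_root_Sp: "t * t = 1 \<Longrightarrow> odd_root l t \<in> Sp (2 * l + 1)"
  unfolding odd_root_def by (rule wblock_Sp[OF odd_root_rel])

lemma odd_root_square: assumes "t * t = 1"
  shows "\<exists>C. wonenburger_rel (2 * l + 1) (odd_A l) (odd_B l t) C \<and> (l = 0 \<longrightarrow> C = 0\<^sub>m 1 1) \<and>
    odd_root l t * odd_root l t = wblock (odd_A l) (odd_B l t) C"
proof -
  let ?c = "root_b l t (2 * t) * (root_a l * root_a l - 1\<^sub>m (2 * l + 1))"
  note w = wonenburger_square[OF odd_root_rel[OF assms], of l, unfolded root_aa root_ab]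
  have "2 \<cdot>\<^sub>m (?c * root_a l) = 0\<^sub>m 1 1" if "l = 0"
  proof -
    have "root_a l = 0\<^sub>m 1 1" using that by (auto simp: root_a_def mono_mat_def intro!: eq_matI)
    then show ?thesis using that by (auto simp: mat_unit intro!: eq_matI)
  qed
  then show ?thesis using w unfolding odd_root_def by blast
qed

lemma sym_part_wblock: assumes "wonenburger_rel k A B C"
  shows "sym_part k (wblock A B C) = four_block_mat A (0\<^sub>m k k) (0\<^sub>m k k) (A\<^sup>T)"
    "alt_part k (wblock A B C) = four_block_mat (0\<^sub>m k k) B C (0\<^sub>m k k)"
proof -
  have c: "A \<in> carrier_mat k k" "B \<in> carrier_mat k k" "C \<in> carrier_mat k k"
    using assms by (auto simp: wonenburger_rel_def)
  show "sym_part k (wblock A B C) = four_block_mat A (0\<^sub>m k k) (0\<^sub>m k k) (A\<^sup>T)"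
    "alt_part k (wblock A B C) = four_block_mat (0\<^sub>m k k) B C (0\<^sub>m k k)"
    unfolding sym_part_def alt_part_def sadj_wblock[OF assms] unfolding wblock_def using c
    by (auto intro!: eq_matI)
qed

lemma om_low_high: assumes "u \<in> carrier_vec k" "v \<in> carrier_vec k"
  shows "om k (low_emb k *\<^sub>v u) (high_emb k *\<^sub>v v) = - (u \<bullet> v)"
proof -
  have "symp_form k * high_emb k = - low_emb k"
  proof -
    have "symp_form k * high_emb k = (low_emb k * (- 1\<^sub>m k * (high_emb k)\<^sup>T) + high_emb k * (1\<^sub>m k * (low_emb k)\<^sup>T)) * high_emb k"
      unfolding symp_form_def by (subst four_block_mat_low_high[of _ k]) (auto simp: mat_unit mat_add_zero)
    also have "\<dots> = - low_emb k" by (simp add: mat_dist mat_assoc mat_unit low_high_orthonormal mat_add_zero)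
    finally show ?thesis .
  qed
  then have "symp_form k *\<^sub>v (high_emb k *\<^sub>v v) = - (low_emb k *\<^sub>v v)"
    using assms by (simp add: mat_vec_assoc[symmetric] mat_uminus_vec)
  then have "om k (low_emb k *\<^sub>v u) (high_emb k *\<^sub>v v) = - ((low_emb k *\<^sub>v u) \<bullet> (low_emb k *\<^sub>v v))"
    by (simp add: om_def)
  also have "(low_emb k *\<^sub>v u) \<bullet> (low_emb k *\<^sub>v v) = ((low_emb k)\<^sup>T *\<^sub>v (low_emb k *\<^sub>v u)) \<bullet> v"
    by (rule transpose_vec_mult_scalar[symmetric, of _ "2 * k" k]) (use assms in \<open>auto intro!: carrier_matI carrier_vecI\<close>)
  also have "(low_emb k)\<^sup>T *\<^sub>v (low_emb k *\<^sub>v u) = u"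
    using assms by (simp add: mat_vec_assoc[symmetric] low_high_orthonormal mat_one_vec)
  finally show ?thesis .
qed

lemma mpow_intertwine:
  assumes "A \<in> carrier_mat m m" "B \<in> carrier_mat k k" "R \<in> carrier_mat m k" "A * R = R * B" "x \<in> carrier_vec k"
  shows "mpow A j (R *\<^sub>v x) = R *\<^sub>v mpow B j x"
proof (induction j)
  case (Suc j)
  note v = mpow_carrier[OF assms(2,5), of j]
  have "A *\<^sub>v (R *\<^sub>v mpow B j x) = (A * R) *\<^sub>v mpow B j x" using assms(1-3,5) v by (simp add: mat_vec_assoc)
  also have "\<dots> = R *\<^sub>v (B *\<^sub>v mpow B j x)" unfolding assms(4) using assms(1-3,5) v by (simp add: mat_vec_assoc)
  finally show ?case using Suc by simp
qed simp

lemma root_a_unit: assumes "j < 2 * l + 1"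
  shows "(root_a l)\<^sup>T *\<^sub>v unit_vec (2 * l + 1) j =
    (if j < l then unit_vec (2 * l + 1) (j + l + 1) else if j = l then 0\<^sub>v (2 * l + 1) else (1 / 2) \<cdot>\<^sub>v unit_vec (2 * l + 1) (j - l))"
  by (rule eq_vecI) (use assms in \<open>auto simp: root_a_def mono_mat_index\<close>)

lemma root_a_chain: "j \<le> l \<Longrightarrow> mpow ((root_a l)\<^sup>T) (2 * j) (unit_vec (2 * l + 1) 0) = ((1 / 2) ^ j) \<cdot>\<^sub>v unit_vec (2 * l + 1) j"
proof (induction j)
  case 0
  then show ?case by (auto intro!: eq_vecI)
next
  case (Suc j)
  let ?A = "(root_a l)\<^sup>T"
  have "mpow ?A (2 * Suc j) (unit_vec (2 * l + 1) 0) = ?A *\<^sub>v (?A *\<^sub>v mpow ?A (2 * j) (unit_vec (2 * l + 1) 0))" by simp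
  also have "\<dots> = ?A *\<^sub>v (?A *\<^sub>v (((1 / 2) ^ j) \<cdot>\<^sub>v unit_vec (2 * l + 1) j))" using Suc by simp
  also have "?A *\<^sub>v (((1 / 2) ^ j) \<cdot>\<^sub>v unit_vec (2 * l + 1) j) = ((1 / 2) ^ j) \<cdot>\<^sub>v unit_vec (2 * l + 1) (j + l + 1)"
    using Suc.prems root_a_unit[of j l] by (simp add: mat_vec_smult)
  also have "?A *\<^sub>v \<dots> = ((1 / 2) ^ j) \<cdot>\<^sub>v ((1 / 2) \<cdot>\<^sub>v unit_vec (2 * l + 1) (j + l + 1 - l))"
    using Suc.prems root_a_unit[of "j + l + 1" l] by (simp add: mat_vec_smult)
  finally show ?case by (simp add: smult_smult_assoc mult.commute)
qed

text \<open>The first vector of the second half generates the chain, and its top moment has the sign \<open>-t\<close>.\<close>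

lemma odd_root_similar: assumes t: "t = 1 \<or> t = - 1"
  shows "symp_similar (2 * l + 1) (wnf (2 * l + 1) t 0) (odd_root l t)"
proof -
  let ?k = "2 * l + 1"
  define X where "X = odd_root l t"
  have tt: "t * t = 1" using t by auto
  have X: "X \<in> Sp ?k" unfolding X_def by (rule odd_root_Sp[OF tt])
  note rel = odd_root_rel[OF tt, of l]
  let ?a = "root_a l" and ?b = "root_b l t (t / 2)"
  let ?c = "root_b l t (2 * t) * (root_a l * root_a l - 1\<^sub>m ?k)"
  have ac: "?a \<in> carrier_mat ?k ?k" "?b \<in> carrier_mat ?k ?k" "?c \<in> carrier_mat ?k ?k"
    using rel by (auto simp: wonenburger_rel_def)
  have T: "sym_part ?k X * high_emb ?k = high_emb ?k * ?a\<^sup>T"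
    unfolding X_def odd_root_def sym_part_wblock[OF rel] using ac(1)
    by (subst four_block_mat_low_high[of _ ?k]) (auto simp: mat_dist mat_assoc mat_unit low_high_orthonormal mat_add_zero simp del: One_nat_def)
  have D: "alt_part ?k X * high_emb ?k = low_emb ?k * ?b"
    unfolding X_def odd_root_def sym_part_wblock[OF rel] using ac
    by (subst four_block_mat_low_high[of _ ?k]) (auto simp: mat_dist mat_assoc mat_unit low_high_orthonormal mat_add_zero simp del: One_nat_def)
  define x where "x = (unit_vec ?k 0 :: real vec)"
  have x: "x \<in> carrier_vec ?k" by (simp add: x_def)
  define v where "v = high_emb ?k *\<^sub>v x"
  have v: "v \<in> carrier_vec (2 * ?k)" unfolding v_def by (rule mv_carrier) simp
  have hc: "high_emb ?k \<in> carrier_mat (2 * ?k) ?k" by (rule carrier_matI) simp_all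
  have Tj: "mpow (sym_part ?k X) j v = high_emb ?k *\<^sub>v mpow (?a\<^sup>T) j x" for j
    unfolding v_def by (rule mpow_intertwine[OF part_carrier(1) _ hc T x]) (use ac in auto)
  have a2l: "mpow (?a\<^sup>T) (2 * l) x = ((1 / 2) ^ l) \<cdot>\<^sub>v unit_vec ?k l"
    unfolding x_def by (rule root_a_chain) simp
  have "mpow (?a\<^sup>T) (Suc (2 * l)) x = 0\<^sub>v ?k"
    using a2l root_a_unit[of l l] ac by (simp add: mat_vec_smult smult_zero_v)
  then have nil: "mpow (sym_part ?k X) (Suc (2 * l)) v = 0\<^sub>v (2 * ?k)" unfolding Tj by (simp only:) (simp add: mat_vec_zero)
  have "alt_part ?k X *\<^sub>v mpow (sym_part ?k X) (2 * l) v = low_emb ?k *\<^sub>v (?b *\<^sub>v (((1 / 2) ^ l) \<cdot>\<^sub>v unit_vec ?k l))"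
    unfolding Tj a2l using ac by (simp add: mat_vec_assoc[symmetric] D del: One_nat_def)
  then have "om ?k (alt_part ?k X *\<^sub>v mpow (sym_part ?k X) (2 * l) v) v = - ((?b *\<^sub>v (((1 / 2) ^ l) \<cdot>\<^sub>v unit_vec ?k l)) \<bullet> x)"
    unfolding v_def using x ac by (simp only:) (rule om_low_high, auto simp: mv_carrier)
  also have "(?b *\<^sub>v (((1 / 2) ^ l) \<cdot>\<^sub>v unit_vec ?k l)) \<bullet> x = (1 / 2) ^ l * t"
    using ac by (simp add: x_def mat_vec_smult root_b_def mono_mat_index)
  finally have e: "om ?k (alt_part ?k X *\<^sub>v mpow (sym_part ?k X) (2 * l) v) v = - ((1 / 2) ^ l * t)" .
  interpret q: sqrt_data ?k X by unfold_locales (rule X)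
  interpret f: form_ops ?k "alt_part ?k X" "sym_part ?k X"
    by (rule q.form_ops_d) (use sadj_sym_part[OF q.Xc] q.td in auto)
  have "om ?k (alt_part ?k X *\<^sub>v mpow (sym_part ?k X) (2 * l) v) v \<noteq> 0" using e t by auto
  from f.normalize[OF v nil this] obtain w s where w: "s = - sgn (- ((1 / 2) ^ l * t))" "w \<in> carrier_vec (2 * ?k)"
    "mpow (sym_part ?k X) (Suc (2 * l)) w = 0\<^sub>v (2 * ?k)"
    "\<And>j. om ?k (alt_part ?k X *\<^sub>v mpow (sym_part ?k X) j w) w = (if Suc j = Suc (2 * l) then - s else 0)"
    unfolding e by blast
  have st: "s = t" using t w(1) by (auto simp: sgn_mult)
  have k: "Suc (2 * l) = ?k" by simp
  interpret c: cyclic_data ?k ?k t 0 X "sym_part ?k X" "alt_part ?k X" w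
    by unfold_locales (use X w(2,4) w(3)[unfolded k] tt st in \<open>auto intro!: eq_matI\<close>)
  show ?thesis unfolding X_def[symmetric]
    by (rule symp_similarI[OF c.semb_S[folded Sp_iff_semb] Sp_carrier[OF wnf_Sp[OF tt]] Sp_carrier[OF X] c.M_S[symmetric]])
qed

lemma odd_C_row:
  assumes rel: "wonenburger_rel (2 * l + 1) (odd_A l) (odd_B l t) C" and l: "l \<ge> 1" and t: "t * t = 1" and j: "j < 2 * l + 1"
  shows "C $$ (l + 1, j) = (if j = l then - 2 * t else 0)"
proof -
  let ?k = "2 * l + 1"
  have C: "C \<in> carrier_mat ?k ?k" and AB: "odd_A l * odd_A l - odd_B l t * C = 1\<^sub>m ?k"
    using rel by (auto simp: wonenburger_rel_def)
  have B: "odd_B l t = mono_mat ?k (\<lambda>i. 2 * l - i) (\<lambda>i. if i = l then 0 else t)"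
    by (rule eq_matI) (auto simp: odd_B_def mono_mat_index)
  have i: "l - 1 < ?k" by simp
  have "2 * l - (l - 1) = l + 1" using l by simp
  then have BC: "(odd_B l t * C) $$ (l - 1, j) = t * C $$ (l + 1, j)"
    using C j l unfolding B by (subst mono_mat_mult) auto
  have "(odd_A l * odd_A l) $$ (l - 1, j) = (\<Sum>a = 0..<?k. odd_A l $$ (l - 1, a) * odd_A l $$ (a, j))"
    using i j by (simp add: scalar_prod_def)
  also have "\<dots> = (\<Sum>a = 0..<?k. (if a = l - 1 then - odd_A l $$ (a, j) else 0) + (if a = l then odd_A l $$ (a, j) else 0))"
    by (rule sum.cong) (use l in \<open>auto simp: odd_A_index\<close>)
  also have "\<dots> = - odd_A l $$ (l - 1, j) + odd_A l $$ (l, j)" using l by (simp add: sum.distrib)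
  also have "\<dots> = (if j = l - 1 then 1 else if j = l then - 2 else 0)" using j l by (auto simp: odd_A_index)
  finally have AA: "(odd_A l * odd_A l) $$ (l - 1, j) = (if j = l - 1 then 1 else if j = l then - 2 else 0)" .
  have "(odd_A l * odd_A l - odd_B l t * C) $$ (l - 1, j) = (1\<^sub>m ?k :: real mat) $$ (l - 1, j)" unfolding AB ..
  then have "(if j = l - 1 then 1 else if j = l then - 2 else 0) - t * C $$ (l + 1, j) = (if j = l - 1 then 1 else 0)"
    using AA BC i j C by (simp del: index_mult_mat(1))
  then have "t * C $$ (l + 1, j) = (if j = l then - 2 else 0)" using l by (auto split: if_splits)
  then have "t * (t * C $$ (l + 1, j)) = t * (if j = l then - 2 else 0)" by simp
  then show ?thesis using t by (simp add: mult.assoc[symmetric])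
qed

text \<open>The relation for \<open>B C\<close> fixes all rows of \<open>C\<close> except the middle one, because \<open>B\<close> has rank \<open>2 l\<close>;
  symmetry fixes the middle row up to its middle entry.\<close>

lemma odd_C_diff:
  assumes rel: "wonenburger_rel (2 * l + 1) (odd_A l) (odd_B l t) C" "wonenburger_rel (2 * l + 1) (odd_A l) (odd_B l t) C'"
    and t: "t * t = 1" and ij: "i < 2 * l + 1" "j < 2 * l + 1" "\<not> (i = l \<and> j = l)"
  shows "C $$ (i, j) = C' $$ (i, j)"
proof -
  let ?k = "2 * l + 1"
  have c: "C \<in> carrier_mat ?k ?k" "C' \<in> carrier_mat ?k ?k" and s: "C\<^sup>T = C" "C'\<^sup>T = C'"
    and AB: "odd_A l * odd_A l - odd_B l t * C = odd_A l * odd_A l - odd_B l t * C'"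
    using rel by (auto simp: wonenburger_rel_def)
  have B: "odd_B l t = mono_mat ?k (\<lambda>i. 2 * l - i) (\<lambda>i. if i = l then 0 else t)"
    by (rule eq_matI) (auto simp: odd_B_def mono_mat_index)
  have row: "C $$ (i, j) = C' $$ (i, j)" if i: "i < ?k" "i \<noteq> l" and j: "j < ?k" for i j
  proof -
    have "(odd_A l * odd_A l - odd_B l t * C) $$ (2 * l - i, j) = (odd_A l * odd_A l - odd_B l t * C') $$ (2 * l - i, j)"
      unfolding AB ..
    then have "(odd_B l t * C) $$ (2 * l - i, j) = (odd_B l t * C') $$ (2 * l - i, j)"
      using c i j by (simp del: index_mult_mat(1))
    moreover have "2 * l - (2 * l - i) = i" "2 * l - i \<noteq> l" using i by auto
    ultimately have "t * C $$ (i, j) = t * C' $$ (i, j)"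
      using c i j unfolding B by (simp add: mono_mat_mult del: index_mult_mat(1))
    then show ?thesis using t by auto
  qed
  show ?thesis
  proof (cases "i = l")
    case True
    then have "C $$ (j, i) = C' $$ (j, i)" using row[of j i] ij by auto
    then show ?thesis using s c ij by (metis carrier_matD index_transpose_mat(1))
  qed (use row ij in auto)
qed

text \<open>Conjugation with \<open>U \<oplus> U\<^sup>-\<^sup>T\<close>, where \<open>U = 1 + x E\<close> for the matrix unit \<open>E\<close> in position \<open>(l + 1, l)\<close>, fixes
  \<open>A\<close> and \<open>B\<close> and changes only the middle entry of \<open>C\<close>. It does so with slope \<open>4 t\<close>, because
  \<open>C\<close> has the entry \<open>-2 t\<close> in position \<open>(l + 1, l)\<close>; this is where \<open>l \<ge> 1\<close> enters.\<close>

lemma odd_summand_similar: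
  assumes rel: "wonenburger_rel (2 * l + 1) (odd_A l) (odd_B l t) C" "wonenburger_rel (2 * l + 1) (odd_A l) (odd_B l t) C'"
    and l: "l \<ge> 1" and t: "t * t = 1"
  shows "symp_similar (2 * l + 1) (wblock (odd_A l) (odd_B l t) C) (wblock (odd_A l) (odd_B l t) C')"
proof -
  define k where "k = 2 * l + 1"
  note odd_dim [simp del]
  let ?A = "odd_A l" and ?B = "odd_B l t"
  note rel' = rel[folded k_def]
  have c: "?A \<in> carrier_mat k k" "?B \<in> carrier_mat k k" "C \<in> carrier_mat k k" "C' \<in> carrier_mat k k"
    and s: "?B\<^sup>T = ?B" "C\<^sup>T = C" "C'\<^sup>T = C'"
    using rel' by (auto simp: wonenburger_rel_def)
  define E where "E = mat k k (\<lambda>(i, j). if i = l + 1 \<and> j = l then 1 else 0 :: real)"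
  have E: "E \<in> carrier_mat k k" by (simp add: E_def)
  define x where "x = - (C $$ (l, l) - C' $$ (l, l)) * t / 4"
  have EX: "(E * X) $$ (i, j) = (if i = l + 1 then X $$ (l, j) else 0)" if "dim_row X = k" "i < k" "j < dim_col X" for X i j
  proof -
    have "E = mono_mat k (\<lambda>_. l) (\<lambda>i. if i = l + 1 then 1 else 0)" by (rule eq_matI) (auto simp: E_def mono_mat_index)
    then show ?thesis using that by (simp only:, subst mono_mat_mult) (auto simp: k_def)
  qed
  have XE: "(X * E) $$ (i, j) = (if j = l then X $$ (i, l + 1) else 0)" if "dim_col X = k" "i < dim_row X" "j < k" for X i j
  proof -
    have "(X * E) $$ (i, j) = (\<Sum>a = 0..<k. X $$ (i, a) * E $$ (a, j))"
      using that E by (simp add: scalar_prod_def)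
    also have "\<dots> = (\<Sum>a = 0..<k. if a = l + 1 then (if j = l then X $$ (i, l + 1) else 0) else 0)"
      by (rule sum.cong) (use that in \<open>auto simp: E_def\<close>)
    finally have "(X * E) $$ (i, j) = (\<Sum>a = 0..<k. if a = l + 1 then (if j = l then X $$ (i, l + 1) else 0) else 0)" .
    then show ?thesis using l by (simp add: k_def)
  qed
  have EA: "E * ?A = ?A * E"
    by (rule eq_matI) (use E c l in \<open>auto simp: EX XE odd_A_index k_def simp del: index_mult_mat(1)\<close>)
  have EB: "E * ?B = 0\<^sub>m k k"
    by (rule eq_matI) (use E c l in \<open>auto simp: EX odd_B_def k_def simp del: index_mult_mat(1)\<close>)
  have BE: "?B * E\<^sup>T = 0\<^sub>m k k"
  proof -
    have "?B * E\<^sup>T = (E * ?B)\<^sup>T" using E c s by (simp add: mat_tr)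
    then show ?thesis unfolding EB by simp
  qed
  have EE: "E * E = 0\<^sub>m k k"
  proof (rule eq_matI)
    fix i j assume "i < dim_row (0\<^sub>m k k :: real mat)" "j < dim_col (0\<^sub>m k k :: real mat)"
    then have ij: "i < k" "j < k" by auto
    moreover have "E $$ (l, j) = 0" using ij by (simp add: E_def k_def)
    ultimately show "(E * E) $$ (i, j) = 0\<^sub>m k k $$ (i, j)" using E by (simp add: EX del: index_mult_mat(1))
  qed (use E in auto)
  have AE: "?A\<^sup>T * E\<^sup>T = E\<^sup>T * ?A\<^sup>T"
    using arg_cong[OF EA, of transpose_mat] E c by (simp add: mat_tr)
  have CE: "(C' * E) $$ (i, j) = (if i = l \<and> j = l then - 2 * t else 0)" if "i < k" "j < k" for i j
  proof -
    have "C' $$ (i, l + 1) = C' $$ (l + 1, i)" using s(3) c(4) that l by (metis carrier_matD index_transpose_mat(1) k_def add_less_mono1 less_add_same_cancel1 mult_2 not_less_eq_eq One_nat_def zero_less_one linorder_not_less)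
    then show ?thesis using that c E odd_C_row[OF rel(2) l t, of i] by (auto simp: XE k_def simp del: index_mult_mat(1))
  qed
  have EC: "(E\<^sup>T * C) $$ (i, j) = (if i = l \<and> j = l then - 2 * t else 0)" if "i < k" "j < k" for i j
  proof -
    have "(E\<^sup>T * C) = (C * E)\<^sup>T" using E c s by (simp add: mat_tr)
    then have "(E\<^sup>T * C) $$ (i, j) = (C * E) $$ (j, i)" using that E c by (simp del: index_mult_mat(1))
    moreover have "C $$ (j, l + 1) = C $$ (l + 1, j)" using s(2) c(3) that l by (metis carrier_matD index_transpose_mat(1) k_def add_less_mono1 less_add_same_cancel1 mult_2 not_less_eq_eq One_nat_def zero_less_one linorder_not_less)
    ultimately show ?thesis using that c E odd_C_row[OF rel(1) l t, of j] by (auto simp: XE k_def simp del: index_mult_mat(1))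
  qed
  define U where "U = 1\<^sub>m k + x \<cdot>\<^sub>m E"
  define V where "V = 1\<^sub>m k - x \<cdot>\<^sub>m E\<^sup>T"
  have UV: "U \<in> carrier_mat k k" "V \<in> carrier_mat k k" using E by (auto simp: U_def V_def)
  define P where "P = four_block_mat U (0\<^sub>m k k) (0\<^sub>m k k) V"
  have Pc: "P \<in> carrier_mat (2 * k) (2 * k)" unfolding P_def using UV by (auto intro!: carrier_matI)
  have VU: "V\<^sup>T * U = 1\<^sub>m k" unfolding U_def V_def using E
    by (simp add: mat_tr mat_dist mat_unit EE smult_zero_mat) (rule eq_matI, auto)
  have UV': "U\<^sup>T * V = 1\<^sub>m k" using arg_cong[OF VU, of transpose_mat] UV by (simp add: mat_tr)
  have nz: "- 0\<^sub>m k k = (0\<^sub>m k k :: real mat)" by (rule eq_matI) auto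
  have "sadj k k P * P = four_block_mat (1\<^sub>m k) (0\<^sub>m k k) (0\<^sub>m k k) (1\<^sub>m k)"
    unfolding P_def using UV
    by (subst sadj_four_block) (auto, subst mult_four_block_mat[of _ k k _ k _ k _ _ k _ k], auto simp: mat_unit mat_add_zero VU UV' mat_dist nz)
  also have "\<dots> = 1\<^sub>m (2 * k)" by (rule eq_matI) auto
  finally have P: "P \<in> Sp k" using Pc by (simp add: Sp_iff_semb semb_iff_sadj)
  have 1: "U * ?A = ?A * U" unfolding U_def using E c by (simp add: mat_dist mat_unit EA)
  have 2: "U * ?B = ?B * V" unfolding U_def V_def using E c by (simp add: mat_dist mat_unit EB BE smult_zero_mat) (rule eq_matI, auto)
  have 4: "V * ?A\<^sup>T = ?A\<^sup>T * V" unfolding V_def using E c by (simp add: mat_dist mat_unit AE)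
  have 3: "V * C = C' * U"
  proof (rule eq_matI)
    fix i j assume "i < dim_row (C' * U)" "j < dim_col (C' * U)"
    then have ij: "i < k" "j < k" using c UV by auto
    have "(V * C) $$ (i, j) = C $$ (i, j) - x * (E\<^sup>T * C) $$ (i, j)"
      unfolding V_def using E c ij by (simp add: mat_dist mat_unit del: index_mult_mat(1))
    moreover have "(C' * U) $$ (i, j) = C' $$ (i, j) + x * (C' * E) $$ (i, j)"
      unfolding U_def using E c ij by (simp add: mat_dist mat_unit del: index_mult_mat(1))
    moreover have "C $$ (i, j) = C' $$ (i, j)" if "\<not> (i = l \<and> j = l)"
      using odd_C_diff[OF rel t _ _ that] ij by (simp add: k_def)
    moreover have "x * t * 4 = - (C $$ (l, l) - C' $$ (l, l))" using t by (simp add: x_def mult.assoc)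
    ultimately show "(V * C) $$ (i, j) = (C' * U) $$ (i, j)" using ij by (auto simp: CE EC)
  qed (use c UV in auto)
  have "P * wblock ?A ?B C = wblock ?A ?B C' * P"
    unfolding P_def wblock_def using c UV
    by (subst (1 2) mult_four_block_mat[of _ k k _ k _ k _ _ k _ k]) (auto simp: mat_unit mat_add_zero 1 2 3 4)
  then show ?thesis unfolding k_def[symmetric]
    using symp_similarI[OF P wblock_carrier[OF rel'(1)] wblock_carrier[OF rel'(2)]] by blast
qed

lemma odd_summand_sqrt: assumes "odd_summand G" shows "\<exists>k X. G \<in> Sp k \<and> symp_sqrt k G X"
proof -
  obtain l t C where t: "t \<in> {1, - 1}" and rel: "wonenburger_rel (2 * l + 1) (odd_A l) (odd_B l t) C"
    and l0: "l = 0 \<longrightarrow> C = 0\<^sub>m 1 1" and G: "G = wblock (odd_A l) (odd_B l t) C"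
    using assms by (auto simp: odd_summand_def)
  have tt: "t * t = 1" using t by auto
  obtain C' where rel': "wonenburger_rel (2 * l + 1) (odd_A l) (odd_B l t) C'" and l0': "l = 0 \<longrightarrow> C' = 0\<^sub>m 1 1"
    and sq: "odd_root l t * odd_root l t = wblock (odd_A l) (odd_B l t) C'"
    using odd_root_square[OF tt] by blast
  have "symp_similar (2 * l + 1) G (wblock (odd_A l) (odd_B l t) C')"
  proof (cases "l = 0")
    case True
    then show ?thesis unfolding G using l0 l0' symp_similar_refl[OF wblock_carrier[OF rel]] by simp
  next
    case False
    then show ?thesis unfolding G by (intro odd_summand_similar[OF rel rel' _ tt]) simp
  qed
  moreover have "symp_sqrt (2 * l + 1) (wblock (odd_A l) (odd_B l t) C') (odd_root l t)"
    using sq odd_root_Sp[OF tt] by (simp add: symp_sqrt_def)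
  ultimately have "\<exists>X. symp_sqrt (2 * l + 1) G X" by (rule symp_sqrt_similar)
  moreover have "G \<in> Sp (2 * l + 1)" unfolding G by (rule wblock_Sp[OF rel])
  ultimately show ?thesis by blast
qed

lemma wnf_odd_square: assumes "s = 1 \<or> s = - 1"
  shows "\<exists>G. odd_summand G \<and> symp_similar (2 * l + 1) (wnf (2 * l + 1) s 0 * wnf (2 * l + 1) s 0) G"
proof -
  have ss: "s * s = 1" using assms by auto
  obtain C where C: "wonenburger_rel (2 * l + 1) (odd_A l) (odd_B l s) C" "l = 0 \<longrightarrow> C = 0\<^sub>m 1 1"
    "odd_root l s * odd_root l s = wblock (odd_A l) (odd_B l s) C"
    using odd_root_square[OF ss] by blast
  have "odd_summand (wblock (odd_A l) (odd_B l s) C)" unfolding odd_summand_def using C(1,2) assms by blast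
  then show ?thesis using symp_similar_square[OF odd_root_similar[OF assms, of l]] unfolding C(3) by blast
qed

section \<open>Square roots of matrices without negative real eigenvalues\<close>

text \<open>The complement of the closed negative real axis, where the principal square root is defined.\<close>

definition slit :: "complex \<Rightarrow> bool" where
  "slit z \<longleftrightarrow> \<not> (Im z = 0 \<and> Re z \<le> 0)"

text \<open>All eigenvalues lie in the open right half plane.\<close>

definition rhp :: "complex mat \<Rightarrow> bool" where
  "rhp Y \<longleftrightarrow> (\<forall>z. eigenvalue Y z \<longrightarrow> Re z > 0)"

lemma eigenvalue_upper_triangular:
  assumes "A \<in> carrier_mat n n" "upper_triangular A"
  shows "eigenvalue A z \<longleftrightarrow> (\<exists>i<n. A $$ (i, i) = (z :: complex))"
  unfolding eigenvalue_root_char_poly[OF assms(1)] char_poly_upper_triangular[OF assms] poly_prod_list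
  using assms(1) by (auto simp: prod_list_zero_iff diag_mat_def)

lemma det_nonzero_inverse:
  assumes "A \<in> carrier_mat n n" "det A \<noteq> (0 :: 'a :: field)"
  shows "\<exists>B\<in>carrier_mat n n. B * A = 1\<^sub>m n \<and> A * B = 1\<^sub>m n"
  using det_non_zero_imp_unit[OF assms, of "()"] unfolding Units_def ring_mat_def by auto

text \<open>Split off the first row and column. The remaining part \<open>x\<close> of the first row of the root has to solve
  \<open>x (c + Y') = r\<close>, and \<open>c + Y'\<close> is invertible since its diagonal entries have positive real part.\<close>

lemma upper_triangular_sqrt:
  "B \<in> carrier_mat n n \<Longrightarrow> upper_triangular B \<Longrightarrow> (\<And>i. i < n \<Longrightarrow> slit (B $$ (i, i))) \<Longrightarrow>
   \<exists>Y :: complex mat. Y \<in> carrier_mat n n \<and> upper_triangular Y \<and> Y * Y = B \<and> (\<forall>i<n. Re (Y $$ (i, i)) > 0)"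
proof (induction n arbitrary: B)
  case 0
  then show ?case by (intro exI[of _ "0\<^sub>m 0 0"]) (auto intro!: eq_matI)
next
  case (Suc m)
  obtain b r z B' where sp: "split_block B 1 1 = (b, r, z, B')" by (cases "split_block B 1 1")
  have s: "b \<in> carrier_mat 1 1" "r \<in> carrier_mat 1 m" "z \<in> carrier_mat m 1" "B' \<in> carrier_mat m m"
    "B = four_block_mat b r z B'" using split_block[OF sp, of m m] Suc.prems(1) by auto
  have idx: "B $$ (Suc i, Suc j) = B' $$ (i, j)" if "i < m" "j < m" for i j
    unfolding s(5) using s that by simp
  have z0: "z = 0\<^sub>m m 1"
  proof (rule eq_matI)
    fix i j assume "i < dim_row (0\<^sub>m m 1 :: complex mat)" "j < dim_col (0\<^sub>m m 1 :: complex mat)"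
    then have ij: "i < m" "j = 0" by auto
    have "B $$ (Suc i, 0) = 0" using Suc.prems(1,2) ij by (intro upper_triangularD) auto
    then show "z $$ (i, j) = 0\<^sub>m m 1 $$ (i, j)" using s ij by simp
  qed (use s in auto)
  have "upper_triangular B'"
  proof (rule upper_triangularI)
    fix i j assume "j < i" "i < dim_row B'"
    then show "B' $$ (i, j) = 0" using idx[of i j] upper_triangularD[OF Suc.prems(2), of "Suc j" "Suc i"] s Suc.prems(1) by auto
  qed
  moreover have "slit (B' $$ (i, i))" if "i < m" for i using Suc.prems(3)[of "Suc i"] idx[of i i] that by simp
  ultimately obtain Y' where Y': "Y' \<in> carrier_mat m m" "upper_triangular Y'" "Y' * Y' = B'" "\<forall>i<m. Re (Y' $$ (i, i)) > 0"
    using Suc.IH[OF s(4)] by blast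
  define c where "c = csqrt (B $$ (0, 0))"
  have c2: "c * c = B $$ (0, 0)" using power2_csqrt[of "B $$ (0, 0)"] by (simp add: c_def power2_eq_square)
  have "Re c > 0"
  proof -
    have "Re c \<ge> 0" unfolding c_def using csqrt_principal[of "B $$ (0, 0)"] by linarith
    moreover have "Re c \<noteq> 0"
    proof
      assume "Re c = 0"
      then have "B $$ (0, 0) = - complex_of_real (Im c * Im c)" unfolding c2[symmetric] by (simp add: complex_eq_iff)
      then have "\<not> slit (B $$ (0, 0))" by (simp add: slit_def)
      then show False using Suc.prems(3)[of 0] by simp
    qed
    ultimately show ?thesis by simp
  qed
  define K where "K = c \<cdot>\<^sub>m 1\<^sub>m m + Y'"
  have K: "K \<in> carrier_mat m m" "upper_triangular K"
    using Y'(1) upper_triangularD[OF Y'(2)] by (auto simp: K_def intro!: upper_triangularI)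
  have "K $$ (i, i) \<noteq> 0" if "i < m" for i
  proof -
    have "Re (K $$ (i, i)) > 0" using Y' that \<open>Re c > 0\<close> by (simp add: K_def add_pos_pos)
    then show ?thesis by auto
  qed
  then have "det K \<noteq> 0" unfolding upper_triangular_imp_det_eq_0_iff[OF K] using K(1) by (auto simp: diag_mat_def)
  then obtain L where L: "L \<in> carrier_mat m m" "L * K = 1\<^sub>m m" using det_nonzero_inverse[OF K(1)] by blast
  define x where "x = r * L"
  have x: "x \<in> carrier_mat 1 m" using s L by (simp add: x_def)
  have xK: "c \<cdot>\<^sub>m x + x * Y' = r"
  proof -
    have "x * K = r" unfolding x_def using s L K by (simp add: mat_assoc mat_unit)
    moreover have "x * K = c \<cdot>\<^sub>m x + x * Y'" unfolding K_def using x Y' by (simp add: mat_dist mat_unit)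
    ultimately show ?thesis by simp
  qed
  define C where "C = mat 1 1 (\<lambda>_. c)"
  have Cc: "C \<in> carrier_mat 1 1" by (simp add: C_def)
  have CC: "C * C = b" 
  proof (rule eq_matI)
    fix i j assume "i < dim_row b" "j < dim_col b"
    then have "i = 0" "j = 0" using s by auto
    moreover have "B $$ (0, 0) = b $$ (0, 0)" using s by simp
    ultimately show "(C * C) $$ (i, j) = b $$ (i, j)" using c2 by (simp add: C_def scalar_prod_def)
  qed (use s in \<open>auto simp: C_def\<close>)
  have Cx: "C * x = c \<cdot>\<^sub>m x"
    by (rule eq_matI) (use x in \<open>auto simp: C_def scalar_prod_def\<close>)
  define Y where "Y = four_block_mat C x (0\<^sub>m m 1) Y'"
  have Yc: "Y \<in> carrier_mat (Suc m) (Suc m)" unfolding Y_def using Cc Y' by auto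
  have "Y * Y = B" unfolding Y_def s(5) z0 using s(1) Cc x Y' xK
    by (subst mult_four_block_mat[of _ 1 1 _ m _ m _ _ 1 _ m]) (auto simp: mat_unit mat_add_zero CC Cx)
  moreover have "upper_triangular Y" unfolding Y_def by (rule upper_triangular_four_block[of _ 1 _ m])
      (use Cc Y' in \<open>auto simp: C_def\<close>)
  moreover have "Re (Y $$ (i, i)) > 0" if "i < Suc m" for i
    using that Y' Cc \<open>Re c > 0\<close> unfolding Y_def by (cases i) (auto simp: C_def)
  ultimately show ?case using Yc by blast
qed

lemma schur_complex:
  assumes "A \<in> carrier_mat n n"
  obtains B P Q :: "complex mat" where "B \<in> carrier_mat n n" "P \<in> carrier_mat n n" "Q \<in> carrier_mat n n"
    "upper_triangular B" "P * Q = 1\<^sub>m n" "Q * P = 1\<^sub>m n" "A = P * B * Q"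
proof -
  obtain B where B: "B \<in> carrier_mat n n" "upper_triangular B" "similar_mat A B"
    using schur_decomposition_exists[OF assms] char_poly_factorized[OF assms] by blast
  then obtain P Q where "similar_mat_wit A B P Q" by (auto simp: similar_mat_def)
  from similar_mat_witD2[OF assms this] show ?thesis using that B by blast
qed

lemma eigenvalue_intertwine:
  assumes "A \<in> carrier_mat m m" "B \<in> carrier_mat k k" "S \<in> carrier_mat m k" "L \<in> carrier_mat k m"
    "A * S = S * B" "L * S = 1\<^sub>m k" "eigenvalue B (z :: complex)"
  shows "eigenvalue A z"
proof -
  obtain v where v: "v \<in> carrier_vec k" "v \<noteq> 0\<^sub>v k" "B *\<^sub>v v = z \<cdot>\<^sub>v v"
    using assms(2,7) by (auto simp: eigenvalue_def eigenvector_def)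
  have "A *\<^sub>v (S *\<^sub>v v) = (A * S) *\<^sub>v v" using assms(1,3) v by (simp add: mat_vec_assoc)
  also have "\<dots> = S *\<^sub>v (B *\<^sub>v v)" unfolding assms(5) using assms(2,3) v by (simp add: mat_vec_assoc)
  also have "\<dots> = z \<cdot>\<^sub>v (S *\<^sub>v v)" unfolding v(3) using assms(3) v by (simp add: mat_vec_smult)
  finally have e: "A *\<^sub>v (S *\<^sub>v v) = z \<cdot>\<^sub>v (S *\<^sub>v v)" .
  have "S *\<^sub>v v \<noteq> 0\<^sub>v m"
  proof
    assume a: "S *\<^sub>v v = 0\<^sub>v m"
    have "v = L *\<^sub>v (S *\<^sub>v v)" using assms(3,4,6) v by (simp add: mat_vec_assoc[symmetric] mat_one_vec)
    also have "\<dots> = 0\<^sub>v k" unfolding a using assms(4) by (simp add: mat_vec_zero)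
    finally show False using v by simp
  qed
  moreover have "S *\<^sub>v v \<in> carrier_vec m" using assms(3) v by auto
  ultimately show ?thesis using e assms(1) by (auto simp: eigenvalue_def eigenvector_def)
qed

lemma complex_sqrt_exists:
  assumes A: "A \<in> carrier_mat n n" and ev: "\<And>z. eigenvalue A z \<Longrightarrow> slit z"
  shows "\<exists>Y\<in>carrier_mat n n. Y * Y = A \<and> rhp Y"
proof -
  obtain B P Q where B: "B \<in> carrier_mat n n" "P \<in> carrier_mat n n" "Q \<in> carrier_mat n n"
    "upper_triangular B" "P * Q = 1\<^sub>m n" "Q * P = 1\<^sub>m n" "A = P * B * Q" using schur_complex[OF A] .
  have AP: "A * P = P * B" unfolding B(7) using B(1-3,6) by (simp add: mat_assoc mat_unit)
  have "slit (B $$ (i, i))" if "i < n" for i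
    using ev[OF eigenvalue_intertwine[OF A B(1,2,3) AP B(6)]] eigenvalue_upper_triangular[OF B(1,4)] that by blast
  then obtain Y where Y: "Y \<in> carrier_mat n n" "upper_triangular Y" "Y * Y = B" "\<forall>i<n. Re (Y $$ (i, i)) > 0"
    using upper_triangular_sqrt[OF B(1,4)] by blast
  have QP: "Q * (P * X) = X" if "dim_row X = n" for X
    using that B(2,3,6) by (simp add: mat_assoc[symmetric] mat_unit)
  have "(P * Y * Q) * (P * Y * Q) = P * ((Y * Y) * Q)" using B(1-3) Y(1) by (simp add: mat_assoc QP)
  then have sq: "(P * Y * Q) * (P * Y * Q) = A" unfolding Y(3) B(7) using B(1-3) by (simp add: mat_assoc)
  have "Re z > 0" if "eigenvalue (P * Y * Q) z" for z
  proof -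
    have "Y * Q = Q * (P * Y * Q)" using B(1-3) Y(1) by (simp add: mat_assoc QP)
    from eigenvalue_intertwine[OF Y(1) _ B(3,2) this B(5) that] have "eigenvalue Y z" using B Y by auto
    then show ?thesis using eigenvalue_upper_triangular[OF Y(1,2)] Y(4) by auto
  qed
  then have "rhp (P * Y * Q)" by (simp add: rhp_def)
  moreover have "P * Y * Q \<in> carrier_mat n n" using B Y by auto
  ultimately show ?thesis using sq by blast
qed

text \<open>The difference \<open>W = Y - Z\<close> satisfies \<open>Y W = - W Z\<close>. After triangularising \<open>Z\<close>, the first nonzero column
  of \<open>W\<close> would be an eigenvector of \<open>Y\<close> for the negative of an eigenvalue of \<open>Z\<close>, which has negative
  real part.\<close>

lemma complex_sqrt_unique:
  assumes Y: "Y \<in> carrier_mat n n" "rhp Y" and Z: "Z \<in> carrier_mat n n" "rhp Z" and eq: "Y * Y = Z * Z"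
  shows "Y = Z"
proof -
  obtain B P Q where B: "B \<in> carrier_mat n n" "P \<in> carrier_mat n n" "Q \<in> carrier_mat n n"
    "upper_triangular B" "P * Q = 1\<^sub>m n" "Q * P = 1\<^sub>m n" "Z = P * B * Q" using schur_complex[OF Z(1)] .
  have ZP: "Z * P = P * B" unfolding B(7) using B(1-3,6) by (simp add: mat_assoc mat_unit)
  define W where "W = (Y - Z) * P"
  have W: "W \<in> carrier_mat n n" unfolding W_def using Y(1) Z(1) B(2) by auto
  have "Y * (Y - Z) = - ((Y - Z) * Z)" using Y Z eq by (simp add: mat_dist) (rule eq_matI, auto simp del: index_mult_mat(1))
  then have "Y * W = - ((Y - Z) * (Z * P))" unfolding W_def using Y(1) Z(1) B(2) by (simp add: mat_assoc[symmetric] mat_uminus_left)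
  then have YW: "Y * W = - (W * B)" unfolding ZP W_def using Y(1) Z(1) B(1,2) by (simp add: mat_assoc)
  have "\<forall>i<n. W $$ (i, j) = 0" if "j < n" for j using that
  proof (induction j rule: less_induct)
    case (less j)
    have WB: "(W * B) $$ (i, j) = W $$ (i, j) * B $$ (j, j)" if i: "i < n" for i
    proof -
      have "(W * B) $$ (i, j) = (\<Sum>a = 0..<n. W $$ (i, a) * B $$ (a, j))" using W B i less.prems by (simp add: scalar_prod_def)
      also have "\<dots> = (\<Sum>a = 0..<n. if a = j then W $$ (i, j) * B $$ (j, j) else 0)"
      proof (rule sum.cong)
        fix a assume "a \<in> {0..<n}"
        then show "W $$ (i, a) * B $$ (a, j) = (if a = j then W $$ (i, j) * B $$ (j, j) else 0)"
          using less.IH[of a] less.prems i upper_triangularD[OF B(4), of j a] B(1) by (cases a j rule: linorder_cases) auto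
      qed simp
      finally show ?thesis using less.prems by simp
    qed
    have cw: "col W j \<in> carrier_vec n" using W by (auto intro: carrier_vecI)
    have "Y *\<^sub>v col W j = (- B $$ (j, j)) \<cdot>\<^sub>v col W j"
    proof (rule eq_vecI)
      fix i assume "i < dim_vec ((- B $$ (j, j)) \<cdot>\<^sub>v col W j)"
      then have i: "i < n" using W by simp
      have "(Y *\<^sub>v col W j) $ i = (Y * W) $$ (i, j)" using Y W i less.prems by simp
      also have "\<dots> = - (W * B) $$ (i, j)" unfolding YW using W B i less.prems by (simp del: index_mult_mat(1))
      finally show "(Y *\<^sub>v col W j) $ i = ((- B $$ (j, j)) \<cdot>\<^sub>v col W j) $ i" unfolding WB[OF i] using W i less.prems by simp
    qed (use Y W in auto)
    moreover have "eigenvalue Z (B $$ (j, j))"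
      by (rule eigenvalue_intertwine[OF Z(1) B(1,2,3) ZP B(6)]) (use eigenvalue_upper_triangular[OF B(1,4)] less.prems in blast)
    then have "\<not> eigenvalue Y (- B $$ (j, j))" using Y(2) Z(2) unfolding rhp_def by (metis add.inverse_inverse less_asym neg_0_less_iff_less uminus_complex.sel(1))
    ultimately have "col W j = 0\<^sub>v n" using cw Y(1) by (auto simp: eigenvalue_def eigenvector_def)
    then show ?case using W less.prems by (metis carrier_matD(1,2) index_col index_zero_vec(1))
  qed
  then have "W = 0\<^sub>m n n" using W by (intro eq_matI) auto
  then have "W * Q = 0\<^sub>m n n" using B(3) by (simp add: mat_unit)
  moreover have "W * Q = Y - Z" unfolding W_def using Y(1) Z(1) B(2,3,5) by (simp add: mat_assoc mat_unit)
  ultimately have yz: "Y - Z = 0\<^sub>m n n" by simp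
  show ?thesis
  proof (rule eq_matI)
    fix i j assume ij: "i < dim_row Z" "j < dim_col Z"
    then have "(Y - Z) $$ (i, j) = 0" unfolding yz using Z by simp
    then show "Y $$ (i, j) = Z $$ (i, j)" using Y Z ij by simp
  qed (use Y Z in auto)
qed

abbreviation cmat :: "real mat \<Rightarrow> complex mat" where "cmat \<equiv> map_mat complex_of_real"

lemma cmat_mult: "dim_col A = dim_row B \<Longrightarrow> cmat (A * B) = cmat A * cmat B"
  by (rule of_real_hom.mat_hom_mult[of _ "dim_row A" "dim_col A" _ "dim_col B"]) auto

lemma cmat_one: "cmat (1\<^sub>m n) = 1\<^sub>m n" by (rule of_real_hom.mat_hom_one)

lemma cmat_inj: "cmat A = cmat B \<Longrightarrow> A = B"
proof -
  assume e: "cmat A = cmat B"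
  then have d: "dim_row A = dim_row B" "dim_col A = dim_col B" by (metis index_map_mat(2,3))+
  show "A = B"
  proof (rule eq_matI)
    fix i j assume "i < dim_row B" "j < dim_col B"
    then show "A $$ (i, j) = B $$ (i, j)" using arg_cong[OF e, of "\<lambda>X. X $$ (i, j)"] d by simp
  qed (use d in auto)
qed

text \<open>The complex conjugate of the principal root is a root of the same kind, so by uniqueness the root
  is real.\<close>

lemma real_sqrt_exists:
  assumes A: "A \<in> carrier_mat n n" and ev: "\<And>z. eigenvalue (cmat A) z \<Longrightarrow> slit z"
  shows "\<exists>R\<in>carrier_mat n n. R * R = A \<and> rhp (cmat R)"
proof -
  have cA: "cmat A \<in> carrier_mat n n" using A by auto
  obtain Y where Y: "Y \<in> carrier_mat n n" "Y * Y = cmat A" "rhp Y" using complex_sqrt_exists[OF cA ev] by blast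
  define Z where "Z = map_mat cnj Y"
  have Z: "Z \<in> carrier_mat n n" using Y by (simp add: Z_def)
  have ZZ: "Z * Z = map_mat cnj (Y * Y)" unfolding Z_def using Y(1) by (intro eq_matI) (auto simp: scalar_prod_def)
  also have "\<dots> = Y * Y" unfolding Y(2) by (rule eq_matI) auto
  finally have "Y * Y = Z * Z" by simp
  moreover have "rhp Z" unfolding rhp_def
  proof (intro allI impI)
    fix z assume "eigenvalue Z z"
    then obtain v where v: "v \<in> carrier_vec n" "v \<noteq> 0\<^sub>v n" "Z *\<^sub>v v = z \<cdot>\<^sub>v v" using Z by (auto simp: eigenvalue_def eigenvector_def)
    let ?w = "map_vec cnj v"
    have "Y *\<^sub>v ?w = map_vec cnj (Z *\<^sub>v v)" unfolding Z_def using Y(1) v(1) by (intro eq_vecI) (auto simp: scalar_prod_def)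
    also have "\<dots> = cnj z \<cdot>\<^sub>v ?w" unfolding v(3) using v(1) by (intro eq_vecI) auto
    finally have "Y *\<^sub>v ?w = cnj z \<cdot>\<^sub>v ?w" .
    moreover have "?w \<noteq> 0\<^sub>v n"
    proof
      assume a: "?w = 0\<^sub>v n"
      have "v = 0\<^sub>v n"
      proof (rule eq_vecI)
        fix i assume "i < dim_vec (0\<^sub>v n :: complex vec)"
        then show "v $ i = 0\<^sub>v n $ i" using arg_cong[OF a, of "\<lambda>x. x $ i"] v(1) by simp
      qed (use v in auto)
      then show False using v by simp
    qed
    moreover have "?w \<in> carrier_vec n" using v by auto
    ultimately have "eigenvalue Y (cnj z)" using Y(1)
      unfolding eigenvalue_def eigenvector_def by (intro exI[of _ ?w]) simp
    then show "0 < Re z" using Y(3) unfolding rhp_def by fastforce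
  qed
  ultimately have YZ: "Y = Z" using complex_sqrt_unique[OF Y(1,3) Z] by blast
  define R where "R = map_mat Re Y"
  have R: "R \<in> carrier_mat n n" using Y by (simp add: R_def)
  have cR: "cmat R = Y"
  proof (rule eq_matI)
    fix i j assume ij: "i < dim_row Y" "j < dim_col Y"
    then have "Y $$ (i, j) = cnj (Y $$ (i, j))" using YZ by (metis Z_def index_map_mat(1))
    then have "Im (Y $$ (i, j)) = 0" by (simp add: complex_eq_iff)
    then show "cmat R $$ (i, j) = Y $$ (i, j)" using ij by (simp add: R_def complex_eq_iff)
  qed (auto simp: R_def)
  have "cmat (R * R) = cmat A" using R Y(2) cR by (simp add: cmat_mult)
  then have "R * R = A" by (rule cmat_inj)
  then show ?thesis using R Y(3) cR by auto
qed

lemma eigenvalue_transpose: "A \<in> carrier_mat n n \<Longrightarrow> eigenvalue (A\<^sup>T) z \<longleftrightarrow> eigenvalue A (z :: complex)"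
  using eigenvalue_root_char_poly[of A n z] eigenvalue_root_char_poly[of "A\<^sup>T" n z] char_poly_transpose_mat[of A n] by auto

lemma cspectrum_iff: "z \<in> cspectrum M \<longleftrightarrow> eigenvalue (cmat M) z"
  by (simp add: cspectrum_def spectrum_def)

lemma eigenvalue_sadj: assumes "R \<in> carrier_mat (2 * n) (2 * n)" "eigenvalue (cmat (sadj n n R)) z"
  shows "eigenvalue (cmat R) z"
proof -
  have J: "symp_form n * sadj n n R = R\<^sup>T * symp_form n"
    using assms by (simp add: sadj_def mat_dist mat_neg symp_form_square')
  have "cmat (R\<^sup>T) * cmat (symp_form n) = cmat (symp_form n) * cmat (sadj n n R)"
    using arg_cong[OF J, of cmat] assms by (simp add: cmat_mult)
  moreover have "cmat (- symp_form n) * cmat (symp_form n) = 1\<^sub>m (2 * n)"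
    by (simp add: cmat_mult[symmetric] mat_dist symp_form_square mat_neg cmat_one)
  ultimately have "eigenvalue (cmat (R\<^sup>T)) z"
    using assms by (intro eigenvalue_intertwine[of "cmat (R\<^sup>T)" "2 * n" "cmat (sadj n n R)" "2 * n" "cmat (symp_form n)" "cmat (- symp_form n)"]) auto
  moreover have "cmat (R\<^sup>T) = (cmat R)\<^sup>T" by (rule eq_matI) auto
  ultimately show ?thesis using eigenvalue_transpose[of "cmat R" "2 * n"] assms by simp
qed

lemma eigenvalue_inverse: assumes "A \<in> carrier_mat m m" "B \<in> carrier_mat m m" "A * B = 1\<^sub>m m" "eigenvalue B (z :: complex)"
  shows "z \<noteq> 0" "eigenvalue A (1 / z)"
proof -
  obtain v where v: "v \<in> carrier_vec m" "v \<noteq> 0\<^sub>v m" "B *\<^sub>v v = z \<cdot>\<^sub>v v" using assms by (auto simp: eigenvalue_def eigenvector_def)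
  have "v = A *\<^sub>v (B *\<^sub>v v)" using assms(1,2,3) v(1) by (simp add: mat_vec_assoc[symmetric] mat_one_vec)
  also have "\<dots> = z \<cdot>\<^sub>v (A *\<^sub>v v)" unfolding v(3) using assms(1) v(1) by (simp add: mat_vec_smult)
  finally have e: "v = z \<cdot>\<^sub>v (A *\<^sub>v v)" .
  show z: "z \<noteq> 0"
  proof
    assume "z = 0"
    then have "v = 0\<^sub>v m" by (subst e) (use assms(1) in \<open>auto intro!: eq_vecI\<close>)
    then show False using v by simp
  qed
  have "A *\<^sub>v v = (1 / z) \<cdot>\<^sub>v v" by (subst (2) e) (use z in \<open>auto intro!: eq_vecI\<close>)
  then show "eigenvalue A (1 / z)" using assms(1) v by (auto simp: eigenvalue_def eigenvector_def)
qed

text \<open>The inverse adjoint of the principal root \<open>R\<close> is again a root of \<open>M\<close> with spectrum in the right half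
  plane. By uniqueness it is \<open>R\<close>, which says that \<open>R\<close> is symplectic.\<close>

theorem symp_sqrt_no_negative:
  assumes M: "M \<in> Sp n" and ev: "cspectrum M \<inter> complex_of_real ` {..<0} = {}"
  shows "\<exists>X. symp_sqrt n M X"
proof -
  note c = Sp_carrier[OF M]
  have "slit z" if "eigenvalue (cmat M) z" for z
  proof (rule ccontr)
    assume "\<not> slit z"
    then obtain x where x: "z = complex_of_real x" "x \<le> 0" by (auto simp: slit_def complex_eq_iff)
    have "cmat (sadj n n M) * cmat M = 1\<^sub>m (2 * n)"
      using c by (simp add: cmat_mult[symmetric] Sp_sadj_left[OF M] cmat_one)
    from eigenvalue_inverse(1)[OF _ _ this that] c have "z \<noteq> 0" by auto
    then have "x < 0" using x by auto
    then show False using ev that x(1) cspectrum_iff by auto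
  qed
  then obtain R where R: "R \<in> carrier_mat (2 * n) (2 * n)" "R * R = M" "rhp (cmat R)" using real_sqrt_exists[OF c] by blast
  let ?M = "sadj n n M"
  define S where "S = R * ?M"
  have S: "S \<in> carrier_mat (2 * n) (2 * n)" unfolding S_def using R by (auto intro!: carrier_matI)
  have RS: "R * S = 1\<^sub>m (2 * n)" unfolding S_def using R by (simp add: mat_assoc[symmetric] Sp_sadj_right[OF M])
  have SR: "S * R = 1\<^sub>m (2 * n)" by (rule mat_mult_left_right_inverse[OF R(1) S RS])
  have "M * (S * S) = (R * (R * S)) * S" using R S unfolding R(2)[symmetric] by (simp add: mat_assoc)
  also have "\<dots> = 1\<^sub>m (2 * n)" using R S RS by (simp add: mat_unit)
  finally have "?M * (M * (S * S)) = ?M" by (simp add: mat_unit)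
  then have SS: "S * S = ?M" using S Sp_cancel(2)[OF M, of "S * S"] by simp
  \<comment> \<open>\<open>S\<close> is the inverse of \<open>R\<close>\<close>
  define R' where "R' = sadj n n S"
  have R': "R' \<in> carrier_mat (2 * n) (2 * n)" by (simp add: R'_def)
  have "R' * R' = sadj n n (S * S)" unfolding R'_def by (rule sadj_mult[OF S S, symmetric])
  then have R'2: "R' * R' = M" unfolding SS by (simp add: sadj_sadj[OF c])
  have "rhp (cmat R')" unfolding rhp_def
  proof (intro allI impI)
    fix z assume z: "eigenvalue (cmat R') z"
    have "eigenvalue (cmat S) z" by (rule eigenvalue_sadj[OF S z[unfolded R'_def]])
    moreover have "cmat R * cmat S = 1\<^sub>m (2 * n)" using R S by (simp add: cmat_mult[symmetric] RS cmat_one)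
    ultimately have "z \<noteq> 0" "eigenvalue (cmat R) (1 / z)" using eigenvalue_inverse[of "cmat R" "2 * n" "cmat S" z] R S by auto
    then have "Re (1 / z) > 0" using R(3) unfolding rhp_def by blast
    then show "Re z > 0" by (auto simp: Re_divide zero_less_divide_iff not_sum_power2_lt_zero split: if_splits)
  qed
  moreover have "cmat R * cmat R = cmat R' * cmat R'" using R R' R'2 by (simp add: cmat_mult[symmetric])
  ultimately have "cmat R = cmat R'" using complex_sqrt_unique[of "cmat R" "2 * n" "cmat R'"] R R' by auto
  then have RR: "R = R'" by (rule cmat_inj)
  have "sadj n n (R * S) = 1\<^sub>m (2 * n)" unfolding RS by (rule sadj_one)
  then have "sadj n n S * sadj n n R = 1\<^sub>m (2 * n)" using sadj_mult[OF R(1) S] by simp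
  then have "R * sadj n n R = 1\<^sub>m (2 * n)" using RR R'_def by simp
  then have "sadj n n R * R = 1\<^sub>m (2 * n)" by (rule mat_mult_left_right_inverse[OF R(1) sadj_carrier])
  then have "R \<in> Sp n" using R(1) by (simp add: Sp_iff_semb semb_iff_sadj)
  then show ?thesis using R(2) by (auto simp: symp_sqrt_def)
qed

section \<open>Spectra\<close>

lemma cspectrum_intertwine:
  assumes "A \<in> carrier_mat (2 * m) (2 * m)" "B \<in> carrier_mat (2 * k) (2 * k)" "S \<in> carrier_mat (2 * m) (2 * k)"
    "L \<in> carrier_mat (2 * k) (2 * m)" "A * S = S * B" "L * S = 1\<^sub>m (2 * k)"
  shows "cspectrum B \<subseteq> cspectrum A"
proof
  fix z assume "z \<in> cspectrum B"
  then have "eigenvalue (cmat B) z" by (simp add: cspectrum_iff)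
  moreover have "cmat A * cmat S = cmat S * cmat B" using assms by (simp add: cmat_mult[symmetric])
  moreover have "cmat L * cmat S = 1\<^sub>m (2 * k)" using assms by (simp add: cmat_mult[symmetric] cmat_one)
  ultimately have "eigenvalue (cmat A) z"
    using assms(1-4) by (intro eigenvalue_intertwine[of "cmat A" "2 * m" "cmat B" "2 * k" "cmat S" "cmat L"]) auto
  then show "z \<in> cspectrum A" by (simp add: cspectrum_iff)
qed

lemma cspectrum_similar: assumes "symp_similar n M N" shows "cspectrum M = cspectrum N"
proof -
  have *: "cspectrum M \<subseteq> cspectrum N" if s: "symp_similar n M N" for M N
  proof -
    obtain P where P: "P \<in> Sp n" "P * M = N * P" and c: "M \<in> carrier_mat (2 * n) (2 * n)" "N \<in> carrier_mat (2 * n) (2 * n)"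
      using symp_similarE[OF s] .
    show ?thesis by (rule cspectrum_intertwine[OF c(2,1) Sp_carrier[OF P(1)] sadj_carrier P(2)[symmetric] Sp_sadj_left[OF P(1)]])
  qed
  show ?thesis using *[OF assms] *[OF symp_similar_sym[OF assms]] by blast
qed

lemma cspectrum_diamond:
  assumes M: "M \<in> carrier_mat (2 * m) (2 * m)" and N: "N \<in> carrier_mat (2 * k) (2 * k)"
  shows "cspectrum (M \<diamond> N) = cspectrum M \<union> cspectrum N"
proof
  let ?L = "emb_left m k" and ?R = "emb_right m k" and ?D = "M \<diamond> N"
  have D: "?D \<in> carrier_mat (2 * (m + k)) (2 * (m + k))" using M N by (rule diamond_carrier)
  have DL: "?D * ?L = ?L * M" "?D * ?R = ?R * N"
    unfolding diamond_eq[OF M N] using M N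
    by (simp_all add: mat_dist mat_assoc emb_orthonormal mat_unit mat_add_zero)
  have "cspectrum M \<subseteq> cspectrum ?D"
    by (rule cspectrum_intertwine[OF D M emb_carrier(1) _ DL(1) emb_orthonormal(1)]) (auto intro!: carrier_matI)
  moreover have "cspectrum N \<subseteq> cspectrum ?D"
    by (rule cspectrum_intertwine[OF D N emb_carrier(2) _ DL(2) emb_orthonormal(4)]) (auto intro!: carrier_matI)
  ultimately show "cspectrum M \<union> cspectrum N \<subseteq> cspectrum ?D" by simp
  have LD: "?L\<^sup>T * ?D = M * ?L\<^sup>T" "?R\<^sup>T * ?D = N * ?R\<^sup>T"
    unfolding diamond_eq[OF M N] using M N
    by (simp_all add: mat_dist mat_assoc emb_cancel mat_unit mat_add_zero)
  show "cspectrum ?D \<subseteq> cspectrum M \<union> cspectrum N"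
  proof
    fix z assume "z \<in> cspectrum ?D"
    then obtain v where v: "v \<in> carrier_vec (2 * (m + k))" "v \<noteq> 0\<^sub>v (2 * (m + k))" "cmat ?D *\<^sub>v v = z \<cdot>\<^sub>v v"
      using D by (auto simp: cspectrum_iff eigenvalue_def eigenvector_def)
    have sub: "eigenvalue (cmat A) z" if A: "A \<in> carrier_mat r r" and S: "S \<in> carrier_mat r (2 * (m + k))" and AS: "S * ?D = A * S"
      and nz: "cmat S *\<^sub>v v \<noteq> 0\<^sub>v r" for A S r
    proof -
      have "cmat A *\<^sub>v (cmat S *\<^sub>v v) = cmat (A * S) *\<^sub>v v" using A S v(1) by (simp add: cmat_mult mat_vec_assoc)
      also have "\<dots> = cmat S *\<^sub>v (cmat ?D *\<^sub>v v)" unfolding AS[symmetric] using D S v(1) by (simp add: cmat_mult mat_vec_assoc del: distrib_left_numeral)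
      also have "\<dots> = z \<cdot>\<^sub>v (cmat S *\<^sub>v v)" unfolding v(3) using S v(1) by (simp add: mat_vec_smult del: distrib_left_numeral)
      finally have e: "cmat A *\<^sub>v (cmat S *\<^sub>v v) = z \<cdot>\<^sub>v (cmat S *\<^sub>v v)" .
      show ?thesis unfolding eigenvalue_def eigenvector_def
        by (intro exI[of _ "cmat S *\<^sub>v v"]) (use e nz A S in \<open>auto intro!: carrier_vecI\<close>)
    qed
    have id: "v = cmat ?L *\<^sub>v (cmat (?L\<^sup>T) *\<^sub>v v) + cmat ?R *\<^sub>v (cmat (?R\<^sup>T) *\<^sub>v v)"
    proof -
      have "v = cmat (?L * ?L\<^sup>T + ?R * ?R\<^sup>T) *\<^sub>v v" unfolding emb_complete using v(1) by (simp add: cmat_one mat_one_vec)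
      also have "cmat (?L * ?L\<^sup>T + ?R * ?R\<^sup>T) = cmat ?L * cmat (?L\<^sup>T) + cmat ?R * cmat (?R\<^sup>T)"
        by (simp add: cmat_mult[symmetric]) (rule eq_matI, auto simp del: index_mult_mat(1))
      finally show ?thesis using v(1) by (simp add: mat_add_vec mat_vec_assoc)
    qed
    have tc: "?L\<^sup>T \<in> carrier_mat (2 * m) (2 * (m + k))" "?R\<^sup>T \<in> carrier_mat (2 * k) (2 * (m + k))"
      by (rule carrier_matI; simp)+
    have "cmat (?L\<^sup>T) *\<^sub>v v \<noteq> 0\<^sub>v (2 * m) \<or> cmat (?R\<^sup>T) *\<^sub>v v \<noteq> 0\<^sub>v (2 * k)"
    proof (rule ccontr)
      assume "\<not> ?thesis"
      then have "v = cmat ?L *\<^sub>v 0\<^sub>v (2 * m) + cmat ?R *\<^sub>v 0\<^sub>v (2 * k)" using id by simp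
      then have "v = 0\<^sub>v (2 * (m + k))" by (simp add: mat_vec_zero)
      then show False using v(2) by simp
    qed
    then show "z \<in> cspectrum M \<union> cspectrum N"
    proof
      assume "cmat (?L\<^sup>T) *\<^sub>v v \<noteq> 0\<^sub>v (2 * m)"
      from sub[OF M tc(1) LD(1) this] have "eigenvalue (cmat M) z" .
      then show ?thesis by (simp add: cspectrum_iff)
    next
      assume "cmat (?R\<^sup>T) *\<^sub>v v \<noteq> 0\<^sub>v (2 * k)"
      from sub[OF N tc(2) LD(2) this] have "eigenvalue (cmat N) z" .
      then show ?thesis by (simp add: cspectrum_iff)
    qed
  qed
qed

lemma cspectrum_empty: "cspectrum (0\<^sub>m 0 0) = {}"
proof -
  have "v = 0\<^sub>v 0" if "v \<in> carrier_vec 0" for v :: "complex vec" using that by (intro eq_vecI) auto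
  then show ?thesis by (auto simp: cspectrum_iff eigenvalue_def eigenvector_def)
qed

lemma cspectrum_inverse: assumes M: "M \<in> Sp n" and z: "z \<in> cspectrum M" shows "z \<noteq> 0" "1 / z \<in> cspectrum M"
proof -
  note c = Sp_carrier[OF M]
  have 1: "cmat (sadj n n M) * cmat M = 1\<^sub>m (2 * n)"
    using c by (simp add: cmat_mult[symmetric] Sp_sadj_left[OF M] cmat_one)
  have m: "cmat (sadj n n M) \<in> carrier_mat (2 * n) (2 * n)" "cmat M \<in> carrier_mat (2 * n) (2 * n)" using c by auto
  from eigenvalue_inverse[OF m 1] z show "z \<noteq> 0" "1 / z \<in> cspectrum M"
    using eigenvalue_sadj[OF c] by (auto simp: cspectrum_iff)
qed

lemma real_eigenvalue: assumes "M \<in> carrier_mat n n" "complex_of_real l \<in> cspectrum M" shows "eigenvalue M l"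
proof -
  have "poly (char_poly (cmat M)) (complex_of_real l) = 0"
    using assms eigenvalue_root_char_poly[of "cmat M" n] by (simp add: cspectrum_iff)
  then have "complex_of_real (poly (char_poly M) l) = 0" by (simp add: of_real_hom.char_poly_hom[OF assms(1)])
  then show ?thesis using eigenvalue_root_char_poly[OF assms(1)] by simp
qed

text \<open>\<open>W + W\<^sup>-\<^sup>1\<close> is block diagonal with blocks \<open>2 A\<close> and \<open>2 A\<^sup>T\<close>.\<close>

lemma cspectrum_wblock:
  assumes rel: "wonenburger_rel k A B C" and z: "z \<in> cspectrum (wblock A B C)"
  shows "z \<noteq> 0" "eigenvalue (cmat A) ((z + 1 / z) / 2)"
proof -
  let ?W = "wblock A B C" and ?\<mu> = "(z + 1 / z) / 2"
  have W: "?W \<in> Sp k" by (rule wblock_Sp[OF rel])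
  note c = Sp_carrier[OF W]
  have A: "A \<in> carrier_mat k k" using rel by (simp add: wonenburger_rel_def)
  show z0: "z \<noteq> 0" using cspectrum_inverse(1)[OF W z] .
  obtain v where v: "v \<in> carrier_vec (2 * k)" "v \<noteq> 0\<^sub>v (2 * k)" "cmat ?W *\<^sub>v v = z \<cdot>\<^sub>v v"
    using z c by (auto simp: cspectrum_iff eigenvalue_def eigenvector_def)
  let ?V = "sadj k k ?W"
  have VW: "cmat ?V * cmat ?W = 1\<^sub>m (2 * k)" using c by (simp add: cmat_mult[symmetric] Sp_sadj_left[OF W] cmat_one)
  have "v = cmat ?V *\<^sub>v (cmat ?W *\<^sub>v v)" using VW c v(1) by (simp add: mat_vec_assoc[symmetric] mat_one_vec)
  also have "\<dots> = z \<cdot>\<^sub>v (cmat ?V *\<^sub>v v)" unfolding v(3) using v(1) by (simp add: mat_vec_smult)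
  finally have e: "v = z \<cdot>\<^sub>v (cmat ?V *\<^sub>v v)" .
  have Vv: "cmat ?V *\<^sub>v v = (1 / z) \<cdot>\<^sub>v v" by (subst (2) e) (use z0 in \<open>auto intro!: eq_vecI\<close>)
  let ?T = "sym_part k ?W"
  have cT: "cmat ?T = (1 / 2) \<cdot>\<^sub>m (cmat ?W + cmat ?V)" unfolding sym_part_def using c by (intro eq_matI) auto
  have Tv: "cmat ?T *\<^sub>v v = ?\<mu> \<cdot>\<^sub>v v"
    unfolding cT using c v(1) by (simp add: mat_smult_vec mat_add_vec v(3) Vv) (rule eq_vecI, auto simp: field_simps)
  have T: "?T = low_emb k * (A * (low_emb k)\<^sup>T) + high_emb k * (A\<^sup>T * (high_emb k)\<^sup>T)"
    unfolding sym_part_wblock[OF rel] using A by (subst four_block_mat_low_high[of _ k]) (auto simp: mat_unit mat_add_zero)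
  have LT: "(low_emb k)\<^sup>T * ?T = A * (low_emb k)\<^sup>T"
    "(high_emb k)\<^sup>T * ?T = A\<^sup>T * (high_emb k)\<^sup>T"
    unfolding T using A by (simp_all add: mat_dist low_high_cancel mat_unit mat_add_zero)
  have id: "low_emb k * (low_emb k)\<^sup>T + high_emb k * (high_emb k)\<^sup>T = 1\<^sub>m (2 * k)"
  proof -
    have "four_block_mat (1\<^sub>m k) (0\<^sub>m k k) (0\<^sub>m k k) (1\<^sub>m k) = (1\<^sub>m (2 * k) :: real mat)" by (rule eq_matI) auto
    then show ?thesis by (subst (asm) four_block_mat_low_high[of _ k]) (auto simp: mat_unit mat_add_zero)
  qed
  have sub: "eigenvalue (cmat Z) ?\<mu>" if Z: "Z \<in> carrier_mat k k" and S: "S \<in> carrier_mat k (2 * k)" and AS: "S * ?T = Z * S"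
    and nz: "cmat S *\<^sub>v v \<noteq> 0\<^sub>v k" for Z S
  proof -
    have "cmat Z *\<^sub>v (cmat S *\<^sub>v v) = cmat (Z * S) *\<^sub>v v" using Z S v(1) by (simp add: cmat_mult mat_vec_assoc)
    also have "\<dots> = cmat S *\<^sub>v (cmat ?T *\<^sub>v v)" unfolding AS[symmetric] using S v(1) by (simp add: cmat_mult mat_vec_assoc)
    also have "\<dots> = ?\<mu> \<cdot>\<^sub>v (cmat S *\<^sub>v v)" unfolding Tv using S v(1) by (simp add: mat_vec_smult)
    finally have e: "cmat Z *\<^sub>v (cmat S *\<^sub>v v) = ?\<mu> \<cdot>\<^sub>v (cmat S *\<^sub>v v)" .
    show ?thesis unfolding eigenvalue_def eigenvector_def
      by (intro exI[of _ "cmat S *\<^sub>v v"]) (use e nz Z S in \<open>auto intro!: carrier_vecI\<close>)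
  qed
  have idv: "v = cmat (low_emb k) *\<^sub>v (cmat ((low_emb k)\<^sup>T) *\<^sub>v v) + cmat (high_emb k) *\<^sub>v (cmat ((high_emb k)\<^sup>T) *\<^sub>v v)"
  proof -
    have "v = cmat (low_emb k * (low_emb k)\<^sup>T + high_emb k * (high_emb k)\<^sup>T) *\<^sub>v v" unfolding id using v(1) by (simp add: cmat_one mat_one_vec)
    also have "cmat (low_emb k * (low_emb k)\<^sup>T + high_emb k * (high_emb k)\<^sup>T)
      = cmat (low_emb k) * cmat ((low_emb k)\<^sup>T) + cmat (high_emb k) * cmat ((high_emb k)\<^sup>T)"
      by (simp add: cmat_mult[symmetric]) (rule eq_matI, auto simp del: index_mult_mat(1))
    finally show ?thesis using v(1) by (simp add: mat_add_vec mat_vec_assoc)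
  qed
  have "cmat ((low_emb k)\<^sup>T) *\<^sub>v v \<noteq> 0\<^sub>v k \<or> cmat ((high_emb k)\<^sup>T) *\<^sub>v v \<noteq> 0\<^sub>v k"
  proof (rule ccontr)
    assume "\<not> ?thesis"
    then have "v = cmat (low_emb k) *\<^sub>v 0\<^sub>v k + cmat (high_emb k) *\<^sub>v 0\<^sub>v k" using idv by simp
    then have "v = 0\<^sub>v (2 * k)" by (simp add: mat_vec_zero)
    then show False using v(2) by simp
  qed
  moreover have lh: "(low_emb k)\<^sup>T \<in> carrier_mat k (2 * k)" "(high_emb k)\<^sup>T \<in> carrier_mat k (2 * k)"
    by (rule carrier_matI; simp)+
  ultimately show "eigenvalue (cmat A) ?\<mu>"
  proof (elim disjE)
    assume "cmat ((low_emb k)\<^sup>T) *\<^sub>v v \<noteq> 0\<^sub>v k"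
    then show ?thesis by (rule sub[OF A lh(1) LT(1)])
  next
    assume "cmat ((high_emb k)\<^sup>T) *\<^sub>v v \<noteq> 0\<^sub>v k"
    from sub[OF _ lh(2) LT(2) this] have "eigenvalue (cmat (A\<^sup>T)) ?\<mu>" using A by simp
    moreover have "cmat (A\<^sup>T) = (cmat A)\<^sup>T" by (rule eq_matI) auto
    ultimately show ?thesis using eigenvalue_transpose[of "cmat A" k] A by simp
  qed
qed

lemma joukowsky_eq: assumes "z \<noteq> 0" "l \<noteq> 0" "(z + 1 / z) / 2 = complex_of_real ((l + 1 / l) / 2)"
  shows "z \<in> {complex_of_real l, complex_of_real (inverse l)}"
proof -
  have "(z + 1 / z) / 2 = (l + 1 / complex_of_real l) / 2" using assms(3) by simp
  then have eq: "z + 1 / z = l + 1 / complex_of_real l" unfolding divide_cancel_right by simp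
  have "(z - l) * (z - 1 / complex_of_real l) = z * ((z + 1 / z) - (l + 1 / complex_of_real l))"
    using assms(1,2) by (simp add: field_simps)
  also have "\<dots> = 0" unfolding eq by simp
  finally show ?thesis by (auto simp: inverse_eq_divide)
qed

lemma cspectrum_wblock_triangular:
  assumes rel: "wonenburger_rel k A B C" and A: "upper_triangular A" "\<And>i. i < k \<Longrightarrow> A $$ (i, i) = (l + 1 / l) / 2" and l: "l \<noteq> 0"
  shows "cspectrum (wblock A B C) \<subseteq> {complex_of_real l, complex_of_real (inverse l)}"
proof
  fix z assume z: "z \<in> cspectrum (wblock A B C)"
  note e = cspectrum_wblock[OF rel z]
  have c: "A \<in> carrier_mat k k" using rel by (simp add: wonenburger_rel_def)
  have ut: "upper_triangular (cmat A)" using upper_triangularD[OF A(1)] c by (intro upper_triangularI) auto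
  have "cmat A \<in> carrier_mat k k" using c by simp
  from eigenvalue_upper_triangular[OF this ut] e(2) c obtain i where "i < k" "(z + 1 / z) / 2 = complex_of_real (A $$ (i, i))"
    by auto
  then show "z \<in> {complex_of_real l, complex_of_real (inverse l)}" using joukowsky_eq[OF e(1) l] A(2) by simp
qed

lemma wnf_cspectrum: assumes "s * s = 1" "l \<noteq> 0"
  shows "cspectrum (wnf k s ((l + 1 / l) / 2)) \<subseteq> {complex_of_real l, complex_of_real (inverse l)}"
  unfolding wnf_def
  by (rule cspectrum_wblock_triangular[OF wnf_rel[OF assms(1)] _ _ assms(2)]) (auto intro!: upper_triangularI)

lemma even_summand_cspectrum: "even_summand E \<Longrightarrow> cspectrum E \<subseteq> {- 1}"
proof -
  assume "even_summand E"
  then obtain m s D where r: "wonenburger_rel m (jordan_block m (- 1)) (s \<cdot>\<^sub>m antidiag_mat m) D"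
    "E = wblock (jordan_block m (- 1)) (s \<cdot>\<^sub>m antidiag_mat m) D" by (auto simp: even_summand_def)
  have "upper_triangular (jordan_block m (- 1) :: real mat)" by (intro upper_triangularI) auto
  then show ?thesis using cspectrum_wblock_triangular[OF r(1), of "- 1"] r(2) by auto
qed

lemma odd_summand_cspectrum: "odd_summand G \<Longrightarrow> cspectrum G \<subseteq> {- 1}"
proof -
  assume "odd_summand G"
  then obtain l t C where r: "wonenburger_rel (2 * l + 1) (odd_A l) (odd_B l t) C" "G = wblock (odd_A l) (odd_B l t) C"
    by (auto simp: odd_summand_def)
  have "upper_triangular (odd_A l)" by (intro upper_triangularI) (auto simp: odd_A_index)
  then show ?thesis using cspectrum_wblock_triangular[OF r(1), of "- 1"] r(2) by (auto simp: odd_A_index)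
qed

section \<open>Assembling the normal form\<close>

text \<open>The size of a symplectic matrix is determined by the matrix. Leaving it out makes \<open>\<diamond>\<close> an
  associative operation with unit that is commutative up to \<open>sim\<close>.\<close>

definition is_Sp :: "real mat \<Rightarrow> bool" where "is_Sp M \<longleftrightarrow> (\<exists>n. M \<in> Sp n)"

definition sim :: "real mat \<Rightarrow> real mat \<Rightarrow> bool" where
  "sim M N \<longleftrightarrow> (\<exists>n. M \<in> Sp n \<and> symp_similar n M N)"

lemma Sp_unique: "M \<in> Sp n \<Longrightarrow> M \<in> carrier_mat (2 * m) (2 * m) \<Longrightarrow> m = n"
  using Sp_carrier[of M n] by auto

lemma is_SpI: "M \<in> Sp n \<Longrightarrow> is_Sp M" by (auto simp: is_Sp_def)

lemma is_Sp_zero [simp]: "is_Sp (0\<^sub>m 0 0)" using Sp_zero is_SpI by blast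

lemma is_Sp_diamond [simp]: "is_Sp M \<Longrightarrow> is_Sp N \<Longrightarrow> is_Sp (M \<diamond> N)"
  unfolding is_Sp_def using diamond_Sp by blast

lemma sim_refl: "is_Sp M \<Longrightarrow> sim M M"
  unfolding sim_def is_Sp_def using symp_similar_refl Sp_carrier by blast

lemma sim_trans [trans]: "sim L M \<Longrightarrow> sim M N \<Longrightarrow> sim L N"
proof -
  assume "sim L M" "sim M N"
  then obtain n m where 1: "L \<in> Sp n" "symp_similar n L M" and 2: "M \<in> Sp m" "symp_similar m M N" unfolding sim_def by blast
  have "n = m" using Sp_unique[OF 2(1)] symp_similar_carrier[OF 1(2)] by blast
  then show ?thesis using 1 2 symp_similar_trans unfolding sim_def by blast
qed

lemma sim_diamond: "sim M M' \<Longrightarrow> sim N N' \<Longrightarrow> sim (M \<diamond> N) (M' \<diamond> N')"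
  unfolding sim_def using symp_similar_diamond diamond_Sp by blast

lemma sim_commute: "is_Sp M \<Longrightarrow> is_Sp N \<Longrightarrow> sim (M \<diamond> N) (N \<diamond> M)"
  unfolding sim_def is_Sp_def using diamond_commute diamond_Sp Sp_carrier by blast

lemma is_Sp_assoc: "is_Sp L \<Longrightarrow> is_Sp M \<Longrightarrow> is_Sp N \<Longrightarrow> L \<diamond> M \<diamond> N = L \<diamond> (M \<diamond> N)"
  unfolding is_Sp_def using diamond_assoc Sp_carrier by blast

lemma is_Sp_zero_unit [simp]: "is_Sp M \<Longrightarrow> 0\<^sub>m 0 0 \<diamond> M = M" "is_Sp M \<Longrightarrow> M \<diamond> 0\<^sub>m 0 0 = M"
  unfolding is_Sp_def using diamond_zero_left diamond_zero_right Sp_carrier by blast+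

lemma sim_left_commute: assumes "is_Sp A" "is_Sp B" "is_Sp C" shows "sim (A \<diamond> (B \<diamond> C)) (B \<diamond> (A \<diamond> C))"
  using sim_diamond[OF sim_commute[OF assms(1,2)] sim_refl[OF assms(3)]] assms by (simp add: is_Sp_assoc)

lemma sim_interchange: assumes "is_Sp A" "is_Sp A'" "is_Sp B" "is_Sp B'"
  shows "sim ((A \<diamond> A') \<diamond> (B \<diamond> B')) ((A \<diamond> B) \<diamond> (A' \<diamond> B'))"
  using sim_diamond[OF sim_refl[OF assms(1)] sim_left_commute[OF assms(2-4)]] assms by (simp add: is_Sp_assoc)

lemma cspectrum_sim: "sim M N \<Longrightarrow> cspectrum M = cspectrum N"
  unfolding sim_def using cspectrum_similar by blast

lemma cspectrum_is_Sp_diamond: "is_Sp M \<Longrightarrow> is_Sp N \<Longrightarrow> cspectrum (M \<diamond> N) = cspectrum M \<union> cspectrum N"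
  unfolding is_Sp_def using cspectrum_diamond Sp_carrier by blast

lemma diamond_sum_Nil [simp]: "diamond_sum [] = 0\<^sub>m 0 0" by (simp add: diamond_sum_def)

lemma diamond_sum_Cons [simp]: "diamond_sum (M # Ms) = M \<diamond> diamond_sum Ms" by (simp add: diamond_sum_def)

lemma is_Sp_diamond_sum: "(\<And>M. M \<in> set Ms \<Longrightarrow> is_Sp M) \<Longrightarrow> is_Sp (diamond_sum Ms)"
  by (induction Ms) auto

lemma cspectrum_diamond_sum: "(\<And>M. M \<in> set Ms \<Longrightarrow> is_Sp M) \<Longrightarrow> cspectrum (diamond_sum Ms) = (\<Union>M\<in>set Ms. cspectrum M)"
  by (induction Ms) (auto simp: cspectrum_empty cspectrum_is_Sp_diamond is_Sp_diamond_sum)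

lemma sim_diamond_sum: "(\<And>l. l \<in> set ls \<Longrightarrow> sim (F l) (F' l)) \<Longrightarrow> sim (diamond_sum (map F ls)) (diamond_sum (map F' ls))"
  by (induction ls) (auto simp: sim_refl sim_diamond)

text \<open>A summand is moved past the others to the position of \<open>l\<close>.\<close>

lemma sim_absorb:
  "distinct ls \<Longrightarrow> l \<in> set ls \<Longrightarrow> is_Sp K \<Longrightarrow> (\<And>l. l \<in> set ls \<Longrightarrow> is_Sp (F l)) \<Longrightarrow>
    sim (K \<diamond> diamond_sum (map F ls)) (diamond_sum (map (F(l := K \<diamond> F l)) ls))"
proof (induction ls)
  case (Cons a as)
  have R: "is_Sp (diamond_sum (map F as))" using Cons.prems(4) by (intro is_Sp_diamond_sum) auto
  have a: "is_Sp (F a)" using Cons.prems(4) by simp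
  show ?case
  proof (cases "a = l")
    case True
    have m: "map (F(l := K \<diamond> F l)) as = map F as" using Cons.prems(1) True by auto
    then have e: "diamond_sum (map (F(l := K \<diamond> F l)) (a # as)) = K \<diamond> diamond_sum (map F (a # as))"
      unfolding list.map diamond_sum_Cons m using True Cons.prems(3) a R by (simp add: is_Sp_assoc)
    show ?thesis unfolding e by (rule sim_refl) (use Cons.prems(3) a R in simp)
  next
    case False
    have "sim (K \<diamond> (F a \<diamond> diamond_sum (map F as))) (F a \<diamond> (K \<diamond> diamond_sum (map F as)))"
      by (rule sim_left_commute[OF Cons.prems(3) a R])
    also have "sim \<dots> (F a \<diamond> diamond_sum (map (F(l := K \<diamond> F l)) as))"
      by (rule sim_diamond[OF sim_refl[OF a] Cons.IH]) (use Cons.prems False in auto)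
    finally show ?thesis using False by (simp add: fun_upd_def)
  qed
qed simp

definition has_root :: "real mat \<Rightarrow> bool" where "has_root M \<longleftrightarrow> (\<exists>n X. symp_sqrt n M X)"

lemma has_root_sim: assumes "sim M N" "has_root N" shows "has_root M"
proof -
  obtain n where n: "symp_similar n M N" using assms(1) by (auto simp: sim_def)
  obtain m Y where Y: "symp_sqrt m N Y" using assms(2) by (auto simp: has_root_def)
  then have "N \<in> Sp m" using Sp_mult by (auto simp: symp_sqrt_def)
  then have "n = m" using Sp_unique symp_similar_carrier[OF n] by blast
  then show ?thesis using symp_sqrt_similar[OF n] Y unfolding has_root_def by blast
qed

lemma has_root_diamond: assumes "has_root M" "has_root N" shows "has_root (M \<diamond> N)"
proof -
  obtain m X k Y where "X \<in> Sp m" "X * X = M" "Y \<in> Sp k" "Y * Y = N"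
    using assms by (auto simp: has_root_def symp_sqrt_def)
  then have "symp_sqrt (m + k) (M \<diamond> N) (X \<diamond> Y)"
    using diamond_mult[of X m Y k X Y] diamond_Sp Sp_carrier by (auto simp: symp_sqrt_def)
  then show ?thesis unfolding has_root_def by blast
qed

lemma has_root_zero: "has_root (0\<^sub>m 0 0)"
  unfolding has_root_def symp_sqrt_def using Sp_zero by (intro exI[of _ 0] exI[of _ "0\<^sub>m 0 0"]) (auto intro!: eq_matI)

lemma has_root_diamond_sum: "(\<And>M. M \<in> set Ms \<Longrightarrow> has_root M) \<Longrightarrow> has_root (diamond_sum Ms)"
  by (induction Ms) (auto simp: has_root_zero has_root_diamond)

lemma has_root_double: assumes "is_Sp N" shows "has_root (N \<diamond> N)"
proof -
  obtain k where "N \<in> Sp k" using assms by (auto simp: is_Sp_def)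
  then have "symp_sqrt (k + k) (N \<diamond> N) (swap_root k N)"
    by (simp add: symp_sqrt_def swap_root_Sp swap_root_square Sp_carrier)
  then show ?thesis unfolding has_root_def by blast
qed

lemma even_summand_is_Sp: "even_summand E \<Longrightarrow> is_Sp E"
  unfolding even_summand_def using wblock_Sp is_SpI by blast

lemma odd_summand_is_Sp: "odd_summand G \<Longrightarrow> is_Sp G"
  unfolding odd_summand_def using wblock_Sp is_SpI by blast

lemma minus_one_form_has_root: assumes "minus_one_form F" shows "has_root F"
proof -
  obtain Es Gs where F: "F = (diamond_sum Es \<diamond> diamond_sum Es) \<diamond> diamond_sum Gs"
    and Es: "\<forall>E\<in>set Es. even_summand E" and Gs: "\<forall>G\<in>set Gs. odd_summand G" using assms by (auto simp: minus_one_form_def)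
  have "has_root G" if "G \<in> set Gs" for G using odd_summand_sqrt Gs that unfolding has_root_def by blast
  moreover have "is_Sp (diamond_sum Es)" using Es even_summand_is_Sp by (intro is_Sp_diamond_sum) auto
  ultimately show ?thesis unfolding F by (intro has_root_diamond has_root_double has_root_diamond_sum)
qed

lemma wnf_even_summand: "s * s = 1 \<Longrightarrow> m \<ge> 1 \<Longrightarrow> even_summand (wnf m s (- 1))"
proof -
  assume s: "s * s = 1" and m: "m \<ge> 1"
  have "s \<in> {1, - 1}" using s by (auto simp: square_eq_1_iff)
  then show ?thesis unfolding even_summand_def wnf_def using wnf_rel[OF s, of m "- 1"] m by blast
qed

definition assemble :: "real list \<Rightarrow> real mat \<Rightarrow> (real \<Rightarrow> real mat) \<Rightarrow> real mat list \<Rightarrow> real mat list \<Rightarrow> real mat" where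
  "assemble ls M0 N Es Gs =
     M0 \<diamond> (diamond_sum (map (\<lambda>l. N l \<diamond> N l) ls) \<diamond> ((diamond_sum Es \<diamond> diamond_sum Es) \<diamond> diamond_sum Gs))"

text \<open>The list \<open>ls\<close> is fixed before the blocks are split off and may contain values that are not
  eigenvalues of \<open>M\<close>; their components \<open>N l\<close> are empty matrices. So \<open>ls\<close> stays the same in the induction.\<close>

definition root_form :: "real list \<Rightarrow> real mat \<Rightarrow> real mat \<Rightarrow> (real \<Rightarrow> real mat) \<Rightarrow> real mat list \<Rightarrow> real mat list \<Rightarrow> bool" where
  "root_form ls M M0 N Es Gs \<longleftrightarrow>
     is_Sp M0 \<and> cspectrum M0 \<inter> complex_of_real ` {..<0} = {} \<and>
     (\<forall>l\<in>set ls. (\<exists>k. wonenburger k (N l)) \<and> cspectrum (N l) \<subseteq> {complex_of_real l, complex_of_real (inverse l)}) \<and>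
     (\<forall>E\<in>set Es. even_summand E) \<and> (\<forall>G\<in>set Gs. odd_summand G) \<and> sim M (assemble ls M0 N Es Gs)"

lemma root_form_parts:
  assumes "root_form ls M M0 N Es Gs"
  shows "is_Sp M0" "l \<in> set ls \<Longrightarrow> is_Sp (N l)" "is_Sp (diamond_sum (map (\<lambda>l. N l \<diamond> N l) ls))"
    "is_Sp (diamond_sum Es)" "is_Sp (diamond_sum Gs)"
proof -
  show N: "l \<in> set ls \<Longrightarrow> is_Sp (N l)" for l using assms wonenburger_Sp is_SpI unfolding root_form_def by blast
  then show "is_Sp (diamond_sum (map (\<lambda>l. N l \<diamond> N l) ls))" by (intro is_Sp_diamond_sum) auto
  show "is_Sp M0" using assms by (simp add: root_form_def)
  show "is_Sp (diamond_sum Es)"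
    by (rule is_Sp_diamond_sum, rule even_summand_is_Sp) (use assms in \<open>simp add: root_form_def\<close>)
  show "is_Sp (diamond_sum Gs)"
    by (rule is_Sp_diamond_sum, rule odd_summand_is_Sp) (use assms in \<open>simp add: root_form_def\<close>)
qed

lemma root_form_add_pair:
  assumes rf: "root_form ls M' M0 N Es Gs" and ls: "distinct ls" "l \<in> set ls"
    and W: "wonenburger m W" "cspectrum W \<subseteq> {complex_of_real l, complex_of_real (inverse l)}"
    and M: "sim M ((W \<diamond> W) \<diamond> M')"
  shows "root_form ls M M0 (N(l := W \<diamond> N l)) Es Gs"
proof -
  let ?N = "N(l := W \<diamond> N l)"
  let ?P = "diamond_sum (map (\<lambda>l. N l \<diamond> N l) ls)" and ?Q = "(diamond_sum Es \<diamond> diamond_sum Es) \<diamond> diamond_sum Gs"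
  note p = root_form_parts[OF rf]
  have Q: "is_Sp ?Q" using p by simp
  have WS: "is_Sp W" using wonenburger_Sp[OF W(1)] is_SpI by blast
  have "sim ((W \<diamond> W) \<diamond> ?P) (diamond_sum (map ((\<lambda>l. N l \<diamond> N l)(l := (W \<diamond> W) \<diamond> (N l \<diamond> N l))) ls))"
    by (rule sim_absorb[OF ls]) (use WS p(2) in auto)
  also have "sim \<dots> (diamond_sum (map (\<lambda>l. ?N l \<diamond> ?N l) ls))"
    by (rule sim_diamond_sum) (use WS p(2) ls(2) in \<open>auto intro: sim_refl sim_interchange\<close>)
  finally have P: "sim ((W \<diamond> W) \<diamond> ?P) (diamond_sum (map (\<lambda>l. ?N l \<diamond> ?N l) ls))" .
  have "sim M ((W \<diamond> W) \<diamond> assemble ls M0 N Es Gs)"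
    by (rule sim_trans[OF M sim_diamond[OF sim_refl]]) (use WS rf in \<open>auto simp: root_form_def\<close>)
  also have "sim \<dots> (M0 \<diamond> ((W \<diamond> W) \<diamond> (?P \<diamond> ?Q)))"
    unfolding assemble_def by (rule sim_left_commute) (use WS p(1,3) Q in auto)
  also have "(W \<diamond> W) \<diamond> (?P \<diamond> ?Q) = ((W \<diamond> W) \<diamond> ?P) \<diamond> ?Q" using WS p(3) Q by (simp add: is_Sp_assoc)
  also have "sim (M0 \<diamond> \<dots>) (assemble ls M0 ?N Es Gs)"
    unfolding assemble_def by (rule sim_diamond[OF sim_refl[OF p(1)] sim_diamond[OF P sim_refl[OF Q]]])
  finally have fin: "sim M (assemble ls M0 ?N Es Gs)" .
  obtain k where "wonenburger k (N l)" using rf ls(2) unfolding root_form_def by blast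
  then have "wonenburger (m + k) (?N l)" using wonenburger_diamond[OF W(1)] by simp
  moreover have "cspectrum (?N l) \<subseteq> {complex_of_real l, complex_of_real (inverse l)}"
    using rf ls(2) W(2) cspectrum_is_Sp_diamond[OF WS p(2)[OF ls(2)]] unfolding root_form_def by auto
  ultimately show ?thesis using rf fin unfolding root_form_def by (metis fun_upd_apply)
qed

lemma root_form_add_even:
  assumes rf: "root_form ls M' M0 N Es Gs" and E: "even_summand E" and M: "sim M ((E \<diamond> E) \<diamond> M')"
  shows "root_form ls M M0 N (E # Es) Gs"
proof -
  let ?P = "diamond_sum (map (\<lambda>l. N l \<diamond> N l) ls)" and ?E = "diamond_sum Es" and ?G = "diamond_sum Gs"
  note p = root_form_parts[OF rf]
  have ES: "is_Sp E" by (rule even_summand_is_Sp[OF E])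
  have "sim M ((E \<diamond> E) \<diamond> assemble ls M0 N Es Gs)"
    by (rule sim_trans[OF M sim_diamond[OF sim_refl]]) (use ES rf in \<open>auto simp: root_form_def\<close>)
  also have "sim \<dots> (M0 \<diamond> ((E \<diamond> E) \<diamond> (?P \<diamond> ((?E \<diamond> ?E) \<diamond> ?G))))"
    unfolding assemble_def by (rule sim_left_commute) (use ES p in auto)
  also have "sim \<dots> (M0 \<diamond> (?P \<diamond> ((E \<diamond> E) \<diamond> ((?E \<diamond> ?E) \<diamond> ?G))))"
    by (rule sim_diamond[OF sim_refl[OF p(1)] sim_left_commute]) (use ES p in auto)
  also have "(E \<diamond> E) \<diamond> ((?E \<diamond> ?E) \<diamond> ?G) = ((E \<diamond> E) \<diamond> (?E \<diamond> ?E)) \<diamond> ?G" using ES p by (simp add: is_Sp_assoc)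
  also have "sim (M0 \<diamond> (?P \<diamond> \<dots>)) (assemble ls M0 N (E # Es) Gs)"
    unfolding assemble_def diamond_sum_Cons by (intro sim_diamond sim_interchange) (use ES p sim_refl in auto)
  finally show ?thesis using rf E unfolding root_form_def by simp
qed

lemma root_form_add_odd:
  assumes rf: "root_form ls M' M0 N Es Gs" and G: "odd_summand G" and M: "sim M (G \<diamond> M')"
  shows "root_form ls M M0 N Es (G # Gs)"
proof -
  let ?P = "diamond_sum (map (\<lambda>l. N l \<diamond> N l) ls)" and ?E = "diamond_sum Es \<diamond> diamond_sum Es" and ?G = "diamond_sum Gs"
  note p = root_form_parts[OF rf]
  have GS: "is_Sp G" by (rule odd_summand_is_Sp[OF G])
  have "sim M (G \<diamond> assemble ls M0 N Es Gs)"
    by (rule sim_trans[OF M sim_diamond[OF sim_refl]]) (use GS rf in \<open>auto simp: root_form_def\<close>)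
  also have "sim \<dots> (M0 \<diamond> (G \<diamond> (?P \<diamond> (?E \<diamond> ?G))))"
    unfolding assemble_def by (rule sim_left_commute) (use GS p in auto)
  also have "sim \<dots> (M0 \<diamond> (?P \<diamond> (G \<diamond> (?E \<diamond> ?G))))"
    by (rule sim_diamond[OF sim_refl[OF p(1)] sim_left_commute]) (use GS p in auto)
  also have "sim \<dots> (assemble ls M0 N Es (G # Gs))" unfolding assemble_def diamond_sum_Cons
    by (rule sim_diamond[OF sim_refl[OF p(1)] sim_diamond[OF sim_refl sim_left_commute]]) (use GS p in auto)
  finally show ?thesis using rf G unfolding root_form_def by simp
qed

text \<open>The blocks are split off from \<open>X\<close> and not from \<open>X\<^sup>2\<close>: then the remaining part of \<open>X\<^sup>2\<close> is again a
  square, and the induction on the dimension goes on until no negative eigenvalue is left.\<close>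

lemma square_normal_form:
  assumes ls: "distinct ls"
  shows "X \<in> Sp n \<Longrightarrow> (\<And>l. l < - 1 \<Longrightarrow> complex_of_real l \<in> cspectrum (X * X) \<Longrightarrow> l \<in> set ls) \<Longrightarrow>
    \<exists>M0 N Es Gs. root_form ls (X * X) M0 N Es Gs"
proof (induction n arbitrary: X rule: less_induct)
  case (less n)
  note X = less.prems(1)
  have XX: "X * X \<in> Sp n" using X Sp_mult by blast
  show ?case
  proof (cases "cspectrum (X * X) \<inter> complex_of_real ` {..<0} = {}")
    case True
    have zero: "diamond_sum (map (\<lambda>l. 0\<^sub>m 0 0 \<diamond> 0\<^sub>m 0 0) ls) = 0\<^sub>m 0 0" for ls :: "real list"
      by (induction ls) auto
    moreover have "wonenburger 0 (0\<^sub>m 0 0)"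
      unfolding wonenburger_def wonenburger_rel_def wblock_def
      by (intro exI[of _ "0\<^sub>m 0 0"]) (auto intro!: eq_matI)
    ultimately have "root_form ls (X * X) (X * X) (\<lambda>_. 0\<^sub>m 0 0) [] []"
      using True is_SpI[OF XX] sim_refl[OF is_SpI[OF XX]] by (auto simp: root_form_def assemble_def cspectrum_empty)
    then show ?thesis by blast
  next
    case False
    then obtain l where l: "l < 0" "complex_of_real l \<in> cspectrum (X * X)" by auto
    have ev: "eigenvalue (X * X) l" by (rule real_eigenvalue[OF Sp_carrier[OF XX] l(2)])
    interpret q: sqrt_data n X by unfold_locales (rule X)
    have step: "sim (X * X) (H * H \<diamond> X' * X') \<and> (\<exists>M0 N Es Gs. root_form ls (X' * X') M0 N Es Gs)"
      if H: "H \<in> Sp k" and k: "1 \<le> k" "k \<le> n" and X': "X' \<in> Sp (n - k)" and s: "symp_similar n X (H \<diamond> X')" for H X' k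
    proof
      have HH: "is_Sp (H * H)" "is_Sp (X' * X')" using H X' Sp_mult is_SpI by blast+
      have "symp_similar n (X * X) ((H \<diamond> X') * (H \<diamond> X'))" by (rule symp_similar_square[OF s])
      then show s2: "sim (X * X) (H * H \<diamond> X' * X')"
        using XX diamond_mult[OF Sp_carrier[OF H] Sp_carrier[OF X'] Sp_carrier[OF H] Sp_carrier[OF X']] by (auto simp: sim_def)
      have "cspectrum (X' * X') \<subseteq> cspectrum (X * X)"
        unfolding cspectrum_sim[OF s2] cspectrum_is_Sp_diamond[OF HH] by simp
      then show "\<exists>M0 N Es Gs. root_form ls (X' * X') M0 N Es Gs"
        using less.IH[of "n - k" X'] k X' less.prems(2) by fastforce
    qed
    consider (hyp) "l \<noteq> - 1"
      | (even) m s X' where "l = - 1" "s * s = 1" "m \<ge> 1" "X' \<in> Sp (n - (m + m))" "m + m \<le> n" "symp_similar n X (swap_root m (wnf m s (- 1)) \<diamond> X')"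
      | (odd) k s X' where "l = - 1" "s * s = 1" "odd k" "X' \<in> Sp (n - k)" "k \<le> n" "symp_similar n X (wnf k s 0 \<diamond> X')"
      using q.split_minus_one ev by metis
    then show ?thesis
    proof cases
      case hyp
      obtain m s X' where m: "m \<ge> 1" "s * s = 1" "X' \<in> Sp (n - (m + m))" "m + m \<le> n"
        "symp_similar n X (swap_root m (wnf m s ((l + 1 / l) / 2)) \<diamond> X')" using q.split_hyperbolic[OF l(1) hyp ev] by blast
      \<comment> \<open>the representative of the pair; \<open>(l + 1 / l) / 2\<close> is the same for both members\<close>
      define l' where "l' = (if l < - 1 then l else 1 / l)"
      have l': "l' < - 1" "(l + 1 / l) / 2 = (l' + 1 / l') / 2" using l(1) hyp by (auto simp: l'_def field_simps)
      have "1 / complex_of_real l \<in> cspectrum (X * X)" by (rule cspectrum_inverse(2)[OF XX l(2)])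
      then have "complex_of_real l' \<in> cspectrum (X * X)" using l(2) by (simp add: l'_def)
      then have l'ls: "l' \<in> set ls" using less.prems(2) l'(1) by blast
      let ?W = "wnf m s ((l' + 1 / l') / 2)"
      have W: "?W \<in> Sp m" "wonenburger m ?W" using wnf_Sp wnf_wonenburger m(2) by blast+
      have sp: "cspectrum ?W \<subseteq> {complex_of_real l', complex_of_real (inverse l')}"
        by (rule wnf_cspectrum[OF m(2)]) (use l'(1) in auto)
      have "1 \<le> m + m" using m(1) by simp
      from step[OF swap_root_Sp[OF W(1)] this m(4,3) m(5)[unfolded l'(2)]] show ?thesis
        unfolding swap_root_square[OF Sp_carrier[OF W(1)]] using root_form_add_pair[OF _ ls l'ls W(2) sp] by blast
    next
      case even
      let ?W = "wnf m s (- 1)"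
      have W: "?W \<in> Sp m" using wnf_Sp even(2) by blast
      have "1 \<le> m + m" using even(3) by simp
      from step[OF swap_root_Sp[OF W] this even(5,4,6)] show ?thesis
        unfolding swap_root_square[OF Sp_carrier[OF W]] using root_form_add_even[OF _ wnf_even_summand[OF even(2,3)]] by blast
    next
      case odd
      obtain j where k: "k = 2 * j + 1" using odd(3) by (rule oddE)
      have W: "wnf k s 0 \<in> Sp k" using wnf_Sp odd(2) by blast
      have "s = 1 \<or> s = - 1" using odd(2) by (simp add: square_eq_1_iff)
      then obtain G where G: "odd_summand G" "symp_similar k (wnf k s 0 * wnf k s 0) G" using wnf_odd_square[of s j] k by blast
      have sG: "sim (wnf k s 0 * wnf k s 0) G" using G(2) Sp_mult[OF W W] by (auto simp: sim_def)
      have "1 \<le> k" using k by simp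
      note st = step[OF W this odd(5,4,6)]
      have "is_Sp (X' * X')" using Sp_mult[OF odd(4) odd(4)] is_SpI by blast
      then have "sim (X * X) (G \<diamond> X' * X')" using sim_trans[OF conjunct1[OF st] sim_diamond[OF sG sim_refl]] by blast
      then show ?thesis using st root_form_add_odd[OF _ G(1)] by blast
    qed
  qed
qed

lemma finite_neg_reps: assumes "M \<in> carrier_mat n n" shows "finite (neg_reps M)"
proof -
  have "finite (cspectrum M)" unfolding cspectrum_def using card_finite_spectrum(1)[of "cmat M" n] assms by simp
  then have "finite (complex_of_real ` neg_reps M)" by (rule finite_subset[rotated]) (auto simp: neg_reps_def)
  then show ?thesis by (rule finite_imageD) (simp add: inj_on_def)
qed

lemma sim_symp_similar: "sim M N \<Longrightarrow> M \<in> Sp n \<Longrightarrow> symp_similar n M N"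
  unfolding sim_def using Sp_unique Sp_carrier by blast

theorem theoremD:
  fixes n :: nat and M :: "real mat"
  assumes "M \<in> Sp n"
  shows "(\<exists>X. symp_sqrt n M X) \<longleftrightarrow>
    (\<exists>n0 M0 (nl :: real \<Rightarrow> nat) (Ml :: real \<Rightarrow> real mat) n1 M1.
       symp_similar n M
         (M0 \<diamond> diamond_sum (map Ml (sorted_list_of_set (neg_reps M))) \<diamond> M1) \<and>
       (M0 \<in> Sp n0 \<and> cspectrum M0 \<inter> complex_of_real ` {..<0} = {}) \<and>
       (\<forall>l\<in>neg_reps M.
          Ml l \<in> Sp (nl l) \<and>
          cspectrum (Ml l) \<subseteq> {complex_of_real l, complex_of_real (inverse l)} \<and>
          even (nl l) \<and>
          (\<exists>k N. k < nl l \<and> wonenburger k N \<and> symp_similar (nl l) (Ml l) (N \<diamond> N))) \<and>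
       (M1 \<in> Sp n1 \<and> cspectrum M1 \<subseteq> {- 1} \<and>
          (\<exists>F. minus_one_form F \<and> symp_similar n1 M1 F)))" (is "?L \<longleftrightarrow> ?R")
proof
  assume ?L
  then obtain X where X: "X \<in> Sp n" "X * X = M" by (auto simp: symp_sqrt_def)
  define ls where "ls = sorted_list_of_set (neg_reps M)"
  have fin: "finite (neg_reps M)" by (rule finite_neg_reps[OF Sp_carrier[OF assms]])
  have ls: "distinct ls" "set ls = neg_reps M" using fin by (auto simp: ls_def)
  have neg: "l < - 1" if "l \<in> set ls" for l using that by (auto simp: ls(2) neg_reps_def)
  have cover: "l \<in> set ls" if "l < - 1" "complex_of_real l \<in> cspectrum (X * X)" for l
    using that cspectrum_inverse(2)[OF assms, of "complex_of_real l"] X(2)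
    by (auto simp: ls(2) neg_reps_def inverse_eq_divide)
  obtain M0 N Es Gs where rf: "root_form ls M M0 N Es Gs"
    using square_normal_form[OF ls(1) X(1) cover] unfolding X(2) by blast
  then have M0: "is_Sp M0" "cspectrum M0 \<inter> complex_of_real ` {..<0} = {}"
    and N: "\<forall>l\<in>set ls. (\<exists>k. wonenburger k (N l)) \<and> cspectrum (N l) \<subseteq> {complex_of_real l, complex_of_real (inverse l)}"
    and E: "\<forall>E\<in>set Es. even_summand E" and G: "\<forall>G\<in>set Gs. odd_summand G"
    and s: "sim M (assemble ls M0 N Es Gs)"
    unfolding root_form_def by blast+
  note p = root_form_parts[OF rf]
  define M1 where "M1 = (diamond_sum Es \<diamond> diamond_sum Es) \<diamond> diamond_sum Gs"
  have NS: "is_Sp (N l)" if "l \<in> set ls" for l by (rule p(2)[OF that])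
  note ES = p(4) and GS = p(5)
  have M1: "is_Sp M1" using ES GS by (simp add: M1_def)
  have "cspectrum (diamond_sum Es) \<subseteq> {- 1}"
    using E even_summand_is_Sp even_summand_cspectrum by (subst cspectrum_diamond_sum) blast+
  moreover have "cspectrum (diamond_sum Gs) \<subseteq> {- 1}"
    using G odd_summand_is_Sp odd_summand_cspectrum by (subst cspectrum_diamond_sum) blast+
  ultimately have M1c: "cspectrum M1 \<subseteq> {- 1}" using ES GS by (simp add: M1_def cspectrum_is_Sp_diamond)
  let ?P = "diamond_sum (map (\<lambda>l. N l \<diamond> N l) ls)"
  note P = p(3)
  have Nc: "cspectrum (N l \<diamond> N l) \<subseteq> {complex_of_real l, complex_of_real (inverse l)}" if "l \<in> set ls" for l
    using N that NS[OF that] by (simp add: cspectrum_is_Sp_diamond)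
  have "M0 \<diamond> (?P \<diamond> M1) = M0 \<diamond> ?P \<diamond> M1" using M0(1) P M1 by (simp add: is_Sp_assoc)
  then have sim: "sim M (M0 \<diamond> ?P \<diamond> M1)" using s by (simp add: M1_def assemble_def)
  define nl where "nl = (\<lambda>l. (SOME k. wonenburger k (N l)) + (SOME k. wonenburger k (N l)))"
  have wN: "wonenburger (SOME k. wonenburger k (N l)) (N l)" if "l \<in> set ls" for l using N that someI_ex by fast
  \<comment> \<open>no other component has the eigenvalue \<open>l\<close> of \<open>M\<close>, so the one that belongs to \<open>l\<close> is not empty\<close>
  have nl_pos: "nl l > 0" if l: "l \<in> set ls" for l
  proof (rule ccontr)
    assume "\<not> nl l > 0"
    then have "N l \<in> Sp 0" using wonenburger_Sp[OF wN[OF l]] by (simp add: nl_def)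
    then have "N l = 0\<^sub>m 0 0" by (rule Sp_zeroD)
    then have empty: "cspectrum (N l \<diamond> N l) = {}" by (simp add: cspectrum_empty)
    have "complex_of_real l \<in> cspectrum M" using l by (auto simp: ls(2) neg_reps_def)
    also have "cspectrum M = cspectrum M0 \<union> cspectrum ?P \<union> cspectrum M1"
      unfolding cspectrum_sim[OF sim] using M0(1) P M1 by (simp add: cspectrum_is_Sp_diamond)
    finally have "complex_of_real l \<in> cspectrum M0 \<union> cspectrum ?P \<union> cspectrum M1" .
    moreover have "complex_of_real l \<notin> cspectrum M0" using M0(2) neg[OF l] by auto
    moreover have "complex_of_real l \<notin> cspectrum M1"
    proof
      assume "complex_of_real l \<in> cspectrum M1"
      then have "complex_of_real l = complex_of_real (- 1)" using M1c by auto
      then show False using neg[OF l] unfolding of_real_eq_iff by simp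
    qed
    ultimately have "complex_of_real l \<in> cspectrum ?P" by blast
    moreover have "cspectrum ?P = (\<Union>l\<in>set ls. cspectrum (N l \<diamond> N l))"
      using NS by (subst cspectrum_diamond_sum) auto
    ultimately obtain l' where l': "l' \<in> set ls" "complex_of_real l \<in> cspectrum (N l' \<diamond> N l')" by auto
    then have "complex_of_real l = complex_of_real l' \<or> complex_of_real l = complex_of_real (inverse l')"
      using Nc[OF l'(1)] by blast
    then have "l = l' \<or> l = inverse l'" unfolding of_real_eq_iff .
    moreover have "inverse l' > - 1" using neg[OF l'(1)] by (simp add: field_simps)
    ultimately have "l = l'" using neg[OF l] by auto
    then show False using l'(2) empty by simp
  qed
  obtain n0 where n0: "M0 \<in> Sp n0" using M0(1) by (auto simp: is_Sp_def)
  obtain n1 where n1: "M1 \<in> Sp n1" using M1 by (auto simp: is_Sp_def)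
  have form: "\<exists>F. minus_one_form F \<and> symp_similar n1 M1 F"
    using E G symp_similar_refl[OF Sp_carrier[OF n1]] unfolding minus_one_form_def M1_def by blast
  have main: "symp_similar n M (M0 \<diamond> diamond_sum (map (\<lambda>l. N l \<diamond> N l) (sorted_list_of_set (neg_reps M))) \<diamond> M1)"
    using sim_symp_similar[OF sim assms] unfolding ls_def .
  have mid: "\<forall>l\<in>neg_reps M. N l \<diamond> N l \<in> Sp (nl l) \<and>
      cspectrum (N l \<diamond> N l) \<subseteq> {complex_of_real l, complex_of_real (inverse l)} \<and> even (nl l) \<and>
      (\<exists>k N'. k < nl l \<and> wonenburger k N' \<and> symp_similar (nl l) (N l \<diamond> N l) (N' \<diamond> N'))"
  proof
    fix l assume "l \<in> neg_reps M"
    then have l: "l \<in> set ls" by (simp add: ls(2))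
    have S: "N l \<diamond> N l \<in> Sp (nl l)" unfolding nl_def using wonenburger_Sp[OF wN[OF l]] by (intro diamond_Sp)
    moreover have "(SOME k. wonenburger k (N l)) < nl l" using nl_pos[OF l] by (simp add: nl_def)
    moreover have "even (nl l)" by (simp add: nl_def)
    ultimately show "N l \<diamond> N l \<in> Sp (nl l) \<and>
      cspectrum (N l \<diamond> N l) \<subseteq> {complex_of_real l, complex_of_real (inverse l)} \<and> even (nl l) \<and>
      (\<exists>k N'. k < nl l \<and> wonenburger k N' \<and> symp_similar (nl l) (N l \<diamond> N l) (N' \<diamond> N'))"
      using Nc[OF l] wN[OF l] symp_similar_refl[OF Sp_carrier[OF S]] by blast
  qed
  show ?R
    by (rule exI[of _ n0], rule exI[of _ M0], rule exI[of _ nl], rule exI[of _ "\<lambda>l. N l \<diamond> N l"],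
        rule exI[of _ n1], rule exI[of _ M1], intro conjI) (rule main n0 M0(2) mid n1 M1c form)+
next
  assume ?R
  then show ?L
  proof (elim exE conjE)
    fix n0 M0 nl Ml n1 M1 F
    assume s: "symp_similar n M (M0 \<diamond> diamond_sum (map Ml (sorted_list_of_set (neg_reps M))) \<diamond> M1)"
      and M0: "M0 \<in> Sp n0" "cspectrum M0 \<inter> complex_of_real ` {..<0} = {}"
      and Ml: "\<forall>l\<in>neg_reps M. Ml l \<in> Sp (nl l) \<and>
        cspectrum (Ml l) \<subseteq> {complex_of_real l, complex_of_real (inverse l)} \<and> even (nl l) \<and>
        (\<exists>k N. k < nl l \<and> wonenburger k N \<and> symp_similar (nl l) (Ml l) (N \<diamond> N))"
      and M1: "M1 \<in> Sp n1" and F: "minus_one_form F" "symp_similar n1 M1 F"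
    have fin: "finite (neg_reps M)" by (rule finite_neg_reps[OF Sp_carrier[OF assms]])
    have "has_root M0" using symp_sqrt_no_negative[OF M0(1,2)] by (auto simp: has_root_def)
    moreover have "has_root (Ml l)" if l: "l \<in> neg_reps M" for l
    proof -
      obtain k N where N: "wonenburger k N" "symp_similar (nl l) (Ml l) (N \<diamond> N)" "Ml l \<in> Sp (nl l)" using Ml l by blast
      have "has_root (N \<diamond> N)" using wonenburger_Sp[OF N(1)] is_SpI by (intro has_root_double) blast
      moreover have "sim (Ml l) (N \<diamond> N)" using N(2,3) by (auto simp: sim_def)
      ultimately show ?thesis using has_root_sim by blast
    qed
    then have "has_root (diamond_sum (map Ml (sorted_list_of_set (neg_reps M))))"
      using fin by (intro has_root_diamond_sum) auto
    moreover have "has_root M1"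
    proof -
      have "sim M1 F" using M1 F by (auto simp: sim_def)
      then show ?thesis using has_root_sim minus_one_form_has_root[OF F(1)] by blast
    qed
    ultimately have "has_root (M0 \<diamond> diamond_sum (map Ml (sorted_list_of_set (neg_reps M))) \<diamond> M1)"
      by (intro has_root_diamond)
    moreover have "sim M (M0 \<diamond> diamond_sum (map Ml (sorted_list_of_set (neg_reps M))) \<diamond> M1)"
      using s assms by (auto simp: sim_def)
    ultimately have "has_root M" using has_root_sim by blast
    then obtain m X where X: "X \<in> Sp m" "X * X = M" by (auto simp: has_root_def symp_sqrt_def)
    then have "M \<in> Sp m" using Sp_mult by blast
    then have "m = n" using Sp_unique Sp_carrier[OF assms] by (metis Sp_carrier assms)
    then show "\<exists>X. symp_sqrt n M X" using X by (auto simp: symp_sqrt_def)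
  qed
qed

end
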